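(* Let $\mathsf{k}$ be a field of characteristic zero and let $X=\{P_1,\dots,P_s\}$ be a set of $s$ distinct ($\mathsf{k}$-rational) points in $\mathbb{P}^2_{\mathsf{k}}$. Let $L_i$ be the linear form dual to $P_i$, and let $A$ be an Artinian Gorenstein quotient of $A(X)$ with dual generator $F=\sum_{i=1}^s\alpha_iL_i^d$, where $d\geq 2\tau(X)$ and $\alpha_i\in\mathsf{k}$, $\alpha_i\neq 0$ for every $i$. Suppose that for some integer $k$ with $1\leq k<\tau(X)$ the first difference of $h_A$ in degrees $0,\dots,\tau(X)$ is $$\Delta h_A=(1,2,h_2-3,\dots,2_k,\dots,2_{\tau(X)}),$$ that is, $\Delta h_A(0)=1$, $\Delta h_A(1)=2$, and $\Delta h_A(i)=2$ for all $k\leq i\leq\tau(X)$. Then there is a linear form $\ell$ such that $\det\mathrm{Hess}^j_\ell(F)\neq 0$ for every $k-1\leq j\leq\lfloor d/2\rfloor$.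
   Context: Let $S=\mathsf{k}[x_0,x_1,x_2]$ (standard grading) act on $R=\mathsf{k}[X_0,X_1,X_2]$ by letting $x_i$ act as $\partial/\partial X_i$; the action is denoted $\circ$. For $F\in R$ homogeneous of degree $d$, $F\ne 0$, the algebra with Macaulay dual generator $F$ is $A=S/\mathrm{Ann}_S(F)$, $\mathrm{Ann}_S(F)=\{g\in S: g\circ F=0\}$; it is Artinian Gorenstein of socle degree $d$. Its Hilbert function is $h_A(i)=h_i=\dim_{\mathsf{k}}A_i$, and $\Delta h_A(0)=h_A(0)$, $\Delta h_A(i)=h_A(i)-h_A(i-1)$ for $i\ge 1$. A subscript on an entry of the vector $\Delta h_A$ records the degree $i$ of that entry. For a finite set $X$ of $s$ distinct points in $\mathbb{P}^2_{\mathsf{k}}$, $I(X)\subset S$ is the homogeneous ideal generated by forms vanishing on $X$, $A(X)=S/I(X)$, $h_{A(X)}(i)=\dim_{\mathsf{k}}A(X)_i$, and $\tau(X)=\min\{i: h_{A(X)}(i)=s\}$. For $P=(a_0:a_1:a_2)$ (with a fixed choice of coordinates) the dual linear form is $L=a_0X_0+a_1X_1+a_2X_2\in R$. If $F=\sum_i\alpha_iL_i^d$ with the $L_i$ dual to the points $P_i\in X$, then $I(X)\subseteq\mathrm{Ann}_S(F)$, so $S/\mathrm{Ann}_S(F)$ is a quotient of $A(X)$. Higher Hessians: choose forms $\alpha^{(j)}_1,\alpha^{(j)}_2,\dots\in S_j$ whose classes form a $\mathsf{k}$-basis of $A_j$. The $j$-th Hessian matrix of $F$ has entries $(\mathrm{Hess}^j(F))_{u,v}=(\alpha^{(j)}_u\alpha^{(j)}_v)\circ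 F\in R$; its determinant is independent of the basis up to a nonzero constant. For a linear form $\ell=a_0x_0+a_1x_1+a_2x_2$, $\mathrm{Hess}^j_\ell(F)$ denotes this matrix evaluated at the point $(X_0,X_1,X_2)=(a_0,a_1,a_2)$. *)

theory Defs
  imports "HOL-Library.Poly_Mapping" "HOL-Library.Numeral_Type" "Jordan_Normal_Form.Determinant"
begin

text \<open>
  Ternary polynomials: the exponent vectors are indexed by the three elements 0, 1, 2 of the
  type 3, and the ring structure is the convolution product of \<^theory>\<open>HOL-Library.Poly_Mapping\<close>.
  The same type serves for S (variables x0, x1, x2) and for R (variables X0, X1, X2).
\<close>

type_synonym 'k pol = "(3 \<Rightarrow>\<^sub>0 nat) \<Rightarrow>\<^sub>0 'k"

definition smult3 :: "'k::field \<Rightarrow> 'k pol \<Rightarrow> 'k pol" where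
  "smult3 c f = Poly_Mapping.single 0 c * f"

definition mdeg :: "(3 \<Rightarrow>\<^sub>0 nat) \<Rightarrow> nat" where
  "mdeg m = (\<Sum>i\<in>UNIV. Poly_Mapping.lookup m i)"

text \<open>The homogeneous polynomials of degree n, including 0.\<close>

definition forms :: "nat \<Rightarrow> 'k::field pol set" where
  "forms n = {f. \<forall>m\<in>Poly_Mapping.keys f. mdeg m = n}"

definition eval3 :: "(3 \<Rightarrow> 'k::field) \<Rightarrow> 'k pol \<Rightarrow> 'k" where
  "eval3 p f = (\<Sum>m\<in>Poly_Mapping.keys f.
     Poly_Mapping.lookup f m * (\<Prod>i\<in>UNIV. p i ^ Poly_Mapping.lookup m i))"

definition var3 :: "3 \<Rightarrow> 'k::field pol" where
  "var3 i = Poly_Mapping.single (Poly_Mapping.single i 1) 1"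

definition linform :: "(3 \<Rightarrow> 'k::field) \<Rightarrow> 'k pol" where
  "linform a = (\<Sum>i\<in>UNIV. smult3 (a i) (var3 i))"

text \<open>
  Truncated subtraction of exponents is harmless here: a monomial not containing the i-th
  variable contributes with coefficient 0.
\<close>

definition partial3 :: "3 \<Rightarrow> 'k::field pol \<Rightarrow> 'k pol" where
  "partial3 i f = (\<Sum>m\<in>Poly_Mapping.keys f.
     Poly_Mapping.single (m - Poly_Mapping.single i 1)
       (of_nat (Poly_Mapping.lookup m i) * Poly_Mapping.lookup f m))"

text \<open>The action of S on R by differentiation.\<close>

definition act :: "'k::field pol \<Rightarrow> 'k pol \<Rightarrow> 'k pol"  (infixr "\<bullet>\<^sub>S" 75) where
  "g \<bullet>\<^sub>S F = (\<Sum>m\<in>Poly_Mapping.keys g. smult3 (Poly_Mapping.lookup g m)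
     ((partial3 0 ^^ Poly_Mapping.lookup m 0)
       ((partial3 1 ^^ Poly_Mapping.lookup m 1)
         ((partial3 2 ^^ Poly_Mapping.lookup m 2) F))))"

definition Ann :: "'k::field pol \<Rightarrow> 'k pol set" where
  "Ann F = {g. g \<bullet>\<^sub>S F = 0}"

text \<open>
  Points of the projective plane are given by chosen homogeneous coordinates
  \<^term>\<open>p :: 3 \<Rightarrow> 'k\<close>; two nonzero vectors give the same point iff they are proportional.
\<close>

definition same_point :: "(3 \<Rightarrow> 'k::field) \<Rightarrow> (3 \<Rightarrow> 'k) \<Rightarrow> bool" where
  "same_point p q \<longleftrightarrow> (\<exists>c. c \<noteq> 0 \<and> q = (\<lambda>i. c * p i))"

text \<open>Submodules of a ring over itself are its ideals, so \<^term>\<open>module.span (*)\<close> generates ideals.\<close>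

definition vanishing_ideal :: "(3 \<Rightarrow> 'k::field) set \<Rightarrow> 'k pol set" where
  "vanishing_ideal X = module.span (*) {f. (\<exists>n. f \<in> forms n) \<and> (\<forall>p\<in>X. eval3 p f = 0)}"

text \<open>
  For an ideal I of S, the degree-j component of S/I is the image of the forms of degree j.
  The list bs consists of forms of degree j whose classes modulo I are a basis of that
  component: they span it, and they are linearly independent.
\<close>

definition basis_of_component :: "'k::field pol set \<Rightarrow> nat \<Rightarrow> 'k pol list \<Rightarrow> bool" where
  "basis_of_component I j bs \<longleftrightarrow> set bs \<subseteq> forms j \<and>
     (\<forall>g\<in>forms j. \<exists>c. g - (\<Sum>u<length bs. smult3 (c u) (bs ! u)) \<in> I) \<and>
     (\<forall>c. (\<Sum>u<length bs. smult3 (c u) (bs ! u)) \<in> I \<longrightarrow> (\<forall>u<length bs. c u = 0))"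

text \<open>As for \<^const>\<open>vector_space.dim\<close>, the dimension is the size of an arbitrarily chosen basis.\<close>

definition hilb :: "'k::field pol set \<Rightarrow> nat \<Rightarrow> nat" where
  "hilb I j = length (SOME bs. basis_of_component I j bs)"

definition first_diff :: "(nat \<Rightarrow> nat) \<Rightarrow> nat \<Rightarrow> int" where
  "first_diff h i = (if i = 0 then int (h 0) else int (h i) - int (h (i - 1)))"

definition tau :: "(3 \<Rightarrow> 'k::field) set \<Rightarrow> nat" where
  "tau X = (LEAST i. hilb (vanishing_ideal X) i = card X)"

definition hess :: "'k::field pol \<Rightarrow> 'k pol list \<Rightarrow> 'k pol mat" where
  "hess F bs = mat (length bs) (length bs) (\<lambda>(u, v). (bs ! u * bs ! v) \<bullet>\<^sub>S F)"

text \<open>The Hessian matrix evaluated at the point whose coordinates are the coefficients of l.\<close>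

definition hess_at :: "'k::field pol \<Rightarrow> 'k pol \<Rightarrow> 'k pol list \<Rightarrow> 'k mat" where
  "hess_at l F bs =
     map_mat (eval3 (\<lambda>i. Poly_Mapping.lookup l (Poly_Mapping.single i 1))) (hess F bs)"

end

theory Submission
  imports Defs
begin

text \<open>
  Let U(j) be the space of linear relations among the values of the forms of degree j at the
  points. The hypothesis says that U(j) has dimension 2(tau-j) for j between k-1 and tau, and a
  form g represents an element of the kernel of the Hessian of order j at l exactly if the
  function with values alpha(i) l(P(i))^(d-2j) g(P(i)) lies in U(j).

  Let u, v be a basis of U(tau-1). The products of u and v with the three coordinates lie in
  U(tau-2), of dimension 4, so there are two linear syzygies between u and v. Their determinant is
  a conic containing the supports of u and v, and counting dimensions shows that there are
  2 tau + 1 points on the conic and that every U(j) in the given range is supported on them.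
  If no linear form annihilates a nonzero element of U(tau-1), the quotient u/v parametrizes the
  conic. Along a tangent line l the Hessian becomes a Hessian of a binary form at a power of a
  linear form, and it is nonsingular for a generic tangent by a Wronskian argument in
  characteristic 0. Otherwise the conic consists of two lines, with tau+1 points on the first and
  tau further points on the second, and l can be moved on both lines independently. For a generic
  position on the second line, its contribution to the kernel equations on the first line is a
  weight at the intersection point, and the binary argument applies again.
\<close>

subsection \<open>Binary forms\<close>

text \<open>One linear form has to serve all orders \<open>j\<close> at once. For each of the
  finitely many \<open>j < tau\<close> the parameters of \<open>l\<close> that fail form a finite
  set, and the field is infinite. From order \<open>tau\<close> on there are no nonzero relations,
  so \<open>l\<close> only has to miss the points. Relations are preferred to Hilbert functions
  because multiplying by a form turns them into relations of lower degree, and because u and v can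
  double as coordinates. No quadratic equation is ever solved: the parametrization u/v and the two
  lines come from linear algebra, so the field need not be algebraically closed. A tangent is taken
  since it pulls back to the square of a binary linear form. A general line would pull back to a
  product of two different factors, and the bound on the order of vanishing at a single point would
  not apply to its powers.\<close>

lemma homogeneous_system:
  fixes M :: "'e \<Rightarrow> 'a \<Rightarrow> 'k::field"
  assumes "finite E" "finite A" "card E < card A"
  shows "\<exists>x. (\<exists>a\<in>A. x a \<noteq> 0) \<and> (\<forall>e\<in>E. (\<Sum>a\<in>A. M e a * x a) = 0)"
  using assms
proof (induction E arbitrary: A M rule: finite_induct)
  case empty
  then obtain a where "a \<in> A" by fastforce
  then show ?case by (intro exI[of _ "\<lambda>_. 1"]) auto
next
  case (insert e E)
  show ?case
  proof (cases "\<forall>a\<in>A. M e a = 0")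
    case True
    have "card E < card A" using insert by simp
    from insert.IH[OF insert.prems(1) this, of M] obtain x
      where "\<exists>a\<in>A. x a \<noteq> 0" "\<forall>e\<in>E. (\<Sum>a\<in>A. M e a * x a) = 0" by blast
    with True show ?thesis by (intro exI[of _ x]) simp
  next
    case False
    then obtain a0 where a0: "a0 \<in> A" "M e a0 \<noteq> 0" by auto
    define B where "B = A - {a0}"
    have B: "finite B" "A = insert a0 B" "a0 \<notin> B" using a0 insert.prems by (auto simp: B_def)
    have "card E < card B" using insert.prems insert.hyps B by simp
    from insert.IH[OF B(1) this, of "\<lambda>e' a. M e' a - M e' a0 * M e a / M e a0"]
    obtain x where x: "\<exists>a\<in>B. x a \<noteq> 0"
      "\<And>e'. e' \<in> E \<Longrightarrow> (\<Sum>a\<in>B. (M e' a - M e' a0 * M e a / M e a0) * x a) = 0" by auto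
    define y where "y = x(a0 := - (\<Sum>a\<in>B. M e a * x a) / M e a0)"
    have yB: "(\<Sum>a\<in>B. M e' a * y a) = (\<Sum>a\<in>B. M e' a * x a)" for e'
      using B(3) by (intro sum.cong) (auto simp: y_def)
    have sumA: "(\<Sum>a\<in>A. M e' a * y a)
        = (\<Sum>a\<in>B. M e' a * x a) - M e' a0 * (\<Sum>a\<in>B. M e a * x a) / M e a0" for e'
      using B by (simp add: yB) (simp add: y_def)
    have "(\<Sum>a\<in>A. M e' a * y a) = 0" if "e' \<in> insert e E" for e'
    proof (cases "e' = e")
      case True
      then show ?thesis using a0 by (simp add: sumA)
    next
      case False
      then have "e' \<in> E" using that by simp
      from x(2)[OF this] show ?thesis
        unfolding sumA
        by (simp add: left_diff_distrib sum_subtractf sum_distrib_left sum_divide_distrib)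
           (simp add: ac_simps)
    qed
    moreover have "\<exists>a\<in>A. y a \<noteq> 0" using x(1) B by (auto simp: y_def)
    ultimately show ?thesis by blast
  qed
qed

section \<open>Wronskians and orders of vanishing in one variable\<close>

text \<open>Leading coefficients in \<open>f * pderiv h = pderiv f * h\<close> force a nonzero
  \<open>h\<close> to have the degree of \<open>f\<close>; here characteristic 0 enters. The
  equation is linear in \<open>h\<close>, so a multiple of \<open>f\<close> can be subtracted from
  \<open>g\<close> to cancel the leading coefficient, and then the difference must be zero.\<close>

lemma wronskian_eq_0_imp_multiple:
  fixes f g :: "'k::field_char_0 poly"
  assumes "f \<noteq> 0" "f * pderiv g = pderiv f * g"
  shows "\<exists>c. g = Polynomial.smult c f"
proof -
  have deg: "degree h = degree f" if "h \<noteq> 0" "f * pderiv h = pderiv f * h" for h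
  proof -
    have nz: "pderiv h \<noteq> 0" if "degree h > 0" for h :: "'k poly"
      using that pderiv_eq_0_iff[of h] by simp
    have lc: "lead_coeff (pderiv h) = of_nat (degree h) * lead_coeff h" if "degree h > 0" for h :: "'k poly"
      using that by (simp add: degree_pderiv coeff_pderiv)
    show ?thesis
    proof (cases "degree h = 0 \<or> degree f = 0")
      case True
      then show ?thesis
      proof
        assume "degree h = 0"
        then have "pderiv h = 0" by (simp add: pderiv_eq_0_iff)
        with that have "pderiv f = 0" by simp
        then show ?thesis using \<open>degree h = 0\<close> by (simp add: pderiv_eq_0_iff)
      next
        assume "degree f = 0"
        then have "pderiv f = 0" by (simp add: pderiv_eq_0_iff)
        with that assms have "pderiv h = 0" by simp
        then show ?thesis using \<open>degree f = 0\<close> by (simp add: pderiv_eq_0_iff)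
      qed
    next
      case False
      have "lead_coeff f * (of_nat (degree h) * lead_coeff h) = of_nat (degree f) * lead_coeff f * lead_coeff h"
        using that(2) lc[of h] lc[of f] False by (metis lead_coeff_mult gr0I)
      then have "of_nat (degree h) = (of_nat (degree f) :: 'k)"
        using that assms by auto
      then show ?thesis by simp
    qed
  qed
  show ?thesis
  proof (cases "g = 0")
    case True
    then show ?thesis by (intro exI[of _ 0]) simp
  next
    case False
    define c where "c = lead_coeff g / lead_coeff f"
    define h where "h = g - Polynomial.smult c f"
    have dg: "degree g = degree f" using deg False assms by blast
    have h: "f * pderiv h = pderiv f * h"
      using assms(2) by (simp add: h_def pderiv_diff pderiv_smult algebra_simps)
    have "h = 0"
    proof (rule ccontr)
      assume "h \<noteq> 0"
      then have "degree h = degree f" using deg h by blast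
      moreover have "coeff h (degree f) = 0" using dg assms(1) by (simp add: h_def c_def)
      ultimately show False using \<open>h \<noteq> 0\<close> by (metis leading_coeff_0_iff)
    qed
    then show ?thesis by (auto simp: h_def)
  qed
qed

lemma power_dvd_pderiv:
  fixes f :: "'k::field_char_0 poly"
  assumes "q ^ Suc n dvd f"
  shows "q ^ n dvd pderiv f"
proof -
  from assms obtain r where "f = q ^ Suc n * r" by (auto elim: dvdE)
  then have "pderiv f = q ^ n * (q * pderiv r + of_nat (Suc n) * pderiv q * r)"
    by (simp add: pderiv_mult pderiv_power_Suc algebra_simps del: power_Suc)
      (simp add: algebra_simps smult_add_left of_nat_poly)
  then show ?thesis by (metis dvd_triv_left)
qed

text \<open>
  The induction replaces a polynomial by its Wronskian with one of the generators, which lowers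
  both the number of generators and the order of vanishing by one.
\<close>

lemma finite_high_order_points:
  fixes f :: "'i \<Rightarrow> 'k::field_char_0 poly"
  assumes "finite J"
  shows "finite {x. \<exists>c. (\<Sum>i\<in>J. Polynomial.smult (c i) (f i)) \<noteq> 0 \<and>
                       [:-x, 1:] ^ card J dvd (\<Sum>i\<in>J. Polynomial.smult (c i) (f i))}"
  using assms
proof (induction J arbitrary: f rule: finite_induct)
  case empty
  then show ?case by simp
next
  case (insert j J)
  let ?S = "\<lambda>J f c. \<Sum>i\<in>J. Polynomial.smult (c i :: 'k) (f i)"
  let ?bad = "\<lambda>J f. {x. \<exists>c. ?S J f c \<noteq> 0 \<and> [:-x, 1:] ^ card J dvd ?S J f c}"
  show ?case
  proof (cases "f j = 0")
    case True
    have "?bad (insert j J) f \<subseteq> ?bad J f"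
      using True insert.hyps by (auto dest: dvd_mult_right simp del: mult_pCons_left)
    then show ?thesis using insert.IH finite_subset by blast
  next
    case False
    define w where "w = (\<lambda>i. f j * pderiv (f i) - pderiv (f j) * f i)"
    have "?bad (insert j J) f \<subseteq> ?bad J w \<union> {x. poly (f j) x = 0}"
    proof (intro subsetI, rule ccontr)
      fix x assume x: "x \<in> ?bad (insert j J) f" and nx: "x \<notin> ?bad J w \<union> {x. poly (f j) x = 0}"
      from x obtain c where c: "?S (insert j J) f c \<noteq> 0"
        "[:-x, 1:] ^ Suc (card J) dvd ?S (insert j J) f c" using insert.hyps by auto
      let ?g = "?S (insert j J) f c"
      have eq: "f j * pderiv ?g - pderiv (f j) * ?g = ?S J w c"
        using insert.hyps by (simp add: w_def pderiv_add pderiv_smult higher_pderiv_sum[of 1, simplified] sum_distrib_left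
            algebra_simps smult_diff_right sum_subtractf)
      have "[:-x, 1:] ^ card J dvd f j * pderiv ?g - pderiv (f j) * ?g"
        using power_dvd_pderiv[OF c(2)] power_le_dvd[OF c(2), of "card J"] by (intro dvd_diff dvd_mult) auto
      \<comment> \<open>If this Wronskian vanishes identically, the combination is a nonzero
        multiple of \<open>f j\<close>, so \<open>f j\<close> vanishes at \<open>x\<close>; this is
        why the roots of \<open>f j\<close> are set aside.\<close>
      with eq nx have "?S J w c = 0" by auto
      with eq have "f j * pderiv ?g = pderiv (f j) * ?g" by simp
      from wronskian_eq_0_imp_multiple[OF False this] obtain b where b: "?g = Polynomial.smult b (f j)" by auto
      with c(1) have "b \<noteq> 0" by auto
      have "[:-x, 1:] dvd ?g" using power_le_dvd[OF c(2), of 1] by simp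
      with b \<open>b \<noteq> 0\<close> have "[:-x, 1:] dvd f j" by (simp add: dvd_smult_iff)
      then show False using nx by (simp add: poly_eq_0_iff_dvd)
    qed
    moreover have "finite (?bad J w \<union> {x. poly (f j) x = 0})"
      using insert.IH poly_roots_finite[OF False] by simp
    ultimately show ?thesis using finite_subset by blast
  qed
qed

text \<open>A polynomial of degree at most n, read as the binary form of degree n it dehomogenizes.\<close>

definition heval :: "nat \<Rightarrow> 'k::field poly \<Rightarrow> 'k \<Rightarrow> 'k \<Rightarrow> 'k" where
  "heval n f a b = (\<Sum>k\<le>n. coeff f k * a ^ k * b ^ (n - k))"

lemma heval_0 [simp]: "heval n 0 a b = 0"
  by (simp add: heval_def)

lemma heval_add: "heval n (f + g) a b = heval n f a b + heval n g a b"
  by (simp add: heval_def algebra_simps sum.distrib)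

lemma heval_diff: "heval n (f - g) a b = heval n f a b - heval n g a b"
  by (simp add: heval_def algebra_simps sum_subtractf)

lemma heval_smult: "heval n (Polynomial.smult c f) a b = c * heval n f a b"
  by (simp add: heval_def algebra_simps sum_distrib_left)

lemma heval_sum: "heval n (\<Sum>i\<in>I. f i) a b = (\<Sum>i\<in>I. heval n (f i) a b)"
  by (induction I rule: infinite_finite_induct) (simp_all add: heval_add)

lemma heval_eq_poly:
  assumes "degree f \<le> n" "b \<noteq> 0"
  shows "heval n f a b = b ^ n * poly f (a / b)"
proof -
  have "heval n f a b = (\<Sum>k\<le>n. b ^ n * (coeff f k * (a / b) ^ k))"
    unfolding heval_def using assms by (intro sum.cong) (auto simp: field_simps power_diff)
  also have "\<dots> = b ^ n * (\<Sum>k\<le>degree f. coeff f k * (a / b) ^ k)"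
    unfolding sum_distrib_left using assms
    by (intro sum.mono_neutral_right) (auto simp: coeff_eq_0)
  finally show ?thesis by (simp add: poly_altdef)
qed

lemma heval_at_infinity: "heval n f a 0 = coeff f n * a ^ n"
proof -
  have "heval n f a 0 = (\<Sum>k\<in>{n}. coeff f k * a ^ k * 0 ^ (n - k))"
    unfolding heval_def by (intro sum.mono_neutral_right) auto
  then show ?thesis by simp
qed

lemma coeff_mult_degree_le:
  fixes f g :: "'k::field poly"
  assumes "degree f \<le> m" "degree g \<le> n"
  shows "coeff (f * g) (m + n) = coeff f m * coeff g n"
proof (cases "degree f = m \<and> degree g = n")
  case True
  then show ?thesis using coeff_mult_degree_sum by blast
next
  case False
  then have "degree f + degree g < m + n" using assms by linarith
  then have "coeff (f * g) (m + n) = 0"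
    using degree_mult_le[of f g] by (intro coeff_eq_0) linarith
  moreover have "coeff f m = 0 \<or> coeff g n = 0"
    using False assms by (meson coeff_eq_0 le_neq_implies_less)
  ultimately show ?thesis by auto
qed

lemma heval_mult:
  assumes "degree f \<le> m" "degree g \<le> n"
  shows "heval (m + n) (f * g) a b = heval m f a b * heval n g a b"
proof (cases "b = 0")
  case True
  then show ?thesis using coeff_mult_degree_le[OF assms] by (simp add: heval_at_infinity power_add)
next
  case False
  have "degree (f * g) \<le> m + n" using degree_mult_le[of f g] assms by linarith
  then show ?thesis using False assms by (simp add: heval_eq_poly power_add)
qed

lemma heval_1_0 [simp]: "heval 0 1 a b = 1"
  by (simp add: heval_def)

lemma heval_linear: "heval 1 [:p, q:] a b = p * b + q * a"
  by (simp add: heval_def)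

lemma degree_power_le_mult:
  fixes f :: "'k::field poly"
  assumes "degree f \<le> m" shows "degree (f ^ n) \<le> m * n"
  using degree_power_le[of f n] mult_le_mono1[OF assms, of n] by linarith

lemma heval_power:
  assumes "degree f \<le> m"
  shows "heval (m * n) (f ^ n) a b = heval m f a b ^ n"
proof (induction n)
  case (Suc n)
  show ?case using heval_mult[OF assms degree_power_le_mult[OF assms, of n], of a b] Suc by simp
qed simp

lemma heval_monom:
  assumes "k \<le> n"
  shows "heval n (monom 1 k) a b = a ^ k * b ^ (n - k)"
proof -
  have "heval n (monom 1 k) a b = (\<Sum>i\<in>{k}. coeff (monom 1 k) i * a ^ i * b ^ (n - i))"
    unfolding heval_def using assms by (intro sum.mono_neutral_right) auto
  then show ?thesis by simp
qed

lemma heval_homogeneous: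
  "heval n f (r * a) (r * b) = r ^ n * heval n f a b"
proof -
  have "r ^ k * r ^ (n - k) = r ^ n" if "k \<le> n" for k using that by (simp flip: power_add)
  then show ?thesis unfolding heval_def sum_distrib_left
    by (intro sum.cong) (auto simp: power_mult_distrib ac_simps)
qed

section \<open>Interpolation and Hessians on the projective line\<close>

text \<open>The pairs are homogeneous coordinates of pairwise distinct points of the projective
  line; the determinants exclude proportional pairs.\<close>

definition noncollinear :: "'i set \<Rightarrow> ('i \<Rightarrow> 'k::field) \<Rightarrow> ('i \<Rightarrow> 'k) \<Rightarrow> bool" where
  "noncollinear I a b \<longleftrightarrow> (\<forall>i\<in>I. a i \<noteq> 0 \<or> b i \<noteq> 0) \<and>
     (\<forall>i\<in>I. \<forall>j\<in>I. i \<noteq> j \<longrightarrow> a i * b j \<noteq> a j * b i)"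

text \<open>The product of the linear forms belonging to the other points has degree
  \<open>card I - 1\<close>; a power of a linear form that is nonzero at the chosen point fills up
  the degree to \<open>n\<close>.\<close>

lemma binary_lagrange:
  fixes a b :: "'i \<Rightarrow> 'k::field"
  assumes fin: "finite I" and nc: "noncollinear I a b" and i: "i \<in> I" and card: "card I \<le> Suc n"
  shows "\<exists>f. degree f \<le> n \<and> heval n f (a i) (b i) \<noteq> 0 \<and>
             (\<forall>j\<in>I - {i}. heval n f (a j) (b j) = 0)"
proof -
  have *: "\<exists>f. degree f \<le> card J \<and> heval (card J) f (a i) (b i) \<noteq> 0 \<and>
             (\<forall>j\<in>J. heval (card J) f (a j) (b j) = 0)"
    if "finite J" "J \<subseteq> I - {i}" for J
    using that
  proof (induction J rule: finite_induct)
    case empty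
    show ?case by (intro exI[of _ 1]) simp
  next
    case (insert j J)
    then obtain f where f: "degree f \<le> card J" "heval (card J) f (a i) (b i) \<noteq> 0"
      "\<And>j. j \<in> J \<Longrightarrow> heval (card J) f (a j) (b j) = 0" by blast
    let ?g = "[:- a j, b j:]"
    have g: "degree ?g \<le> 1" by simp
    have "degree (?g * f) \<le> 1 + card J" using degree_mult_le[of ?g f] f(1) g by linarith
    moreover have "heval (1 + card J) (?g * f) x y = (b j * x - a j * y) * heval (card J) f x y" for x y
      unfolding heval_mult[OF g f(1)] heval_linear by (simp add: algebra_simps)
    moreover have "b j * a i - a j * b i \<noteq> 0"
      using nc insert.prems i unfolding noncollinear_def by (auto simp: ac_simps)
    ultimately show ?case using insert.hyps f by (intro exI[of _ "?g * f"]) auto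
  qed
  obtain f where f: "degree f \<le> card (I - {i})" "heval (card (I - {i})) f (a i) (b i) \<noteq> 0"
    "\<And>j. j \<in> I - {i} \<Longrightarrow> heval (card (I - {i})) f (a j) (b j) = 0"
    using *[of "I - {i}"] fin by auto
  have ab: "a i \<noteq> 0 \<or> b i \<noteq> 0" using nc i unfolding noncollinear_def by auto
  obtain p q where pq: "p * b i + q * a i \<noteq> 0"
  proof (cases "b i = 0")
    case True then show ?thesis using that[of 0 1] ab by simp
  next
    case False then show ?thesis using that[of 1 0] by simp
  qed
  define r where "r = n - card (I - {i})"
  have n: "n = 1 * r + card (I - {i})" using card i fin by (simp add: r_def)
  have d: "degree ([:p, q:] ^ r) \<le> 1 * r" by (rule degree_power_le_mult) simp
  have ev: "heval n ([:p, q:] ^ r * f) x y = (p * y + q * x) ^ r * heval (card (I - {i})) f x y" for x y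
  proof -
    have "degree [:p, q:] \<le> 1" by simp
    from heval_power[OF this, of r x y] heval_mult[OF d f(1), of x y] show ?thesis
      unfolding n[symmetric] heval_linear by simp
  qed
  have "degree ([:p, q:] ^ r * f) \<le> n"
    using degree_mult_le[of "[:p, q:] ^ r" f] d f(1) n by linarith
  then show ?thesis using ev f pq by (intro exI[of _ "[:p, q:] ^ r * f"]) auto
qed

text \<open>Dimension at most \<open>r\<close> in elementary terms: a longest independent family in
  \<open>V\<close> has at most \<open>r\<close> members and, being longest, generates. The
  dependence hypothesis ranges over \<open>i \<le> r\<close>, hence over \<open>r + 1\<close>
  members.\<close>

lemma generating_family_of_bounded_length:
  fixes V :: "'k::field poly set"
  assumes comb: "\<And>(n::nat) c f. (\<And>i. i < n \<Longrightarrow> f i \<in> V) \<Longrightarrow> (\<Sum>i<n. Polynomial.smult (c i) (f i)) \<in> V"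
    and dep: "\<And>f :: nat \<Rightarrow> _. (\<And>i. i \<le> r \<Longrightarrow> f i \<in> V) \<Longrightarrow>
       \<exists>c. (\<exists>i\<le>r. c i \<noteq> 0) \<and> (\<Sum>i\<le>r. Polynomial.smult (c i) (f i)) = 0"
  obtains n f where "n \<le> r" "\<And>g. g \<in> V \<Longrightarrow> \<exists>c. g = (\<Sum>i<n. Polynomial.smult (c i) (f i :: 'k poly))"
proof -
  define indep where "indep = (\<lambda>n f. (\<forall>i<n. f i \<in> V) \<and>
     (\<forall>c :: nat \<Rightarrow> 'k. (\<Sum>i<n. Polynomial.smult (c i) (f i)) = 0 \<longrightarrow> (\<forall>i<n. c i = 0)))"
  have indepD: "c i = 0" if "indep n f" "(\<Sum>i<n. Polynomial.smult (c i) (f i)) = 0" "i < n" for n f c i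
    using that(1)[unfolded indep_def, THEN conjunct2, THEN spec, of c] that(2,3) by simp
  have bound: "n \<le> r" if "indep n f" for n f
  proof (rule ccontr)
    assume "\<not> n \<le> r"
    then have n: "{..r} \<subseteq> {..<n}" by auto
    obtain c where c: "\<exists>i\<le>r. c i \<noteq> 0" "(\<Sum>i\<le>r. Polynomial.smult (c i) (f i)) = 0"
    proof -
      have "f i \<in> V" if "i \<le> r" for i
        using \<open>indep n f\<close> n that unfolding indep_def by auto
      from dep[of f, OF this] that show ?thesis by blast
    qed
    have "(\<Sum>i<n. Polynomial.smult (if i \<le> r then c i else 0) (f i)) = (\<Sum>i\<le>r. Polynomial.smult (c i) (f i))"
      using n by (intro sum.mono_neutral_cong_right) auto
    with c(2) have "(\<Sum>i<n. Polynomial.smult (if i \<le> r then c i else 0) (f i)) = 0" by simp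
    from indepD[OF that this] have z: "\<And>i. i < n \<Longrightarrow> (if i \<le> r then c i else 0) = 0" .
    from c(1) obtain i where i: "i \<le> r" "c i \<noteq> 0" by blast
    with n have "i < n" by auto
    with z[of i] i show False by simp
  qed
  have "\<exists>f. indep 0 f" by (simp add: indep_def)
  then obtain n where n: "\<exists>f. indep n f" "\<And>n'. \<exists>f. indep n' f \<Longrightarrow> n' \<le> n"
    using GreatestI_ex_nat[of "\<lambda>n. \<exists>f. indep n f" r]
      Greatest_le_nat[of "\<lambda>n. \<exists>f. indep n f" _ r] bound by blast
  then obtain f where f: "indep n f" by blast
  have gen: "\<exists>c. g = (\<Sum>i<n. Polynomial.smult (c i) (f i))" if g: "g \<in> V" for g
  proof -
    let ?f = "f(n := g)"
    have "\<not> indep (Suc n) ?f" using n(2)[of "Suc n"] by auto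
    moreover have "\<forall>i<Suc n. ?f i \<in> V" using f g by (auto simp: indep_def less_Suc_eq)
    ultimately obtain c where c: "(\<Sum>i<Suc n. Polynomial.smult (c i) (?f i)) = 0" "\<exists>i<Suc n. c i \<noteq> 0"
      by (auto simp: indep_def)
    have s: "(\<Sum>i<n. Polynomial.smult (c i) (f i)) + Polynomial.smult (c n) g = 0"
      using c(1) by simp
    have "c n \<noteq> 0"
    proof
      assume "c n = 0"
      with s have "(\<Sum>i<n. Polynomial.smult (c i) (f i)) = 0" by simp
      from indepD[OF f this] have "\<forall>i<n. c i = 0" by blast
      with c(2) \<open>c n = 0\<close> show False by (auto simp: less_Suc_eq)
    qed
    then have "g = Polynomial.smult (- 1 / c n) (\<Sum>i<n. Polynomial.smult (c i) (f i))"
      using s by (simp add: add_eq_0_iff2)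
    also have "\<dots> = (\<Sum>i<n. Polynomial.smult (- 1 / c n * c i) (f i))"
      by (rule poly_eqI) (simp only: coeff_smult coeff_sum sum_distrib_left mult.assoc)
    finally show ?thesis by (intro exI)
  qed
  show ?thesis by (rule that[OF bound[OF f]]) (rule gen)
qed

text \<open>
  The last condition says that G lies in the kernel of the Hessian of order m, at a point given by
  x, of the binary form of degree N + m that is the sum of c i times the power of the linear form
  dual to (a i, b i). The forms of degree N satisfying it make up a space of dimension N - m, so
  for almost every x none of them vanishes to order N - m at x.
\<close>

lemma binary_hessian_nondegenerate:
  fixes a b c :: "'i \<Rightarrow> 'k::field_char_0"
  assumes fin: "finite I" and nc: "noncollinear I a b" and cI: "card I \<le> Suc N"
    and S: "m < card {i\<in>I. c i \<noteq> 0}" and mN: "m \<le> N"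
  shows "finite {x. \<exists>G. G \<noteq> 0 \<and> degree G \<le> m \<and> (\<forall>h. degree h \<le> m \<longrightarrow>
    (\<Sum>i\<in>I. c i * heval N ([:-x, 1:] ^ (N - m) * G) (a i) (b i) * heval m h (a i) (b i)) = 0)}"
proof -
  define V where "V = {f. degree f \<le> N \<and> (\<forall>h. degree h \<le> m \<longrightarrow>
    (\<Sum>i\<in>I. c i * heval N f (a i) (b i) * heval m h (a i) (b i)) = 0)}"
  obtain T where T: "T \<subseteq> {i\<in>I. c i \<noteq> 0}" "card T = Suc m" "finite T"
    by (rule obtain_subset_with_card_n[OF Suc_leI[OF S]])
  have comb: "(\<Sum>i<n. Polynomial.smult (e i) (f i)) \<in> V" if fV: "\<And>i. i < n \<Longrightarrow> f i \<in> V" for n :: nat and e f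
  proof -
    have "degree (\<Sum>i<n. Polynomial.smult (e i) (f i)) \<le> N"
      using fV unfolding V_def
      by (intro degree_sum_le) (auto intro: order_trans[OF degree_smult_le])
    moreover have "(\<Sum>i\<in>I. c i * heval N (\<Sum>k<n. Polynomial.smult (e k) (f k)) (a i) (b i) * heval m h (a i) (b i)) = 0"
      if h: "degree h \<le> m" for h
    proof -
      have "(\<Sum>i\<in>I. c i * heval N (\<Sum>k<n. Polynomial.smult (e k) (f k)) (a i) (b i) * heval m h (a i) (b i))
        = (\<Sum>k<n. e k * (\<Sum>i\<in>I. c i * heval N (f k) (a i) (b i) * heval m h (a i) (b i)))"
        unfolding heval_sum heval_smult sum_distrib_left sum_distrib_right
        by (subst sum.swap) (simp only: ac_simps)
      also have "\<dots> = 0" using fV h unfolding V_def by (intro sum.neutral) fastforce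
      finally show ?thesis .
    qed
    ultimately show ?thesis by (simp add: V_def)
  qed
  have "\<forall>t\<in>T. \<exists>f. degree f \<le> N \<and> heval N f (a t) (b t) \<noteq> 0 \<and> (\<forall>j\<in>I - {t}. heval N f (a j) (b j) = 0)"
    using binary_lagrange[OF fin nc _ cI] T(1) by auto
  then obtain L where L: "\<And>t. t \<in> T \<Longrightarrow> degree (L t) \<le> N" "\<And>t. t \<in> T \<Longrightarrow> heval N (L t) (a t) (b t) \<noteq> 0"
    "\<And>t j. t \<in> T \<Longrightarrow> j \<in> I \<Longrightarrow> j \<noteq> t \<Longrightarrow> heval N (L t) (a j) (b j) = 0"
    unfolding bchoice_iff by auto
  \<comment> \<open>The span of the \<open>L t\<close> meets \<open>V\<close> only in 0: testing
    against a form of degree \<open>m\<close> that isolates \<open>t\<close> among the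
    \<open>m + 1\<close> points of \<open>T\<close> leaves a single term, with nonzero weight. This
    complement of dimension \<open>m + 1\<close> bounds the dimension of \<open>V\<close>.\<close>
  have LV: "y t = 0" if V: "(\<Sum>t\<in>T. Polynomial.smult (y t) (L t)) \<in> V" and t: "t \<in> T" for y t
  proof -
    have "noncollinear T a b" using nc T(1) unfolding noncollinear_def by blast
    then obtain h where h: "degree h \<le> m" "heval m h (a t) (b t) \<noteq> 0"
      "\<And>j. j \<in> T \<Longrightarrow> j \<noteq> t \<Longrightarrow> heval m h (a j) (b j) = 0"
      using binary_lagrange[of T a b t m] T t by auto
    have ev: "heval N (\<Sum>t\<in>T. Polynomial.smult (y t) (L t)) (a i) (b i) = (if i \<in> T then y i * heval N (L i) (a i) (b i) else 0)"
      if "i \<in> I" for i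
    proof -
      have "heval N (\<Sum>t\<in>T. Polynomial.smult (y t) (L t)) (a i) (b i) = (\<Sum>t\<in>T. y t * heval N (L t) (a i) (b i))"
        by (simp add: heval_sum heval_smult)
      also have "\<dots> = (\<Sum>t\<in>T. if t = i then y i * heval N (L i) (a i) (b i) else 0)"
        using L(3) that by (intro sum.cong) auto
      finally show ?thesis using T by simp
    qed
    have "0 = (\<Sum>i\<in>I. c i * heval N (\<Sum>t\<in>T. Polynomial.smult (y t) (L t)) (a i) (b i) * heval m h (a i) (b i))"
      using V h(1) by (simp add: V_def)
    also have "\<dots> = (\<Sum>i\<in>I. if i = t then c t * (y t * heval N (L t) (a t) (b t)) * heval m h (a t) (b t) else 0)"
      using ev h(3) t by (intro sum.cong) auto
    also have "\<dots> = c t * (y t * heval N (L t) (a t) (b t)) * heval m h (a t) (b t)"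
      using t T(1) fin by auto
    finally show ?thesis using h(2) L(2)[OF t] T(1) t by auto
  qed
  have dep: "\<exists>e. (\<exists>i\<le>N - m. e i \<noteq> 0) \<and> (\<Sum>i\<le>N - m. Polynomial.smult (e i) (f i)) = 0"
    if f: "\<And>i. i \<le> N - m \<Longrightarrow> f i \<in> V" for f :: "nat \<Rightarrow> _"
  proof -
    \<comment> \<open>\<open>N + 1\<close> coefficient equations against
      \<open>(N - m + 1) + (m + 1)\<close> unknowns. In a solution the part from the
      \<open>L t\<close> is minus the part from \<open>V\<close>, so it lies in \<open>V\<close> and
      its coefficients are zero.\<close>
    have "card {..N} < card ({..N - m} <+> T)"
      using T mN by (simp add: card_Plus)
    then obtain z where z: "\<exists>u\<in>{..N - m} <+> T. z u \<noteq> 0"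
      "\<And>k. k \<le> N \<Longrightarrow> (\<Sum>u\<in>{..N - m} <+> T. coeff (case_sum f L u) k * z u) = 0"
      using homogeneous_system[of "{..N}" "{..N - m} <+> T" "\<lambda>k u. coeff (case_sum f L u) k"] T(3)
      by auto
    let ?f = "\<Sum>i\<le>N - m. Polynomial.smult (z (Inl i)) (f i)" and ?g = "\<Sum>t\<in>T. Polynomial.smult (z (Inr t)) (L t)"
    have "degree ?f \<le> N" "degree ?g \<le> N"
      using f L(1) T(3) by (auto intro!: degree_sum_le order_trans[OF degree_smult_le] simp: V_def)
    then have "degree (?f + ?g) \<le> N" by (rule degree_add_le)
    have fg: "?f + ?g = 0"
    proof (rule poly_eqI)
      fix k
      show "coeff (?f + ?g) k = coeff 0 k"
      proof (cases "k \<le> N")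
        case True
        then show ?thesis using z(2)[OF True] T(3)
          by (simp add: sum.Plus coeff_sum ac_simps)
      next
        case False
        then have "degree (?f + ?g) < k" using \<open>degree (?f + ?g) \<le> N\<close> by linarith
        then show ?thesis by (simp only: coeff_eq_0 coeff_0)
      qed
    qed
    then have "?g = (\<Sum>i<Suc (N - m). Polynomial.smult (- z (Inl i)) (f i))"
      by (simp add: eq_neg_iff_add_eq_0 sum_negf add.commute lessThan_Suc_atMost)
    then have "?g \<in> V" using comb[of "Suc (N - m)" f] f by (metis less_Suc_eq_le)
    then have "z (Inr t) = 0" if "t \<in> T" for t using LV[of "\<lambda>t. z (Inr t)"] that by blast
    then have "?f = 0" "\<exists>i\<le>N - m. z (Inl i) \<noteq> 0" using fg z(1) by auto
    then show ?thesis by (intro exI[of _ "\<lambda>i. z (Inl i)"]) simp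
  qed
  obtain n f where n: "n \<le> N - m" and gen: "\<And>g. g \<in> V \<Longrightarrow> \<exists>c. g = (\<Sum>i<n. Polynomial.smult (c i) (f i))"
    using generating_family_of_bounded_length[of V "N - m"] comb dep by blast
  let ?B = "{x. \<exists>c. (\<Sum>i<n. Polynomial.smult (c i) (f i)) \<noteq> 0 \<and> [:-x, 1:] ^ card {..<n} dvd (\<Sum>i<n. Polynomial.smult (c i) (f i))}"
  have "finite ?B" by (rule finite_high_order_points) simp
  moreover have "x \<in> ?B" if x: "G \<noteq> 0" "degree G \<le> m" "\<forall>h. degree h \<le> m \<longrightarrow>
    (\<Sum>i\<in>I. c i * heval N ([:-x, 1:] ^ (N - m) * G) (a i) (b i) * heval m h (a i) (b i)) = 0" for x G
  proof -
    let ?g = "[:-x, 1:] ^ (N - m) * G"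
    have "degree ?g \<le> N"
      using degree_mult_le[of "[:-x, 1:] ^ (N - m)" G] degree_power_le_mult[of "[:-x, 1:]" 1 "N - m"] x(2) mN
      by (simp add: degree_linear_power)
    then have "?g \<in> V" using x(3) by (simp add: V_def)
    then obtain e where e: "?g = (\<Sum>i<n. Polynomial.smult (e i) (f i))" using gen by blast
    have "?g \<noteq> 0" using x(1) by auto
    moreover have "[:-x, 1:] ^ n dvd ?g" using n by (intro dvd_mult2) (simp add: le_imp_power_dvd)
    ultimately show ?thesis using e by auto
  qed
  ultimately show ?thesis by (elim finite_subset[rotated]) blast
qed

lemma heval_split: "heval m h a b = (\<Sum>e<m. coeff h e * (a ^ e * b ^ (m - e))) + coeff h m * a ^ m"
  unfolding heval_def lessThan_Suc_atMost[symmetric] by (simp add: mult.assoc)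

lemma heval_Suc:
  assumes "degree f \<le> m"
  shows "heval (Suc m) f a b = b * heval m f a b"
  using heval_mult[of 1 1 f m a b] assms heval_linear[of 1 0 a b] by (simp add: one_pCons)

lemma coeff_linear_power_mult:
  fixes x :: "'k::field"
  assumes "degree G \<le> m" "m \<le> N"
  shows "coeff ([:-x, 1:] ^ (N - m) * G) N = coeff G m"
proof -
  have "coeff ([:-x, 1:] ^ (N - m)) (N - m) = 1"
    using lead_coeff_power[of "[:-x, 1:]" "N - m"] by (simp add: degree_linear_power)
  then show ?thesis
    using coeff_mult_degree_le[of "[:-x, 1:] ^ (N - m)" "N - m" G m] assms
    by (simp add: degree_linear_power)
qed

lemma degree_linear_power_mult:
  fixes x :: "'k::field"
  assumes "degree G \<le> m" "m \<le> N"
  shows "degree ([:-x, 1:] ^ (N - m) * G) \<le> N"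
  using degree_mult_le[of "[:-x, 1:] ^ (N - m)" G] assms by (simp add: degree_linear_power)

lemma heval_linear_power_mult:
  fixes x :: "'k::field"
  assumes "degree G \<le> m" "m \<le> N"
  shows "heval N ([:-x, 1:] ^ (N - m) * G) a b = (a - x * b) ^ (N - m) * heval m G a b"
proof -
  have lin: "degree [:-x, 1:] \<le> 1" by simp
  have "degree ([:-x, 1:] ^ (N - m)) \<le> N - m" by (simp add: degree_linear_power)
  from heval_mult[OF this assms(1), of a b] heval_power[OF lin, of "N - m" a b] assms(2)
  show ?thesis unfolding heval_linear by simp
qed

text \<open>The correction term is the contribution of a point at infinity of arbitrary weight.\<close>

lemma binary_hessian_nondegenerate_infinity:
  fixes a b c :: "'i \<Rightarrow> 'k::field_char_0"
  assumes fin: "finite I" and nc: "noncollinear I a b" and cI: "card I \<le> N"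
    and S: "m < card {i\<in>I. c i \<noteq> 0 \<and> b i \<noteq> 0}" and mN: "m \<le> N"
  shows "finite {x. \<exists>G. G \<noteq> 0 \<and> degree G \<le> m \<and> (\<forall>h. degree h \<le> m \<longrightarrow>
    (\<Sum>i\<in>I. c i * heval N ([:-x, 1:] ^ (N - m) * G) (a i) (b i) * heval m h (a i) (b i))
      + r * coeff G m * coeff h m = 0)}" (is "finite ?bad")
proof -
  \<comment> \<open>\<open>None\<close> is the point at infinity. A point of \<open>I\<close> lying
    there is absorbed into its weight, which may cancel; hence the hypothesis counts only points
    with \<open>b i \<noteq> 0\<close>.\<close>
  define J where "J = insert None (Some ` {i\<in>I. b i \<noteq> 0})"
  define a' where "a' = case_option 1 a"
  define b' where "b' = case_option 0 b"
  define c' where "c' = case_option (r + (\<Sum>i\<in>{i\<in>I. b i = 0}. c i * a i ^ (N + m))) c"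
  have finJ: "finite J" using fin by (simp add: J_def)
  have ncJ: "noncollinear J a' b'"
    using nc unfolding noncollinear_def J_def a'_def b'_def by auto
  have "card J \<le> Suc (card {i\<in>I. b i \<noteq> 0})"
    using fin unfolding J_def by (simp add: card_insert_if card_image)
  also have "card {i\<in>I. b i \<noteq> 0} \<le> card I" using fin by (intro card_mono) auto
  finally have cJ: "card J \<le> Suc N" using cI by simp
  have "card {i\<in>I. c i \<noteq> 0 \<and> b i \<noteq> 0} = card (Some ` {i\<in>I. c i \<noteq> 0 \<and> b i \<noteq> 0})"
    by (simp add: card_image)
  also have "\<dots> \<le> card {i\<in>J. c' i \<noteq> 0}"
    using finJ by (intro card_mono) (auto simp: J_def c'_def)
  finally have SJ: "m < card {i\<in>J. c' i \<noteq> 0}" using S by simp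
  have eq: "(\<Sum>i\<in>J. c' i * heval N ([:-x, 1:] ^ (N - m) * G) (a' i) (b' i) * heval m h (a' i) (b' i))
    = (\<Sum>i\<in>I. c i * heval N ([:-x, 1:] ^ (N - m) * G) (a i) (b i) * heval m h (a i) (b i))
      + r * coeff G m * coeff h m" if G: "degree G \<le> m" for x G h
  proof -
    let ?t = "\<lambda>i. c i * heval N ([:-x, 1:] ^ (N - m) * G) (a i) (b i) * heval m h (a i) (b i)"
    have "(\<Sum>i\<in>J. c' i * heval N ([:-x, 1:] ^ (N - m) * G) (a' i) (b' i) * heval m h (a' i) (b' i))
      = (r + (\<Sum>i\<in>{i\<in>I. b i = 0}. c i * a i ^ (N + m))) * coeff G m * coeff h m + (\<Sum>i\<in>{i\<in>I. b i \<noteq> 0}. ?t i)"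
      unfolding J_def using fin
      by (simp add: sum.reindex a'_def b'_def c'_def heval_at_infinity coeff_linear_power_mult[OF G mN])
    also have "(\<Sum>i\<in>{i\<in>I. b i \<noteq> 0}. ?t i) = (\<Sum>i\<in>I. ?t i) - (\<Sum>i\<in>{i\<in>I. b i = 0}. ?t i)"
    proof -
      have "(\<Sum>i\<in>I. ?t i) = (\<Sum>i\<in>{i\<in>I. b i \<noteq> 0} \<union> {i\<in>I. b i = 0}. ?t i)"
        by (intro sum.cong) auto
      also have "\<dots> = (\<Sum>i\<in>{i\<in>I. b i \<noteq> 0}. ?t i) + (\<Sum>i\<in>{i\<in>I. b i = 0}. ?t i)"
        using fin by (intro sum.union_disjoint) auto
      finally show ?thesis by simp
    qed
    also have "(\<Sum>i\<in>{i\<in>I. b i = 0}. ?t i) = (\<Sum>i\<in>{i\<in>I. b i = 0}. c i * a i ^ (N + m)) * coeff G m * coeff h m"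
      unfolding sum_distrib_right
      by (intro sum.cong) (auto simp: heval_at_infinity coeff_linear_power_mult[OF G mN] power_add)
    finally show ?thesis by (simp add: algebra_simps)
  qed
  have "?bad = {x. \<exists>G. G \<noteq> 0 \<and> degree G \<le> m \<and> (\<forall>h. degree h \<le> m \<longrightarrow>
    (\<Sum>i\<in>J. c' i * heval N ([:-x, 1:] ^ (N - m) * G) (a' i) (b' i) * heval m h (a' i) (b' i)) = 0)}"
    by (simp add: eq cong: conj_cong)
  also have "finite \<dots>" by (rule binary_hessian_nondegenerate[OF finJ ncJ cJ SJ mN])
  finally show ?thesis .
qed

text \<open>A form \<open>G\<close> of degree \<open>m\<close> with \<open>coeff G m = 0\<close> is
  divisible by the second coordinate, and so is every test monomial with \<open>e < m\<close>.
  Removing one factor from each lowers \<open>N\<close> and \<open>m\<close> by one, keeps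
  \<open>N - m\<close>, and multiplies the weights by \<open>(b i)\<^sup>2\<close>. On the second of
  two lines this handles kernel elements that vanish at the meeting point.\<close>

lemma binary_hessian_nondegenerate_vanishing_at_infinity:
  fixes a b c :: "'i \<Rightarrow> 'k::field_char_0"
  assumes fin: "finite I" and nc: "noncollinear I a b" and cI: "card I \<le> N"
    and S: "m \<le> card {i\<in>I. c i \<noteq> 0}" and mN: "m \<le> N" and b: "\<And>i. i \<in> I \<Longrightarrow> b i \<noteq> 0"
  shows "finite {x. \<exists>G. G \<noteq> 0 \<and> degree G \<le> m \<and> coeff G m = 0 \<and> (\<forall>e<m.
    (\<Sum>i\<in>I. c i * heval N ([:-x, 1:] ^ (N - m) * G) (a i) (b i) * (a i ^ e * b i ^ (m - e))) = 0)}"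
    (is "finite ?bad")
proof (cases m)
  case 0
  have "?bad = {}" unfolding 0 by (auto simp: leading_coeff_0_iff[symmetric] simp del: leading_coeff_0_iff)
  then show ?thesis by (simp only: finite.emptyI)
next
  case (Suc m')
  then obtain N' where N': "N = Suc N'" using mN by (cases N) auto
  have mN': "m' \<le> N'" "N - m = N' - m'" using mN Suc N' by auto
  have "{i\<in>I. c i * (b i)\<^sup>2 \<noteq> 0} = {i\<in>I. c i \<noteq> 0}" using b by auto
  then have S': "m' < card {i\<in>I. c i * (b i)\<^sup>2 \<noteq> 0}" using S Suc by simp
  have cI': "card I \<le> Suc N'" using cI N' by simp
  have "?bad \<subseteq> {x. \<exists>G. G \<noteq> 0 \<and> degree G \<le> m' \<and> (\<forall>h. degree h \<le> m' \<longrightarrow>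
    (\<Sum>i\<in>I. c i * (b i)\<^sup>2 * heval N' ([:-x, 1:] ^ (N' - m') * G) (a i) (b i) * heval m' h (a i) (b i)) = 0)}"
  proof (intro subsetI CollectI)
    fix x assume "x \<in> ?bad"
    then obtain G where G: "G \<noteq> 0" "degree G \<le> m" "coeff G m = 0"
      and sum0: "\<And>e. e < m \<Longrightarrow> (\<Sum>i\<in>I. c i * heval N ([:-x, 1:] ^ (N - m) * G) (a i) (b i) * (a i ^ e * b i ^ (m - e))) = 0"
      by blast
    have degG: "degree G \<le> m'"
      using G Suc by (metis le_SucE leading_coeff_0_iff)
    let ?f = "[:-x, 1:] ^ (N' - m') * G"
    have hf: "heval N ?f p q = q * heval N' ?f p q" for p q
      unfolding N' by (rule heval_Suc[OF degree_linear_power_mult[OF degG mN'(1)]])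
    have "(\<Sum>i\<in>I. c i * (b i)\<^sup>2 * heval N' ?f (a i) (b i) * heval m' h (a i) (b i)) = 0" for h
    proof -
      have "(\<Sum>i\<in>I. c i * (b i)\<^sup>2 * heval N' ?f (a i) (b i) * heval m' h (a i) (b i))
        = (\<Sum>i\<in>I. \<Sum>e\<le>m'. coeff h e * (c i * heval N ?f (a i) (b i) * (a i ^ e * b i ^ (m - e))))"
        unfolding heval_def[of m'] sum_distrib_left hf
        by (intro sum.cong) (auto simp: Suc power2_eq_square Suc_diff_le ac_simps)
      also have "\<dots> = (\<Sum>e\<le>m'. coeff h e * (\<Sum>i\<in>I. c i * heval N ?f (a i) (b i) * (a i ^ e * b i ^ (m - e))))"
        unfolding sum_distrib_left by (rule sum.swap)
      also have "\<dots> = 0" using sum0 Suc mN'(2) by simp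
      finally show ?thesis .
    qed
    then show "\<exists>G. G \<noteq> 0 \<and> degree G \<le> m' \<and> (\<forall>h. degree h \<le> m' \<longrightarrow>
      (\<Sum>i\<in>I. c i * (b i)\<^sup>2 * heval N' ([:-x, 1:] ^ (N' - m') * G) (a i) (b i) * heval m' h (a i) (b i)) = 0)"
      using G(1) degG by blast
  qed
  moreover have "finite {x. \<exists>G. G \<noteq> 0 \<and> degree G \<le> m' \<and> (\<forall>h. degree h \<le> m' \<longrightarrow>
    (\<Sum>i\<in>I. c i * (b i)\<^sup>2 * heval N' ([:-x, 1:] ^ (N' - m') * G) (a i) (b i) * heval m' h (a i) (b i)) = 0)}"
    by (rule binary_hessian_nondegenerate[OF fin nc cI' S' mN'(1)])
  ultimately show ?thesis by (rule finite_subset)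
qed

subsection \<open>Ternary forms and differentiation\<close>

abbreviation eval_mono :: "(3 \<Rightarrow> 'k::field) \<Rightarrow> (3 \<Rightarrow>\<^sub>0 nat) \<Rightarrow> 'k" where
  "eval_mono p m \<equiv> \<Prod>i\<in>UNIV. p i ^ Poly_Mapping.lookup m i"

lemma UNIV_3: "(UNIV :: 3 set) = {0, 1, 2}"
proof -
  have "x \<in> {0, 1, 2}" for x :: 3
  proof (induct x)
    case (of_int z)
    then have "z = 0 \<or> z = 1 \<or> z = 2" by auto
    then show ?case by auto
  qed
  then show ?thesis by blast
qed

lemma distinct_3: "(0::3) \<noteq> 1" "(0::3) \<noteq> 2" "(1::3) \<noteq> 2"
  by (simp_all add: num1_eq1)

lemma sum_3: "(\<Sum>i\<in>(UNIV::3 set). f i) = f 0 + f 1 + f 2"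
  unfolding UNIV_3 using distinct_3 by (simp add: add.assoc)

lemma prod_3: "(\<Prod>i\<in>(UNIV::3 set). f i) = f 0 * f 1 * f 2"
  unfolding UNIV_3 using distinct_3 by (simp add: mult.assoc)

lemma poly_mapping_sum_singles: "(\<Sum>m\<in>Poly_Mapping.keys f. Poly_Mapping.single m (Poly_Mapping.lookup f m)) = f"
proof (rule poly_mapping_eqI)
  fix n
  have "Poly_Mapping.lookup (\<Sum>m\<in>Poly_Mapping.keys f. Poly_Mapping.single m (Poly_Mapping.lookup f m)) n
      = (\<Sum>m\<in>Poly_Mapping.keys f. if m = n then Poly_Mapping.lookup f n else 0)"
    unfolding lookup_sum by (intro sum.cong) (auto simp: lookup_single)
  also have "\<dots> = Poly_Mapping.lookup f n" by (simp add: not_in_keys_iff_lookup_eq_zero)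
  finally show "Poly_Mapping.lookup (\<Sum>m\<in>Poly_Mapping.keys f. Poly_Mapping.single m (Poly_Mapping.lookup f m)) n
      = Poly_Mapping.lookup f n" .
qed

lemma smult3_single: "smult3 c (Poly_Mapping.single m x) = Poly_Mapping.single m (c * x)"
  by (simp add: smult3_def mult_single)

lemma smult3_add: "smult3 c (f + g) = smult3 c f + smult3 c g"
  by (simp add: smult3_def algebra_simps)

lemma smult3_add_left: "smult3 (c + d) f = smult3 c f + smult3 d f"
  by (simp add: smult3_def single_add algebra_simps)

lemma smult3_smult3: "smult3 c (smult3 d f) = smult3 (c * d) f"
  by (simp add: smult3_def mult_single flip: mult.assoc)

lemma smult3_0_left [simp]: "smult3 0 f = 0"
  by (simp add: smult3_def)

lemma smult3_0_right [simp]: "smult3 c 0 = 0"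
  by (simp add: smult3_def)

lemma smult3_1 [simp]: "smult3 1 f = f"
  by (simp add: smult3_def)

lemma smult3_sum: "smult3 c (\<Sum>i\<in>A. f i) = (\<Sum>i\<in>A. smult3 c (f i))"
  by (simp add: smult3_def sum_distrib_left)

lemma smult3_sum_left: "smult3 (\<Sum>i\<in>A. c i) f = (\<Sum>i\<in>A. smult3 (c i) f)"
  by (induction A rule: infinite_finite_induct) (simp_all add: smult3_add_left)

lemma smult3_mult: "smult3 c f * g = smult3 c (f * g)" "f * smult3 c g = smult3 c (f * g)"
  by (simp_all add: smult3_def ac_simps)

lemma lookup_smult3: "Poly_Mapping.lookup (smult3 c f) m = c * Poly_Mapping.lookup f m"
proof -
  have "smult3 c f = (\<Sum>m\<in>Poly_Mapping.keys f. Poly_Mapping.single m (c * Poly_Mapping.lookup f m))"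
    by (subst poly_mapping_sum_singles[of f, symmetric]) (simp add: smult3_sum smult3_single)
  then have "Poly_Mapping.lookup (smult3 c f) m
      = (\<Sum>n\<in>Poly_Mapping.keys f. if n = m then c * Poly_Mapping.lookup f m else 0)"
    by (simp only: lookup_sum) (intro sum.cong, auto simp: lookup_single)
  then show ?thesis by (simp add: not_in_keys_iff_lookup_eq_zero)
qed

lemma eval3_superset:
  assumes "finite A" "Poly_Mapping.keys f \<subseteq> A"
  shows "eval3 p f = (\<Sum>m\<in>A. Poly_Mapping.lookup f m * eval_mono p m)"
  unfolding eval3_def using assms
  by (intro sum.mono_neutral_left) (auto simp: not_in_keys_iff_lookup_eq_zero)

lemma eval3_add: "eval3 p (f + g) = eval3 p f + eval3 p g"
proof -
  let ?A = "Poly_Mapping.keys f \<union> Poly_Mapping.keys g"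
  have "Poly_Mapping.keys (f + g) \<subseteq> ?A" by (rule keys_add)
  then show ?thesis
    by (simp add: eval3_superset[of ?A] lookup_add distrib_right sum.distrib)
qed

lemma eval3_0 [simp]: "eval3 p 0 = 0"
  by (simp add: eval3_def)

lemma eval3_single: "eval3 p (Poly_Mapping.single m c) = c * eval_mono p m"
  by (cases "c = 0") (simp_all add: eval3_def)

lemma eval3_sum: "eval3 p (\<Sum>i\<in>A. f i) = (\<Sum>i\<in>A. eval3 p (f i))"
  by (induction A rule: infinite_finite_induct) (simp_all add: eval3_add)

lemma eval3_mult: "eval3 p (f * g) = eval3 p f * eval3 p g"
proof -
  have single: "eval3 p (Poly_Mapping.single m c * Poly_Mapping.single n d)
      = eval3 p (Poly_Mapping.single m c) * eval3 p (Poly_Mapping.single n d)" for m n c d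
    by (simp add: mult_single eval3_single lookup_add power_add prod.distrib)
  show ?thesis
    by (subst (1 2 3 4) poly_mapping_sum_singles[symmetric])
       (simp only: sum_product eval3_sum single)
qed

lemma eval3_smult3: "eval3 p (smult3 c f) = c * eval3 p f"
  by (simp add: smult3_def eval3_mult eval3_single)

lemma eval3_diff: "eval3 p (f - g) = eval3 p f - eval3 p g"
  using eval3_add[of p "f - g" g] by simp

lemma eval3_1 [simp]: "eval3 p 1 = 1"
  using eval3_single[of p 0 1] by simp

lemma eval3_power: "eval3 p (f ^ n) = eval3 p f ^ n"
  by (induction n) (simp_all add: eval3_mult)

lemma eval3_prod: "eval3 p (\<Prod>i\<in>A. f i) = (\<Prod>i\<in>A. eval3 p (f i))"
  by (induction A rule: infinite_finite_induct) (simp_all add: eval3_mult)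

lemma lookup_single_eq_if: "Poly_Mapping.lookup (Poly_Mapping.single a (b::'b::zero)) c = (if a = c then b else 0)"
  by (simp add: lookup_single)

lemma eval3_linform: "eval3 p (linform a) = (\<Sum>i\<in>UNIV. a i * p i)"
proof -
  have "eval3 p (var3 j) = p j" for j
  proof -
    have "eval3 p (var3 j) = (\<Prod>i\<in>UNIV. if i = j then p j else 1)"
      unfolding var3_def eval3_single mult_1 by (intro prod.cong) (auto simp: lookup_single_eq_if)
    then show ?thesis by simp
  qed
  then show ?thesis by (simp add: linform_def eval3_sum eval3_smult3)
qed

lemma lookup_linform: "Poly_Mapping.lookup (linform a) (Poly_Mapping.single i 1) = a i"
proof -
  have "Poly_Mapping.single j (1::nat) = Poly_Mapping.single i 1 \<longleftrightarrow> j = i" for j :: 3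
    by (metis lookup_single_eq lookup_single_not_eq zero_neq_one)
  then have "Poly_Mapping.lookup (linform a) (Poly_Mapping.single i 1) = (\<Sum>j\<in>UNIV. if j = i then a i else 0)"
    unfolding linform_def lookup_sum lookup_smult3 var3_def
    by (intro sum.cong) (auto simp: lookup_single_eq_if)
  then show ?thesis by simp
qed

lemma mdeg_add: "mdeg (m + n) = mdeg m + mdeg n"
  by (simp add: mdeg_def lookup_add sum.distrib)

lemma zero_in_forms [simp]: "0 \<in> forms n"
  by (simp add: forms_def)

lemma forms_add: "f \<in> forms n \<Longrightarrow> g \<in> forms n \<Longrightarrow> f + g \<in> forms n"
  using keys_add[of f g] by (auto simp: forms_def)

lemma forms_mult: "f \<in> forms m \<Longrightarrow> g \<in> forms n \<Longrightarrow> f * g \<in> forms (m + n)"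
  using keys_mult[of f g] by (auto simp: forms_def mdeg_add)

lemma single_in_forms: "mdeg m = n \<Longrightarrow> Poly_Mapping.single m c \<in> forms n"
  by (simp add: forms_def)

lemma forms_smult3: "f \<in> forms n \<Longrightarrow> smult3 c f \<in> forms n"
  using forms_mult[OF single_in_forms[of 0 0 c], of f n] by (simp add: smult3_def mdeg_def)

lemma forms_sum: "(\<And>i. i \<in> A \<Longrightarrow> f i \<in> forms n) \<Longrightarrow> (\<Sum>i\<in>A. f i) \<in> forms n"
  by (induction A rule: infinite_finite_induct) (auto intro: forms_add)

lemma forms_diff: "f \<in> forms n \<Longrightarrow> g \<in> forms n \<Longrightarrow> f - g \<in> forms n"
  using forms_add[of f n "smult3 (-1) g"] forms_smult3[of g n "-1"]
  by (simp add: smult3_def single_uminus)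

lemma one_in_forms: "1 \<in> forms 0"
  using single_in_forms[of 0 0 1] by (simp add: mdeg_def)

lemma forms_power: "f \<in> forms m \<Longrightarrow> f ^ n \<in> forms (m * n)"
  by (induction n) (auto simp: one_in_forms intro: forms_mult)

lemma forms_prod: "(\<And>i. i \<in> A \<Longrightarrow> f i \<in> forms 1) \<Longrightarrow> finite A \<Longrightarrow> (\<Prod>i\<in>A. f i) \<in> forms (card A)"
  by (induction A rule: infinite_finite_induct) (use forms_mult[of _ 1] in \<open>fastforce simp: one_in_forms\<close>)+

lemma linform_in_forms: "linform a \<in> forms 1"
proof -
  have "mdeg (Poly_Mapping.single i 1) = 1" for i
    by (simp add: mdeg_def lookup_single_eq_if)
  then show ?thesis unfolding linform_def var3_def
    by (intro forms_sum forms_smult3 single_in_forms) simp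
qed

section \<open>Differentiation of powers of linear forms\<close>

lemma partial3_superset:
  assumes "finite A" "Poly_Mapping.keys f \<subseteq> A"
  shows "partial3 i f = (\<Sum>m\<in>A. Poly_Mapping.single (m - Poly_Mapping.single i 1)
       (of_nat (Poly_Mapping.lookup m i) * Poly_Mapping.lookup f m))"
  unfolding partial3_def using assms
  by (intro sum.mono_neutral_left) (auto simp: not_in_keys_iff_lookup_eq_zero)

lemma partial3_add: "partial3 i (f + g) = partial3 i f + partial3 i g"
proof -
  let ?A = "Poly_Mapping.keys f \<union> Poly_Mapping.keys g"
  have "Poly_Mapping.keys (f + g) \<subseteq> ?A" by (rule keys_add)
  then show ?thesis
    by (simp add: partial3_superset[of ?A] lookup_add distrib_left single_add sum.distrib)
qed

lemma partial3_0 [simp]: "partial3 i 0 = 0"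
  by (simp add: partial3_def)

lemma partial3_single: "partial3 i (Poly_Mapping.single m c) =
    Poly_Mapping.single (m - Poly_Mapping.single i 1) (of_nat (Poly_Mapping.lookup m i) * c)"
  by (cases "c = 0") (simp_all add: partial3_def)

lemma partial3_sum: "partial3 i (\<Sum>j\<in>A. f j) = (\<Sum>j\<in>A. partial3 i (f j))"
  by (induction A rule: infinite_finite_induct) (simp_all add: partial3_add)

lemma partial3_mult: "partial3 i (f * g) = partial3 i f * g + f * partial3 i g"
proof -
  have shift: "m - Poly_Mapping.single i 1 + n = m + n - Poly_Mapping.single i 1"
    if "Poly_Mapping.lookup m i \<noteq> 0" for m n :: "3 \<Rightarrow>\<^sub>0 nat"
    using that by (intro poly_mapping_eqI) (auto simp: lookup_add lookup_minus lookup_single_eq_if)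
  have single: "partial3 i (Poly_Mapping.single m c * Poly_Mapping.single n d)
      = partial3 i (Poly_Mapping.single m c) * Poly_Mapping.single n d
        + Poly_Mapping.single m c * partial3 i (Poly_Mapping.single n d)" for m n and c d :: 'a
    using shift[of m n] shift[of n m]
    by (cases "Poly_Mapping.lookup m i = 0"; cases "Poly_Mapping.lookup n i = 0")
       (simp_all add: mult_single partial3_single lookup_add add.commute algebra_simps flip: single_add)
  have "partial3 i ((\<Sum>m\<in>Poly_Mapping.keys f. Poly_Mapping.single m (Poly_Mapping.lookup f m))
          * (\<Sum>n\<in>Poly_Mapping.keys g. Poly_Mapping.single n (Poly_Mapping.lookup g n)))
      = partial3 i (\<Sum>m\<in>Poly_Mapping.keys f. Poly_Mapping.single m (Poly_Mapping.lookup f m))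
          * (\<Sum>n\<in>Poly_Mapping.keys g. Poly_Mapping.single n (Poly_Mapping.lookup g n))
        + (\<Sum>m\<in>Poly_Mapping.keys f. Poly_Mapping.single m (Poly_Mapping.lookup f m))
          * partial3 i (\<Sum>n\<in>Poly_Mapping.keys g. Poly_Mapping.single n (Poly_Mapping.lookup g n))"
    by (simp only: sum_product partial3_sum single sum.distrib)
  then show ?thesis by (simp only: poly_mapping_sum_singles)
qed

lemma partial3_smult3: "partial3 i (smult3 c f) = smult3 c (partial3 i f)"
  by (simp add: smult3_def partial3_mult partial3_single)

lemma partial3_linform: "partial3 i (linform a) = smult3 (a i) 1"
proof -
  have "partial3 i (var3 j :: 'a pol) = (if j = i then 1 else 0)" for j
    by (simp add: var3_def partial3_single lookup_single_eq_if)
  then have "partial3 i (linform a) = (\<Sum>j\<in>UNIV. if j = i then smult3 (a i) 1 else 0)"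
    unfolding linform_def partial3_sum partial3_smult3 by (intro sum.cong) auto
  then show ?thesis by simp
qed

lemma partial3_linform_power:
  "partial3 i (linform a ^ Suc n) = smult3 (of_nat (Suc n) * a i) (linform a ^ n)"
proof (induction n)
  case 0
  have "partial3 i 1 = (0 :: 'a pol)"
    using partial3_single[of i 0 "1::'a"] by simp
  then show ?case by (simp add: partial3_linform)
next
  case (Suc n)
  have "partial3 i (linform a * linform a ^ Suc n)
      = smult3 (a i) (linform a ^ Suc n) + smult3 (of_nat (Suc n) * a i) (linform a ^ Suc n)"
    unfolding partial3_mult partial3_linform Suc by (simp add: smult3_mult)
  then show ?case by (simp add: algebra_simps flip: smult3_add_left)
qed

lemma partial3_funpow_linform_power:
  fixes a :: "3 \<Rightarrow> 'k::field_char_0"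
  assumes "k \<le> n"
  shows "(partial3 i ^^ k) (smult3 c (linform a ^ n))
    = smult3 (fact n / fact (n - k) * a i ^ k * c) (linform a ^ (n - k))"
  using assms
proof (induction k)
  case (Suc k)
  then have n: "n - k = Suc (n - Suc k)" by simp
  have f: "(fact (n - k) :: 'k) = of_nat (n - k) * fact (n - Suc k)"
    unfolding n by simp
  show ?case using Suc unfolding n
    by (simp add: partial3_smult3 partial3_linform_power smult3_smult3 del: power_Suc)
       (simp add: f n ac_simps)
qed simp

lemma partial3_funpow_sum: "(partial3 i ^^ k) (\<Sum>j\<in>A. f j) = (\<Sum>j\<in>A. (partial3 i ^^ k) (f j))"
  by (induction k) (simp_all add: partial3_sum)

text \<open>Each derivative of a power of \<open>linform a\<close> produces a coordinate of
  \<open>a\<close> and the next lower power, so a monomial of degree \<open>j\<close> acts through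
  its value at the point and the factor \<open>fact d / fact (d - j)\<close>. Annihilation thus
  becomes a question about values at the points.\<close>

lemma act_sum_powers:
  fixes P :: "'i \<Rightarrow> 3 \<Rightarrow> 'k::field_char_0"
  assumes g: "g \<in> forms j" and j: "j \<le> d"
  shows "g \<bullet>\<^sub>S (\<Sum>i\<in>A. smult3 (\<alpha> i) (linform (P i) ^ d))
     = (\<Sum>i\<in>A. smult3 (fact d / fact (d - j) * \<alpha> i * eval3 (P i) g) (linform (P i) ^ (d - j)))"
proof -
  have mon: "(partial3 0 ^^ Poly_Mapping.lookup m 0) ((partial3 1 ^^ Poly_Mapping.lookup m 1)
       ((partial3 2 ^^ Poly_Mapping.lookup m 2) (smult3 c (linform a ^ d))))
     = smult3 (fact d / fact (d - j) * c * eval_mono a m) (linform a ^ (d - j))"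
    if "m \<in> Poly_Mapping.keys g" for m c and a :: "3 \<Rightarrow> 'k"
  proof -
    let ?m = "Poly_Mapping.lookup m"
    have "?m 0 + ?m 1 + ?m 2 = j" using g that by (simp add: forms_def mdeg_def sum_3)
    then have le: "?m 2 \<le> d" "?m 1 \<le> d - ?m 2" "?m 0 \<le> d - ?m 2 - ?m 1"
      and eq: "d - ?m 2 - ?m 1 - ?m 0 = d - j" using j by auto
    show ?thesis
      by (simp add: partial3_funpow_linform_power le eq prod_3 ac_simps del: diff_diff_left)
  qed
  have "g \<bullet>\<^sub>S (\<Sum>i\<in>A. smult3 (\<alpha> i) (linform (P i) ^ d))
      = (\<Sum>m\<in>Poly_Mapping.keys g. \<Sum>i\<in>A. smult3 (Poly_Mapping.lookup g m * (fact d / fact (d - j) * \<alpha> i * eval_mono (P i) m))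
           (linform (P i) ^ (d - j)))"
    unfolding act_def by (intro sum.cong) (simp_all add: partial3_funpow_sum mon smult3_sum smult3_smult3)
  also have "\<dots> = (\<Sum>i\<in>A. \<Sum>m\<in>Poly_Mapping.keys g. smult3 (Poly_Mapping.lookup g m * (fact d / fact (d - j) * \<alpha> i * eval_mono (P i) m))
           (linform (P i) ^ (d - j)))" by (rule sum.swap)
  also have "\<dots> = (\<Sum>i\<in>A. smult3 (fact d / fact (d - j) * \<alpha> i * eval3 (P i) g) (linform (P i) ^ (d - j)))"
    by (intro sum.cong) (simp_all add: eval3_def sum_distrib_left ac_simps flip: smult3_sum_left)
  finally show ?thesis .
qed

subsection \<open>Relations among points of the plane\<close>

definition dot3 :: "(3 \<Rightarrow> 'k::field) \<Rightarrow> (3 \<Rightarrow> 'k) \<Rightarrow> 'k" where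
  "dot3 a p = (\<Sum>i\<in>UNIV. a i * p i)"

lemma eval3_linform_dot3: "eval3 p (linform a) = dot3 a p"
  by (simp add: eval3_linform dot3_def)

lemma dot3_add: "dot3 (\<lambda>c. a c + b c) p = dot3 a p + dot3 b p"
  by (simp add: dot3_def sum.distrib distrib_right)

lemma dot3_diff: "dot3 (\<lambda>c. a c - b c) p = dot3 a p - dot3 b p"
  by (simp add: dot3_def sum_subtractf left_diff_distrib)

lemma dot3_smult: "dot3 (\<lambda>c. r * a c) p = r * dot3 a p"
  by (simp add: dot3_def sum_distrib_left ac_simps)

lemma dot3_sum: "dot3 (\<lambda>c. \<Sum>k\<in>A. a k c) p = (\<Sum>k\<in>A. dot3 (a k) p)"
  unfolding dot3_def sum_distrib_right by (rule sum.swap)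

lemma dot3_unit: "dot3 (\<lambda>c. if c = k then r else 0) p = r * p k"
proof -
  have "dot3 (\<lambda>c. if c = k then r else 0) p = (\<Sum>c\<in>UNIV. if c = k then r * p k else 0)"
    unfolding dot3_def by (intro sum.cong) auto
  then show ?thesis by simp
qed

text \<open>Stated over a commutative ring because it is also applied to vectors of polynomials,
  where it yields the parametrization of a conic.\<close>

definition cross3 :: "(3 \<Rightarrow> 'a) \<Rightarrow> (3 \<Rightarrow> 'a) \<Rightarrow> 3 \<Rightarrow> 'a::comm_ring" where
  "cross3 a b c = (if c = 0 then a 1 * b 2 - a 2 * b 1
     else if c = 1 then a 2 * b 0 - a 0 * b 2 else a 0 * b 1 - a 1 * b 0)"

lemma cross3_simps: "cross3 a b 0 = a 1 * b 2 - a 2 * b 1" "cross3 a b 1 = a 2 * b 0 - a 0 * b 2"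
  "cross3 a b 2 = a 0 * b 1 - a 1 * b 0"
  using distinct_3 by (auto simp: cross3_def)

lemma all_3: "(\<forall>c::3. Q c) \<longleftrightarrow> Q 0 \<and> Q 1 \<and> Q 2"
  using UNIV_3 by (metis UNIV_I empty_iff insert_iff)

lemma all_cross3_0_imp:
  assumes "\<forall>c. cross3 a b c = 0"
  shows "a c * b c' = a c' * b c"
proof -
  have e: "a 1 * b 2 = a 2 * b 1" "a 2 * b 0 = a 0 * b 2" "a 0 * b 1 = a 1 * b 0"
    using assms unfolding all_3 cross3_simps by simp_all
  have "\<forall>c c'. a c * b c' = a c' * b c" unfolding all_3 using e by simp
  then show ?thesis by blast
qed

lemma cross3_nonzero:
  fixes a b :: "3 \<Rightarrow> 'k::field"
  assumes "\<And>x y. \<forall>c. x * a c + y * b c = 0 \<Longrightarrow> x = 0 \<and> y = 0"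
  shows "\<exists>c. cross3 a b c \<noteq> 0"
proof (rule ccontr)
  assume "\<not> ?thesis"
  then have *: "a c * b c' = a c' * b c" for c c' using all_cross3_0_imp by blast
  obtain c0 where "a c0 \<noteq> 0" using assms[of 1 0] by auto
  moreover have "b c0 = 0 \<and> - a c0 = 0" using *[of _ c0] by (intro assms) (simp add: ac_simps)
  ultimately show False by simp
qed

text \<open>By the triple product identity the cross product of \<open>p\<close> with
  \<open>cross3 a b\<close> is \<open>dot3 b p\<close> times \<open>a\<close> minus
  \<open>dot3 a p\<close> times \<open>b\<close>, hence zero. So \<open>p\<close> is proportional to
  \<open>cross3 a b\<close>, which is nonzero by independence.\<close>

lemma multiple_of_cross3:
  fixes a b p :: "3 \<Rightarrow> 'k::field"
  assumes p: "dot3 a p = 0" "dot3 b p = 0"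
    and ind: "\<And>x y. \<forall>c. x * a c + y * b c = 0 \<Longrightarrow> x = 0 \<and> y = 0"
  shows "\<exists>r. \<forall>c. p c = r * cross3 a b c"
proof -
  obtain c0 where c0: "cross3 a b c0 \<noteq> 0" using cross3_nonzero[OF ind] by blast
  have e: "a 0 * p 0 + a 1 * p 1 + a 2 * p 2 = 0" "b 0 * p 0 + b 1 * p 1 + b 2 * p 2 = 0"
    using p by (simp_all add: dot3_def sum_3)
  have "cross3 p (cross3 a b) c = 0" for c
  proof -
    let ?e = "\<lambda>c. a c * (b 0 * p 0 + b 1 * p 1 + b 2 * p 2) - b c * (a 0 * p 0 + a 1 * p 1 + a 2 * p 2)"
    have "p 1 * (a 0 * b 1 - a 1 * b 0) - p 2 * (a 2 * b 0 - a 0 * b 2) = ?e 0"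
      "p 2 * (a 1 * b 2 - a 2 * b 1) - p 0 * (a 0 * b 1 - a 1 * b 0) = ?e 1"
      "p 0 * (a 2 * b 0 - a 0 * b 2) - p 1 * (a 1 * b 2 - a 2 * b 1) = ?e 2"
      by (simp_all add: algebra_simps)
    then have "\<forall>c. cross3 p (cross3 a b) c = 0" unfolding all_3 cross3_simps e by simp
    then show ?thesis by blast
  qed
  then have "p c * cross3 a b c0 = p c0 * cross3 a b c" for c using all_cross3_0_imp by blast
  then show ?thesis using c0 by (intro exI[of _ "p c0 / cross3 a b c0"]) (simp add: field_simps)
qed

lemma reciprocal_basis:
  fixes a b f p :: "3 \<Rightarrow> 'k::field"
  shows "p c * dot3 f (cross3 a b)
    = dot3 a p * cross3 b f c + dot3 b p * cross3 f a c + dot3 f p * cross3 a b c"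
proof -
  have "\<forall>c. p c * dot3 f (cross3 a b)
    = dot3 a p * cross3 b f c + dot3 b p * cross3 f a c + dot3 f p * cross3 a b c"
    unfolding all_3 cross3_simps dot3_def sum_3 by (simp add: algebra_simps)
  then show ?thesis by blast
qed

text \<open>Some entry of \<open>cross3 a b\<close> is nonzero, and the corresponding coordinate
  function as \<open>f\<close> makes the determinant nonzero; \<open>reciprocal_basis\<close> is
  then Cramer's rule.\<close>

lemma complete_to_coordinates:
  fixes a b :: "3 \<Rightarrow> 'k::field"
  assumes "\<And>x y. \<forall>c. x * a c + y * b c = 0 \<Longrightarrow> x = 0 \<and> y = 0"
  obtains f r0 r1 r2 where "\<And>p c. p c = r0 c * dot3 a p + r1 c * dot3 b p + r2 c * dot3 f p"
proof -
  obtain c0 where c0: "cross3 a b c0 \<noteq> 0" using cross3_nonzero[OF assms] by blast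
  define f where "f = (\<lambda>c. if c = c0 then 1 else 0 :: 'k)"
  let ?D = "dot3 f (cross3 a b)"
  have "?D \<noteq> 0" using c0 by (simp add: f_def dot3_unit)
  show ?thesis
  proof (rule that)
    fix p :: "3 \<Rightarrow> 'k" and c
    have "p c = (p c * ?D) / ?D" using \<open>?D \<noteq> 0\<close> by simp
    then show "p c = (cross3 b f c / ?D) * dot3 a p + (cross3 f a c / ?D) * dot3 b p
        + (cross3 a b c / ?D) * dot3 f p"
      unfolding reciprocal_basis by (simp add: add_divide_distrib ac_simps)
  qed
qed

text \<open>The form g composed with a parametrized curve, dehomogenized.\<close>

definition subst_poly :: "(3 \<Rightarrow> 'k::field poly) \<Rightarrow> 'k pol \<Rightarrow> 'k poly" where
  "subst_poly q g = (\<Sum>m\<in>Poly_Mapping.keys g. Polynomial.smult (Poly_Mapping.lookup g m)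
     (\<Prod>c\<in>UNIV. q c ^ Poly_Mapping.lookup m c))"

lemma heval_monomial:
  assumes "\<And>c. degree (q c) \<le> n"
  shows "degree (\<Prod>c\<in>UNIV. q c ^ Poly_Mapping.lookup m c) \<le> n * mdeg m" (is ?deg)
    and "heval (n * mdeg m) (\<Prod>c\<in>UNIV. q c ^ Poly_Mapping.lookup m c) a b
      = eval_mono (\<lambda>c. heval n (q c) a b) m" (is ?eval)
proof -
  let ?l = "Poly_Mapping.lookup m" and ?q = "\<lambda>c. q c ^ Poly_Mapping.lookup m c"
  have d: "degree (?q c) \<le> n * ?l c" for c by (rule degree_power_le_mult) (rule assms)
  have d01: "degree (?q 0 * ?q 1) \<le> n * ?l 0 + n * ?l 1"
    using degree_mult_le[of "?q 0" "?q 1"] d[of 0] d[of 1] by linarith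
  then have "degree (?q 0 * ?q 1 * ?q 2) \<le> n * ?l 0 + n * ?l 1 + n * ?l 2"
    using degree_mult_le[of "?q 0 * ?q 1" "?q 2"] d[of 2] by linarith
  then show ?deg by (simp only: prod_3 mdeg_def sum_3 distrib_left)
  show ?eval unfolding prod_3 mdeg_def sum_3 distrib_left
    by (simp only: heval_mult[OF d01 d] heval_mult[OF d d] heval_power[OF assms])
qed

lemma heval_subst_poly:
  assumes "\<And>c. degree (q c) \<le> n" "g \<in> forms j"
  shows "degree (subst_poly q g) \<le> n * j"
    and "heval (n * j) (subst_poly q g) a b = eval3 (\<lambda>c. heval n (q c) a b) g"
proof -
  have m: "mdeg m = j" if "m \<in> Poly_Mapping.keys g" for m using that assms(2) by (simp add: forms_def)
  show "degree (subst_poly q g) \<le> n * j" unfolding subst_poly_def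
  proof (intro degree_sum_le order_trans[OF degree_smult_le])
    fix m assume "m \<in> Poly_Mapping.keys g"
    with heval_monomial(1)[of q n m] assms(1) m
    show "degree (\<Prod>c\<in>UNIV. q c ^ Poly_Mapping.lookup m c) \<le> n * j" by simp
  qed simp
  show "heval (n * j) (subst_poly q g) a b = eval3 (\<lambda>c. heval n (q c) a b) g"
    unfolding subst_poly_def eval3_def heval_sum heval_smult
  proof (intro sum.cong refl)
    fix m assume "m \<in> Poly_Mapping.keys g"
    with heval_monomial(2)[of q n m a b] assms(1) m
    show "Poly_Mapping.lookup g m * heval (n * j) (\<Prod>c\<in>UNIV. q c ^ Poly_Mapping.lookup m c) a b
        = Poly_Mapping.lookup g m * eval_mono (\<lambda>c. heval n (q c) a b) m" by simp
  qed
qed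

lemma eval3_homogeneous:
  assumes "g \<in> forms j"
  shows "eval3 (\<lambda>c. r * p c) g = r ^ j * eval3 p g"
proof -
  have "eval_mono (\<lambda>c. r * p c) m = r ^ mdeg m * eval_mono p m" for m
    by (simp add: power_mult_distrib prod.distrib mdeg_def power_sum)
  then show ?thesis using assms
    by (simp add: eval3_def forms_def sum_distrib_left ac_simps)
qed

section \<open>Evaluation at points of the plane and its linear relations\<close>

locale plane_points =
  fixes P :: "nat \<Rightarrow> 3 \<Rightarrow> 'k::field_char_0" and s :: nat
  assumes nonzero: "\<And>i. i \<in> {1..s} \<Longrightarrow> P i \<noteq> (\<lambda>_. 0)"
    and distinct: "\<And>i j. i \<in> {1..s} \<Longrightarrow> j \<in> {1..s} \<Longrightarrow> i \<noteq> j \<Longrightarrow> \<not> same_point (P i) (P j)"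
begin

text \<open>
  The degree j component of the homogeneous coordinate ring is a subspace of the functions on the
  points; this is its annihilator.
\<close>

definition relations :: "nat \<Rightarrow> (nat \<Rightarrow> 'k) set" where
  "relations j = {u. (\<forall>i. i \<notin> {1..s} \<longrightarrow> u i = 0) \<and>
     (\<forall>g\<in>forms j. (\<Sum>i=1..s. u i * eval3 (P i) g) = 0)}"

lemma relations_outside: "u \<in> relations j \<Longrightarrow> i \<notin> {1..s} \<Longrightarrow> u i = 0"
  by (simp add: relations_def)

lemma relations_sum: "u \<in> relations j \<Longrightarrow> g \<in> forms j \<Longrightarrow> (\<Sum>i=1..s. u i * eval3 (P i) g) = 0"
  by (simp add: relations_def)

text \<open>Testing the product against \<open>h\<close> is testing \<open>u\<close> against
  \<open>g * h\<close>. Relations thus form a module over the forms, with degrees going down as in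
  Macaulay's inverse system.\<close>

lemma relations_mult:
  assumes "u \<in> relations (m + n)" "g \<in> forms m"
  shows "(\<lambda>i. eval3 (P i) g * u i) \<in> relations n"
  unfolding relations_def
proof (intro CollectI conjI ballI)
  fix h :: "'k pol" assume "h \<in> forms n"
  with assms have "(\<Sum>i=1..s. u i * eval3 (P i) (g * h)) = 0"
    by (intro relations_sum) (auto intro: forms_mult)
  then show "(\<Sum>i=1..s. eval3 (P i) g * u i * eval3 (P i) h) = 0"
    by (simp add: eval3_mult ac_simps)
qed (use assms relations_outside in auto)

lemma relations_dot3:
  assumes "u \<in> relations (Suc n)"
  shows "(\<lambda>i. dot3 a (P i) * u i) \<in> relations n"
  using relations_mult[of u 1 n "linform a"] assms linform_in_forms[of a]
  by (simp add: eval3_linform_dot3)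

lemma relations_lincomb:
  assumes "u \<in> relations j" "v \<in> relations j"
  shows "(\<lambda>i. x * u i + y * v i) \<in> relations j"
  unfolding relations_def
proof (intro CollectI conjI ballI)
  fix g :: "'k pol" assume "g \<in> forms j"
  then have "(\<Sum>i=1..s. u i * eval3 (P i) g) = 0" "(\<Sum>i=1..s. v i * eval3 (P i) g) = 0"
    using assms relations_sum by auto
  moreover have "(\<Sum>i=1..s. (x * u i + y * v i) * eval3 (P i) g)
    = x * (\<Sum>i=1..s. u i * eval3 (P i) g) + y * (\<Sum>i=1..s. v i * eval3 (P i) g)"
    by (simp add: sum_distrib_left sum.distrib algebra_simps)
  ultimately show "(\<Sum>i=1..s. (x * u i + y * v i) * eval3 (P i) g) = 0" by simp
next
  show "\<forall>i. i \<notin> {1..s} \<longrightarrow> x * u i + y * v i = 0"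
    using relations_outside[OF assms(1)] relations_outside[OF assms(2)] by simp
qed

lemma not_proportional:
  assumes "i \<in> {1..s}" "j \<in> {1..s}" "\<And>c c'. P i c * P j c' = P i c' * P j c"
  shows "i = j"
proof (rule ccontr)
  assume "i \<noteq> j"
  obtain c where c: "P i c \<noteq> 0" using nonzero[OF assms(1)] by (auto simp: fun_eq_iff)
  have Pj: "P j = (\<lambda>c'. P j c / P i c * P i c')" using assms(3)[of c] c by (auto simp: field_simps)
  have "P j c \<noteq> 0"
  proof
    assume "P j c = 0"
    with Pj have "P j = (\<lambda>_. 0)" by simp
    with nonzero[OF assms(2)] show False by simp
  qed
  with c have "same_point (P i) (P j)" unfolding same_point_def
    by (intro exI[of _ "P j c / P i c"] conjI Pj) simp
  with distinct assms \<open>i \<noteq> j\<close> show False by blast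
qed

lemma separating_linear_form:
  assumes "i \<in> {1..s}" "j \<in> {1..s}" "i \<noteq> j"
  obtains a where "dot3 a (P j) = 0" "dot3 a (P i) \<noteq> 0"
proof -
  obtain c c' where c: "P i c * P j c' \<noteq> P i c' * P j c" using not_proportional assms by blast
  let ?a = "\<lambda>e. (if e = c then P j c' else 0) - (if e = c' then P j c else 0)"
  have "dot3 ?a p = P j c' * p c - P j c * p c'" for p
    by (simp only: dot3_diff dot3_unit)
  with c show ?thesis by (intro that[of ?a]) (auto simp: ac_simps)
qed

text \<open>Otherwise lines through the at most \<open>m\<close> other points of the support that
  miss \<open>P i\<close>, padded to degree \<open>m\<close> by a linear form nonzero at
  \<open>P i\<close>, multiply to a form isolating \<open>i\<close> in the support, and the relation
  applied to it gives \<open>u i = 0\<close>.\<close>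

lemma support_of_relation:
  assumes u: "u \<in> relations m" and i: "u i \<noteq> 0"
  shows "m + 2 \<le> card {i. u i \<noteq> 0}"
proof (rule ccontr)
  let ?S = "{i. u i \<noteq> 0} - {i}"
  have sub: "{i. u i \<noteq> 0} \<subseteq> {1..s}" using relations_outside[OF u] by blast
  then have fin: "finite {i. u i \<noteq> 0}" by (rule finite_subset) simp
  assume "\<not> ?thesis"
  then have card: "card ?S \<le> m" using i fin by (simp add: card_Diff_singleton)
  have iI: "i \<in> {1..s}" using i sub by blast
  have "\<forall>j\<in>?S. \<exists>a. dot3 a (P j) = 0 \<and> dot3 a (P i) \<noteq> 0"
    using separating_linear_form[OF iI] sub by (metis DiffE insertI1 mem_Collect_eq subset_iff)
  then obtain a where a: "\<And>j. j \<in> ?S \<Longrightarrow> dot3 (a j) (P j) = 0 \<and> dot3 (a j) (P i) \<noteq> 0"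
    unfolding bchoice_iff by blast
  obtain c where c: "P i c \<noteq> 0" using nonzero[OF iI] by (auto simp: fun_eq_iff)
  define b where "b = (\<lambda>e. if e = c then 1 else 0 :: 'k)"
  have b: "dot3 b (P i) \<noteq> 0" using c by (simp add: b_def dot3_unit)
  define g where "g = (\<Prod>j\<in>?S. linform (a j)) * linform b ^ (m - card ?S)"
  have "g \<in> forms (card ?S + 1 * (m - card ?S))" unfolding g_def
    using fin by (intro forms_mult forms_prod forms_power linform_in_forms) auto
  then have g: "g \<in> forms m" using card by simp
  have eg: "eval3 p g = (\<Prod>j\<in>?S. dot3 (a j) p) * dot3 b p ^ (m - card ?S)" for p
    by (simp add: g_def eval3_mult eval3_prod eval3_power eval3_linform_dot3)
  have "eval3 (P i) g \<noteq> 0" using a b fin by (simp add: eg)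
  moreover have "eval3 (P j) g = 0" if "j \<in> ?S" for j using a[OF that] fin that by (auto simp: eg)
  then have "(\<Sum>j=1..s. u j * eval3 (P j) g) = (\<Sum>j=1..s. if j = i then u i * eval3 (P i) g else 0)"
    by (intro sum.cong) auto
  then have "u i * eval3 (P i) g = 0" using relations_sum[OF u g] iI by simp
  ultimately show False using i by simp
qed

end

text \<open>
  The numerical hypotheses in terms of relations: in degree j between k-1 and t, the space of
  relations has dimension 2(t-j). Only the upper bound is recorded, except that u and v are two
  independent relations of degree t-1.
\<close>

locale conic_points = plane_points +
  fixes t k :: nat and u v :: "nat \<Rightarrow> 'a"
  assumes kt: "1 \<le> k" "k < t"
    and determining: "\<And>j. k - 1 \<le> j \<Longrightarrow> j \<le> t \<Longrightarrow> \<exists>T\<subseteq>{1..s}. card T \<le> 2 * (t - j) \<and>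
       (\<forall>z\<in>relations j. (\<forall>i\<in>T. z i = 0) \<longrightarrow> (\<forall>i. z i = 0))"
    and u: "u \<in> relations (t - 1)" and v: "v \<in> relations (t - 1)"
    and uv: "\<And>x y. \<forall>i. x * u i + y * v i = 0 \<Longrightarrow> x = 0 \<and> y = 0"
begin

lemma relations_t: "z \<in> relations t \<Longrightarrow> z i = 0"
proof -
  assume z: "z \<in> relations t"
  have "k - 1 \<le> t" using kt by simp
  from determining[OF this] obtain T where "T \<subseteq> {1..s}" "card T \<le> 0"
    and T: "\<forall>z\<in>relations t. (\<forall>i\<in>T. z i = 0) \<longrightarrow> (\<forall>i. z i = 0)" by auto
  then have "T = {}" by (metis card_0_eq finite_atLeastAtMost finite_subset le_zero_eq)
  with T z show ?thesis by simp
qed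

text \<open>Six products of a coordinate with u or v lie in a space of dimension at most four.\<close>

lemma two_syzygies:
  obtains a b a' b' :: "3 \<Rightarrow> 'a" where
    "\<And>i. dot3 a (P i) * u i + dot3 b (P i) * v i = 0"
    "\<And>i. dot3 a' (P i) * u i + dot3 b' (P i) * v i = 0"
    "\<And>x y. \<forall>c. x * a c + y * a' c = 0 \<Longrightarrow> \<forall>c. x * b c + y * b' c = 0 \<Longrightarrow> x = 0 \<and> y = 0"
proof -
  have t2: "t - 1 = Suc (t - 2)" using kt by simp
  obtain T where T: "T \<subseteq> {1..s}" "card T \<le> 4"
    "\<And>z i. z \<in> relations (t - 2) \<Longrightarrow> \<forall>i\<in>T. z i = 0 \<Longrightarrow> z i = 0"
  proof -
    have "k - 1 \<le> t - 2" "t - 2 \<le> t" "2 * (t - (t - 2)) = 4" using kt by auto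
    with determining[of "t - 2"] that show ?thesis by metis
  qed
  have finT: "finite T" using T(1) finite_subset by blast
  define M where "M = (\<lambda>i. case_sum (\<lambda>c. P i c * u i) (\<lambda>c. P i c * v i))"
  have sumM: "(\<Sum>n\<in>UNIV. M i n * x n)
      = dot3 (\<lambda>c. x (Inl c)) (P i) * u i + dot3 (\<lambda>c. x (Inr c)) (P i) * v i" for i x
    unfolding UNIV_Plus_UNIV[symmetric] M_def dot3_def
    by (simp add: sum.Plus sum_distrib_left ac_simps del: UNIV_Plus_UNIV)
  have syz: "dot3 (\<lambda>c. x (Inl c)) (P i) * u i + dot3 (\<lambda>c. x (Inr c)) (P i) * v i = 0"
    if "\<forall>i\<in>T. (\<Sum>n\<in>UNIV. M i n * x n) = 0" for x i
  proof -
    let ?z = "\<lambda>i. 1 * (dot3 (\<lambda>c. x (Inl c)) (P i) * u i) + 1 * (dot3 (\<lambda>c. x (Inr c)) (P i) * v i)"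
    have "?z \<in> relations (t - 2)"
      using u v unfolding t2 by (intro relations_lincomb relations_dot3)
    from T(3)[OF this] that show ?thesis by (simp add: sumM)
  qed
  have card6: "card (UNIV :: (3 + 3) set) = 6" by simp
  obtain x where x: "\<exists>n\<in>UNIV. x n \<noteq> 0" "\<forall>i\<in>T. (\<Sum>n\<in>UNIV. M i n * x n) = 0"
    using homogeneous_system[of T UNIV M] finT T(2) card6 by auto
  then obtain n0 where n0: "x n0 \<noteq> 0" by blast
  \<comment> \<open>A second, independent solution comes from suppressing a position where the first
    one is nonzero: five unknowns still outnumber four equations.\<close>
  have "card (UNIV - {n0}) = 5" by (simp add: card_Diff_singleton)
  then obtain y0 where y0: "\<exists>n\<in>UNIV - {n0}. y0 n \<noteq> 0" "\<forall>i\<in>T. (\<Sum>n\<in>UNIV - {n0}. M i n * y0 n) = 0"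
    using homogeneous_system[of T "UNIV - {n0}" M] finT T(2) by auto
  define y where "y = y0(n0 := 0)"
  have "(\<Sum>n\<in>UNIV. M i n * y n) = (\<Sum>n\<in>UNIV - {n0}. M i n * y0 n)" for i
    by (simp add: y_def sum.remove[of UNIV n0])
  then have y: "\<forall>i\<in>T. (\<Sum>n\<in>UNIV. M i n * y n) = 0" using y0 by simp
  from y0(1) obtain n1 where "n1 \<noteq> n0" "y0 n1 \<noteq> 0" by blast
  then have n1: "y n1 \<noteq> 0" by (simp add: y_def)
  show ?thesis
  proof (rule that[OF syz[OF x(2)] syz[OF y]])
    fix p q
    assume l: "\<forall>c. p * x (Inl c) + q * y (Inl c) = 0" and r: "\<forall>c. p * x (Inr c) + q * y (Inr c) = 0"
    have *: "p * x n + q * y n = 0" for n using l r by (cases n) auto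
    from *[of n0] n0 have "p = 0" by (simp add: y_def)
    with *[of n1] n1 show "p = 0 \<and> q = 0" by simp
  qed
qed

text \<open>
  The bound 2j+1 on the Hilbert function of points on a conic, in dual form.
\<close>

definition conic_bound :: "nat set \<Rightarrow> bool" where
  "conic_bound Y \<longleftrightarrow> (\<forall>j. \<exists>M::nat \<Rightarrow> nat \<Rightarrow> 'a. \<forall>y. (\<forall>i. i \<notin> Y \<longrightarrow> y i = 0) \<longrightarrow>
     (\<forall>e\<le>2 * j. (\<Sum>i\<in>Y. M e i * y i) = 0) \<longrightarrow> y \<in> relations j)"

lemma card_conic_bound:
  assumes Y: "Y \<subseteq> {1..s}" and cb: "conic_bound Y"
  shows "card Y \<le> 2 * t + 1"
proof (rule ccontr)
  assume "\<not> ?thesis"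
  then have "card {..2 * t} < card Y" by simp
  have finY: "finite Y" using Y finite_subset by blast
  obtain M :: "nat \<Rightarrow> nat \<Rightarrow> 'a" where M: "\<And>y. \<lbrakk>\<forall>i. i \<notin> Y \<longrightarrow> y i = 0; \<forall>e\<le>2 * t. (\<Sum>i\<in>Y. M e i * y i) = 0\<rbrakk> \<Longrightarrow> y \<in> relations t"
    using cb unfolding conic_bound_def by metis
  obtain y where y: "\<exists>i\<in>Y. y i \<noteq> 0" "\<forall>e\<in>{..2 * t}. (\<Sum>i\<in>Y. M e i * y i) = 0"
    using homogeneous_system[OF _ finY \<open>card {..2 * t} < card Y\<close>, of M] by auto
  let ?y = "\<lambda>i. if i \<in> Y then y i else 0"
  have "(\<Sum>i\<in>Y. M e i * ?y i) = (\<Sum>i\<in>Y. M e i * y i)" for e by (intro sum.cong) auto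
  then have "?y \<in> relations t" using y by (intro M) auto
  from relations_t[OF this] y(1) show False by metis
qed

text \<open>Relations supported on \<open>Y\<close> already have dimension at least
  \<open>card Y - (2 * j + 1)\<close>, hence at least \<open>2 * (t - j)\<close>, which is the most
  that all relations of degree \<open>j\<close> can have. A relation that is nonzero off
  \<open>Y\<close> would be one too many.\<close>

lemma relations_supported:
  assumes Y: "Y \<subseteq> {1..s}" and cb: "conic_bound Y" and card: "2 * t + 1 \<le> card Y"
    and j: "k - 1 \<le> j" "j \<le> t" and z: "z \<in> relations j" and i: "i \<notin> Y"
  shows "z i = 0"
proof (rule ccontr)
  assume zi: "z i \<noteq> 0"
  have finY: "finite Y" using Y finite_subset by blast
  have Y0: "0 \<notin> Y" using Y by auto
  obtain M :: "nat \<Rightarrow> nat \<Rightarrow> 'a" where M: "\<And>y. \<lbrakk>\<forall>i. i \<notin> Y \<longrightarrow> y i = 0; \<forall>e\<le>2 * j. (\<Sum>i\<in>Y. M e i * y i) = 0\<rbrakk> \<Longrightarrow> y \<in> relations j"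
    using cb unfolding conic_bound_def by metis
  obtain T where T: "T \<subseteq> {1..s}" "card T \<le> 2 * (t - j)"
    "\<And>z i. z \<in> relations j \<Longrightarrow> \<forall>i\<in>T. z i = 0 \<Longrightarrow> z i = 0"
    using determining[OF j] that by metis
  have finT: "finite T" using T(1) finite_subset by blast
  \<comment> \<open>Unknowns are the values on \<open>Y\<close> and, under the index 0 that names no
    point of \<open>Y\<close>, a coefficient for \<open>z\<close>. The equations make the part on
    \<open>Y\<close> a relation and the total vanish on \<open>T\<close>; they number at most
    \<open>2 * t + 1\<close>.\<close>
  define E where "E = case_sum (\<lambda>e a. if a = 0 then 0 else M e a)
      (\<lambda>i' a. if a = 0 then z i' else if a = i' then 1 else 0)"
  have "card ({..2 * j} <+> T) < card (insert 0 Y)"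
    using card T(2) finT finY Y0 j by (simp add: card_Plus)
  then obtain y where y: "\<exists>a\<in>insert 0 Y. y a \<noteq> 0"
    "\<And>e. e \<in> {..2 * j} <+> T \<Longrightarrow> (\<Sum>a\<in>insert 0 Y. E e a * y a) = 0"
    using homogeneous_system[of "{..2 * j} <+> T" "insert 0 Y" E] finT finY by auto
  define y' where "y' = (\<lambda>i. if i \<in> Y then y i else 0)"
  have "(\<Sum>i\<in>Y. M e i * y' i) = 0" if "e \<le> 2 * j" for e
  proof -
    have "(\<Sum>i\<in>Y. M e i * y' i) = (\<Sum>a\<in>insert 0 Y. E (Inl e) a * y a)"
      using finY Y0 by (simp add: E_def) (intro sum.cong, auto simp: y'_def)
    then show ?thesis using y(2)[of "Inl e"] that by auto
  qed
  then have y'rel: "y' \<in> relations j" by (intro M) (auto simp: y'_def)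
  have "y 0 * z i' + 1 * y' i' = 0" for i'
  proof (rule T(3)[OF relations_lincomb[OF z y'rel]], intro ballI)
    fix i' assume i': "i' \<in> T"
    have "(\<Sum>a\<in>Y. E (Inr i') a * y a) = (\<Sum>a\<in>Y. if a = i' then y i' else 0)"
      using Y0 by (intro sum.cong) (auto simp: E_def)
    then have "(\<Sum>a\<in>Y. E (Inr i') a * y a) = y' i'"
      using finY by (simp add: y'_def)
    then have "(\<Sum>a\<in>insert 0 Y. E (Inr i') a * y a) = z i' * y 0 + y' i'"
      using finY Y0 by (simp add: E_def)
    then show "y 0 * z i' + 1 * y' i' = 0" using y(2)[of "Inr i'"] i' by (auto simp: ac_simps)
  qed
  then have *: "y 0 * z i' + y' i' = 0" for i' by simp
  from *[of i] i zi have "y 0 = 0" by (simp add: y'_def)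
  with * have "y i' = 0" if "i' \<in> Y" for i' using that by (metis add_0 mult_zero_left y'_def)
  with y(1) \<open>y 0 = 0\<close> show False by auto
qed

end

subsection \<open>Points on an irreducible conic\<close>

context conic_points
begin

text \<open>
  The function in the second clause is a relation exactly if g represents an element of the
  kernel of the Hessian of order j at the linear form with coefficients a.
\<close>

definition hessians_nondegenerate :: "(nat \<Rightarrow> 'a) \<Rightarrow> nat \<Rightarrow> (3 \<Rightarrow> 'a) \<Rightarrow> bool" where
  "hessians_nondegenerate \<alpha> d a \<longleftrightarrow> (\<forall>i\<in>{1..s}. dot3 a (P i) \<noteq> 0) \<and>
    (\<forall>j. k - 1 \<le> j \<longrightarrow> j < t \<longrightarrow> (\<forall>g\<in>forms j.
       (\<lambda>i. if i \<in> {1..s} then \<alpha> i * dot3 a (P i) ^ (d - 2 * j) * eval3 (P i) g else 0) \<in> relations j \<longrightarrow>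
       (\<forall>i\<in>{1..s}. eval3 (P i) g = 0)))"

text \<open>\<open>irred\<close> serves twice: it lets \<open>P i\<close> be recovered from the two
  syzygies at \<open>i\<close>, and it makes the three quadratic forms of the resulting
  parametrization independent. In the parameter, the Hessian of order \<open>j\<close> becomes the
  binary one with \<open>m = 2 * j\<close> and \<open>N = 2 * (d - j)\<close>.\<close>

lemma hessians_nondegenerate_irreducible:
  fixes \<alpha> :: "nat \<Rightarrow> 'a"
  assumes irred: "\<And>b w. w \<in> relations (t - 1) \<Longrightarrow> \<forall>i. dot3 b (P i) * w i = 0 \<Longrightarrow>
      (\<forall>c. b c = 0) \<or> (\<forall>i. w i = 0)"
    and \<alpha>: "\<And>i. i \<in> {1..s} \<Longrightarrow> \<alpha> i \<noteq> 0" and d: "2 * t \<le> d"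
  shows "\<exists>a. hessians_nondegenerate \<alpha> d a"
proof -
  obtain a b a' b' where syz: "\<And>i. dot3 a (P i) * u i + dot3 b (P i) * v i = 0"
    "\<And>i. dot3 a' (P i) * u i + dot3 b' (P i) * v i = 0"
    and ind: "\<And>x y. \<forall>c. x * a c + y * a' c = 0 \<Longrightarrow> \<forall>c. x * b c + y * b' c = 0 \<Longrightarrow> x = 0 \<and> y = 0"
    using two_syzygies by metis
  define Y where "Y = {i \<in> {1..s}. u i \<noteq> 0 \<or> v i \<noteq> 0}"
  have Y: "Y \<subseteq> {1..s}" "finite Y" by (auto simp: Y_def)
  have uv0: "u i = 0 \<and> v i = 0" if "i \<notin> Y" for i
    using relations_outside[OF u] relations_outside[OF v] that unfolding Y_def by blast

  \<comment> \<open>At a point of \<open>Y\<close> the syzygies say that \<open>P i\<close> is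
    orthogonal to the vectors with entries \<open>a c * u i + b c * v i\<close> and
    \<open>a' c * u i + b' c * v i\<close>. So it is a multiple of their cross product, which is
    quadratic in \<open>u i\<close> and \<open>v i\<close>.\<close>
  define q where "q = cross3 (\<lambda>c. [:b c, a c:]) (\<lambda>c. [:b' c, a' c:])"
  have deg_pq: "degree ([:x, y:] * [:z, w:]) \<le> 2" for x y z w :: 'a
    using degree_mult_le[of "[:x, y:]" "[:z, w:]"] by simp
  have deg_q: "degree (q c) \<le> 2" for c
    unfolding q_def cross3_def by (auto intro: degree_diff_le deg_pq simp del: mult_pCons_left mult_pCons_right)
  have heval_q: "heval 2 (q c) x y = cross3 (\<lambda>c. b c * y + a c * x) (\<lambda>c. b' c * y + a' c * x) c" for c x y
  proof -
    have "heval 2 ([:p1, p2:] * [:r1, r2:]) x y = (p1 * y + p2 * x) * (r1 * y + r2 * x)" for p1 p2 r1 r2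
      using heval_mult[of "[:p1, p2:]" 1 "[:r1, r2:]" 1 x y] by (simp add: heval_linear[unfolded One_nat_def] numeral_2_eq_2)
    then show ?thesis
      unfolding q_def cross3_def by (simp add: heval_diff del: mult_pCons_left mult_pCons_right)
  qed
  have "\<exists>r. \<forall>c. P i c = r * heval 2 (q c) (u i) (v i)" if i: "i \<in> Y" for i
    unfolding heval_q
  proof (rule multiple_of_cross3)
    have dot: "dot3 (\<lambda>c. x c * v i + y c * u i) (P i) = dot3 y (P i) * u i + dot3 x (P i) * v i" for x y
      by (simp add: dot3_def sum.distrib sum_distrib_left algebra_simps)
    show "dot3 (\<lambda>c. b c * v i + a c * u i) (P i) = 0" "dot3 (\<lambda>c. b' c * v i + a' c * u i) (P i) = 0"
      using syz by (simp_all add: dot)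
  next
    fix x y assume eq: "\<forall>c. x * (b c * v i + a c * u i) + y * (b' c * v i + a' c * u i) = 0"
    define A where "A = (\<lambda>c. x * a c + y * a' c)"
    define B where "B = (\<lambda>c. x * b c + y * b' c)"
    have AB: "A c * u i + B c * v i = 0" for c
      using eq by (simp add: A_def B_def algebra_simps)
    \<comment> \<open>If the two vectors are dependent at \<open>i\<close>, a combination
      \<open>A\<close>, \<open>B\<close> of the syzygies equals \<open>v i\<close> and
      \<open>- u i\<close> times one linear form \<open>C\<close>. Then \<open>C\<close> annihilates
      the nonzero relation \<open>v i * u - u i * v\<close>, so \<open>C = 0\<close> and the
      combination is trivial.\<close>
    obtain C where C: "\<And>c. A c = v i * C c" "\<And>c. B c = - u i * C c"
    proof (cases "v i = 0")
      case True
      then have "u i \<noteq> 0" using i by (simp add: Y_def)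
      then show ?thesis using AB True by (intro that[of "\<lambda>c. - B c / u i"]) auto
    next
      case False
      have "B c = - u i * (A c / v i)" for c
        using AB[of c] False by (simp add: field_simps add_eq_0_iff2)
      then show ?thesis using False by (intro that[of "\<lambda>c. A c / v i"]) auto
    qed
    have sy: "dot3 A (P i') * u i' + dot3 B (P i') * v i' = 0" for i'
    proof -
      have "dot3 A (P i') * u i' + dot3 B (P i') * v i'
        = x * (dot3 a (P i') * u i' + dot3 b (P i') * v i') + y * (dot3 a' (P i') * u i' + dot3 b' (P i') * v i')"
        unfolding A_def B_def dot3_add dot3_smult by (simp add: algebra_simps)
      then show ?thesis using syz by simp
    qed
    have "dot3 C (P i') * (v i * u i' + (- u i) * v i') = 0" for i'
    proof -
      have "A = (\<lambda>c. v i * C c)" "B = (\<lambda>c. - u i * C c)" using C by auto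
      then have "dot3 A (P i') = v i * dot3 C (P i')" "dot3 B (P i') = - u i * dot3 C (P i')"
        by (simp_all only: dot3_smult)
      with sy[of i'] show ?thesis by (simp add: algebra_simps)
    qed
    then have "(\<forall>c. C c = 0) \<or> (\<forall>i'. v i * u i' + (- u i) * v i' = 0)"
      by (intro irred relations_lincomb u v) blast
    moreover have "\<not> (\<forall>i'. v i * u i' + (- u i) * v i' = 0)"
      using uv[of "v i" "- u i"] i by (auto simp: Y_def)
    ultimately have "\<forall>c. C c = 0" by blast
    with C have "\<forall>c. A c = 0" "\<forall>c. B c = 0" by auto
    then show "x = 0 \<and> y = 0" unfolding A_def B_def by (rule ind)
  qed
  then obtain r where r: "\<And>i c. i \<in> Y \<Longrightarrow> P i c = r i * heval 2 (q c) (u i) (v i)" by metis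
  have r0: "r i \<noteq> 0" if "i \<in> Y" for i
  proof
    assume "r i = 0"
    then have "P i = (\<lambda>_. 0)" using r[OF that] by auto
    with nonzero Y that show False by blast
  qed
  have evalP: "eval3 (P i) g = r i ^ j * heval (2 * j) (subst_poly q g) (u i) (v i)"
    if "i \<in> Y" "g \<in> forms j" for i g j
  proof -
    have "P i = (\<lambda>c. r i * heval 2 (q c) (u i) (v i))" using r that by auto
    then show ?thesis
      using eval3_homogeneous[OF that(2), of "r i"] heval_subst_poly(2)[OF deg_q that(2)] by simp
  qed
  have dotP: "dot3 m (P i) = r i * heval 2 (\<Sum>c\<in>UNIV. Polynomial.smult (m c) (q c)) (u i) (v i)" if "i \<in> Y" for m i
    using r[OF that] by (simp add: dot3_def heval_sum heval_smult sum_distrib_left ac_simps)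

  have q_ind: "m c = 0" if "(\<Sum>c\<in>UNIV. Polynomial.smult (m c) (q c)) = 0" for m c
  proof -
    have "dot3 m (P i) * u i = 0" for i
      using dotP[of i m] that uv0[of i] by (cases "i \<in> Y") auto
    then have "(\<forall>c. m c = 0) \<or> (\<forall>i. u i = 0)" by (intro irred u) blast
    moreover have "\<not> (\<forall>i. u i = 0)" using uv[of 1 0] by auto
    ultimately show ?thesis by blast
  qed
  \<comment> \<open>Three coefficient equations in four unknowns, \<open>None\<close> being the
    multiple of the monomial. As the \<open>q c\<close> are independent, this multiple is nonzero
    and can be divided out.\<close>
  have "\<exists>l. (\<Sum>c\<in>UNIV. Polynomial.smult (l c) (q c)) = monom 1 n" if n: "n \<le> 2" for n
  proof -
    let ?M = "\<lambda>e. case_option (- coeff (monom 1 n) e) (\<lambda>c. coeff (q c) e)"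
    have "card {..2::nat} < card (UNIV :: 3 option set)" by simp
    then obtain x where x: "\<exists>o'. x o' \<noteq> 0" "\<And>e. e \<le> 2 \<Longrightarrow> (\<Sum>o'\<in>UNIV. ?M e o' * x o') = 0"
      using homogeneous_system[of "{..2::nat}" "UNIV :: 3 option set" ?M] by auto
    let ?f = "\<Sum>c\<in>UNIV. Polynomial.smult (x (Some c)) (q c)"
    have "coeff ?f e = coeff (Polynomial.smult (x None) (monom 1 n)) e" for e
    proof (cases "e \<le> 2")
      case True
      from x(2)[OF this] show ?thesis
        by (simp add: UNIV_option_conv sum.reindex coeff_sum ac_simps)
    next
      case False
      then have "coeff (q c) e = 0" for c using deg_q[of c] by (intro coeff_eq_0) linarith
      then show ?thesis using False n by (simp add: coeff_sum)
    qed
    then have f: "?f = Polynomial.smult (x None) (monom 1 n)" by (rule poly_eqI)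
    have "x None \<noteq> 0"
    proof
      assume 0: "x None = 0"
      with f q_ind[of "\<lambda>c. x (Some c)"] have "x (Some c) = 0" for c by simp
      with 0 x(1) show False by (metis not_None_eq)
    qed
    moreover have "(\<Sum>c\<in>UNIV. Polynomial.smult (x (Some c) / x None) (q c)) = Polynomial.smult (1 / x None) ?f"
      by (rule poly_eqI) (simp add: coeff_sum sum_divide_distrib)
    ultimately show ?thesis using f by (intro exI[of _ "\<lambda>c. x (Some c) / x None"]) (simp add: smult_monom)
  qed
  then obtain l where l: "\<And>n. n \<le> 2 \<Longrightarrow> (\<Sum>c\<in>UNIV. Polynomial.smult (l n c) (q c)) = monom 1 n" by metis
  have dot_l: "dot3 (l n) (P i) = r i * (u i ^ n * v i ^ (2 - n))" if "i \<in> Y" "n \<le> 2" for i n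
    using dotP[OF that(1)] l[OF that(2)] by (simp add: heval_monom[OF that(2)])
  \<comment> \<open>The \<open>l n\<close> span all linear forms. Points off the conic are included,
    because the tangent has to miss them as well.\<close>
  have l_span: "\<exists>n\<le>2. dot3 (l n) (P i) \<noteq> 0" if i: "i \<in> {1..s}" for i
  proof (rule ccontr)
    assume *: "\<not> ?thesis"
    have "P i c = 0" for c
    proof -
      define m where "m = (\<lambda>c'. (if c' = c then 1 else 0) - (\<Sum>n\<le>2. coeff (q c) n * l n c'))"
      have "(\<Sum>c'\<in>UNIV. Polynomial.smult (m c') (q c')) = q c - (\<Sum>n\<le>2. Polynomial.smult (coeff (q c) n) (monom 1 n))"
      proof -
        have "(\<Sum>c'\<in>UNIV. Polynomial.smult (\<Sum>n\<le>2. coeff (q c) n * l n c') (q c'))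
          = (\<Sum>n\<le>2. Polynomial.smult (coeff (q c) n) (\<Sum>c'\<in>UNIV. Polynomial.smult (l n c') (q c')))"
          by (rule poly_eqI, simp add: coeff_sum sum_distrib_left sum_distrib_right mult.assoc, rule sum.swap)
        moreover have "(\<Sum>c'\<in>UNIV. Polynomial.smult (if c' = c then 1 else 0) (q c')) = (\<Sum>c'\<in>UNIV. if c' = c then q c else 0)"
          by (intro sum.cong) auto
        ultimately show ?thesis by (simp add: m_def smult_diff_left sum_subtractf l)
      qed
      also have "(\<Sum>n\<le>2. Polynomial.smult (coeff (q c) n) (monom 1 n)) = q c"
        using poly_as_sum_of_monoms'[OF deg_q] by (simp add: smult_monom)
      finally have "m c' = 0" for c' using q_ind[of m] by simp
      then have "dot3 m (P i) = 0" by (simp add: dot3_def)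
      moreover have "dot3 m (P i) = P i c"
        unfolding m_def dot3_diff dot3_unit dot3_sum dot3_smult using * by simp
      ultimately show ?thesis by simp
    qed
    with nonzero[OF i] show False by auto
  qed

  have form_monom: "\<exists>g\<in>forms j. \<forall>i\<in>Y. eval3 (P i) g = r i ^ j * heval (2 * j) (monom 1 e) (u i) (v i)"
    if e: "e \<le> 2 * j" for e j
  proof -
    \<comment> \<open>The monomial splits into \<open>z\<close> factors v^2, at most one factor uv
      and \<open>y\<close> factors u^2; each of these is the value of some \<open>l n\<close>, up to
      the factor \<open>r i\<close>.\<close>
    define x y where "x = e mod 2" and "y = e div 2"
    define z where "z = j - x - y"
    have e_eq: "e = x + 2 * y" and "x \<le> 1" by (simp_all add: x_def y_def)
    then have "x + y \<le> j" using e by arith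
    then have xy: "e = x + 2 * y" "j = z + x + y" "2 * j - e = 2 * z + x"
      using e_eq by (simp_all add: z_def)
    let ?g = "linform (l 0) ^ z * linform (l 1) ^ x * linform (l 2) ^ y"
    have "?g \<in> forms (1 * z + 1 * x + 1 * y)" by (intro forms_mult forms_power linform_in_forms)
    moreover have "eval3 (P i) ?g = r i ^ j * heval (2 * j) (monom 1 e) (u i) (v i)" if i: "i \<in> Y" for i
    proof -
      have "eval3 (P i) ?g = (r i * (v i)\<^sup>2) ^ z * (r i * (u i * v i)) ^ x * (r i * (u i)\<^sup>2) ^ y"
        using dot_l[OF i, of 0] dot_l[OF i, of 1] dot_l[OF i, of 2]
        by (simp add: eval3_mult eval3_power eval3_linform_dot3)
      also have "\<dots> = r i ^ (z + x + y) * (u i ^ (x + 2 * y) * v i ^ (2 * z + x))"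
        by (simp add: power_mult_distrib power_add flip: power_mult)
      also have "\<dots> = r i ^ j * heval (2 * j) (monom 1 e) (u i) (v i)"
        unfolding heval_monom[OF e] xy(3) using xy(1,2) by simp
      finally show ?thesis .
    qed
    ultimately show ?thesis using xy(2) by (intro bexI[of _ ?g]) auto
  qed
  have form_of_poly: "\<exists>g\<in>forms j. \<forall>i\<in>Y. eval3 (P i) g = r i ^ j * heval (2 * j) h (u i) (v i)"
    if h: "degree h \<le> 2 * j" for h j
  proof -
    obtain G where G: "\<And>e. e \<le> 2 * j \<Longrightarrow> G e \<in> forms j"
      "\<And>e i. e \<le> 2 * j \<Longrightarrow> i \<in> Y \<Longrightarrow> eval3 (P i) (G e) = r i ^ j * heval (2 * j) (monom 1 e) (u i) (v i)"
      using form_monom[of _ j] by metis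
    let ?g = "\<Sum>e\<le>2 * j. smult3 (coeff h e) (G e)"
    have "eval3 (P i) ?g = r i ^ j * heval (2 * j) h (u i) (v i)" if "i \<in> Y" for i
      using G(2)[OF _ that] by (simp add: eval3_sum eval3_smult3 heval_monom sum_distrib_left heval_def[of _ h] ac_simps)
    moreover have "?g \<in> forms j" using G(1) by (intro forms_sum forms_smult3) auto
    ultimately show ?thesis by blast
  qed

  have nc: "noncollinear Y u v"
    unfolding noncollinear_def
  proof (intro conjI ballI impI notI)
    fix i j assume i: "i \<in> Y" and j: "j \<in> Y" and ij: "i \<noteq> j" and eq: "u i * v j = u j * v i"
    obtain e where e: "u j = e * u i" "v j = e * v i"
    proof (cases "u i = 0")
      case True
      then have "v i \<noteq> 0" "u j = 0" using i eq by (auto simp: Y_def)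
      then show ?thesis using that[of "v j / v i"] True by simp
    next
      case False
      then show ?thesis using that[of "u j / u i"] eq by (simp add: field_simps)
    qed
    have "P j c = r j * e\<^sup>2 / r i * P i c" for c
      using r[OF i, of c] r[OF j, of c] r0[OF i] unfolding e heval_homogeneous by simp
    then have "i = j" using i j Y by (intro not_proportional) auto
    with ij show False by simp
  qed (simp add: Y_def)

  have cb: "conic_bound Y"
    unfolding conic_bound_def
  proof (intro allI exI impI)
    fix j y assume y0: "\<forall>i. i \<notin> Y \<longrightarrow> y i = 0"
      and y: "\<forall>e\<le>2 * j. (\<Sum>i\<in>Y. (\<lambda>e i. r i ^ j * (u i ^ e * v i ^ (2 * j - e))) e i * y i) = 0"
    show "y \<in> relations j" unfolding relations_def
    proof (intro CollectI conjI ballI allI impI)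
      fix g :: "'a pol" assume g: "g \<in> forms j"
      have "(\<Sum>i=1..s. y i * eval3 (P i) g) = (\<Sum>i\<in>Y. y i * (r i ^ j * heval (2 * j) (subst_poly q g) (u i) (v i)))"
        using y0 Y evalP[OF _ g] by (intro sum.mono_neutral_cong_right) auto
      also have "\<dots> = (\<Sum>e\<le>2 * j. coeff (subst_poly q g) e * (\<Sum>i\<in>Y. r i ^ j * (u i ^ e * v i ^ (2 * j - e)) * y i))"
        unfolding heval_def sum_distrib_left by (subst sum.swap) (simp add: ac_simps)
      also have "\<dots> = 0" using y by simp
      finally show "(\<Sum>i=1..s. y i * eval3 (P i) g) = 0" .
    next
      fix i assume "i \<notin> {1..s}"
      then show "y i = 0" using y0 Y by blast
    qed
  qed

  have sumY: "(\<Sum>i\<in>Y. z i * (r i ^ j * heval (2 * j) h (u i) (v i))) = 0"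
    if z: "z \<in> relations j" and z0: "\<And>i. i \<notin> Y \<Longrightarrow> z i = 0" and h: "degree h \<le> 2 * j" for z j h
  proof -
    obtain g where g: "g \<in> forms j" "\<And>i. i \<in> Y \<Longrightarrow> eval3 (P i) g = r i ^ j * heval (2 * j) h (u i) (v i)"
      using form_of_poly[OF h] by blast
    have "(\<Sum>i\<in>Y. z i * (r i ^ j * heval (2 * j) h (u i) (v i))) = (\<Sum>i=1..s. z i * eval3 (P i) g)"
      using g(2) z0 Y by (intro sum.mono_neutral_cong_left) auto
    then show ?thesis using relations_sum[OF z g(1)] by simp
  qed

  \<comment> \<open>As \<open>u\<close> and \<open>v\<close> are also the coordinates of the
    parameter, the two relations of degree \<open>t - 1\<close> merge: the weights
    \<open>r i ^ (t - 1)\<close> annihilate all binary forms of degree \<open>2 * t - 1\<close>, the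
    monomials containing \<open>u\<close> by the relation \<open>u\<close> and the pure power of
    \<open>v\<close> by the relation \<open>v\<close>. On at most \<open>2 * t\<close> points a
    Lagrange form would contradict this.\<close>
  have card_ge: "2 * t + 1 \<le> card Y"
  proof (rule ccontr)
    assume "\<not> ?thesis"
    then have card: "card Y \<le> Suc (2 * t - 1)" by simp
    have rel: "(\<Sum>i\<in>Y. r i ^ (t - 1) * (u i ^ e * v i ^ (2 * t - 1 - e))) = 0" if e: "e \<le> 2 * t - 1" for e
    proof (cases "e = 0")
      case True
      have "2 * t - 1 = Suc (2 * (t - 1))" using kt by simp
      then show ?thesis
        using sumY[OF v, of 1] heval_monom[of 0 "2 * (t - 1)", where 'a='a] uv0 True by (simp add: ac_simps)
    next
      case False
      then obtain e' where e': "e = Suc e'" "e' \<le> 2 * (t - 1)" "2 * t - 1 - e = 2 * (t - 1) - e'"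
        using e kt that[of "e - 1"] by auto
      have "(\<Sum>i\<in>Y. u i * (r i ^ (t - 1) * heval (2 * (t - 1)) (monom 1 e') (u i) (v i))) = 0"
        using uv0 e'(2) by (intro sumY[OF u] order_trans[OF degree_monom_le]) auto
      then show ?thesis unfolding heval_monom[OF e'(2)] e'(3) unfolding e'(1)
        by (simp add: ac_simps)
    qed
    obtain i0 where i0: "i0 \<in> Y" using uv[of 1 0] uv0 by auto
    obtain f where f: "degree f \<le> 2 * t - 1" "heval (2 * t - 1) f (u i0) (v i0) \<noteq> 0"
      "\<forall>i\<in>Y - {i0}. heval (2 * t - 1) f (u i) (v i) = 0"
      using binary_lagrange[OF Y(2) nc i0 card] by blast
    have "(\<Sum>i\<in>Y. r i ^ (t - 1) * heval (2 * t - 1) f (u i) (v i))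
      = (\<Sum>e\<le>2 * t - 1. coeff f e * (\<Sum>i\<in>Y. r i ^ (t - 1) * (u i ^ e * v i ^ (2 * t - 1 - e))))"
      unfolding heval_def sum_distrib_left by (subst sum.swap) (simp add: ac_simps)
    also have "\<dots> = 0" using rel by simp
    also have "(\<Sum>i\<in>Y. r i ^ (t - 1) * heval (2 * t - 1) f (u i) (v i))
      = (\<Sum>i\<in>Y. if i = i0 then r i0 ^ (t - 1) * heval (2 * t - 1) f (u i0) (v i0) else 0)"
      using f(3) by (intro sum.cong) auto
    finally show False using f(2) r0[OF i0] i0 Y by simp
  qed
  have card: "card Y = 2 * t + 1" using card_ge card_conic_bound[OF Y(1) cb] by simp

  \<comment> \<open>The exponent \<open>d\<close> of \<open>r i\<close> collects
    \<open>d - 2 * j\<close> from the tangent and \<open>j\<close> from each of \<open>g\<close> and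
    the test form.\<close>
  define bad where "bad = (\<lambda>j. {x. \<exists>G. G \<noteq> 0 \<and> degree G \<le> 2 * j \<and> (\<forall>h. degree h \<le> 2 * j \<longrightarrow>
    (\<Sum>i\<in>Y. \<alpha> i * r i ^ d * heval (2 * (d - j)) ([:-x, 1:] ^ (2 * (d - j) - 2 * j) * G) (u i) (v i)
       * heval (2 * j) h (u i) (v i)) = 0)})"
  have fin_bad: "finite (bad j)" if j: "j < t" for j
    unfolding bad_def
  proof (rule binary_hessian_nondegenerate[OF Y(2) nc])
    have "{i \<in> Y. \<alpha> i * r i ^ d \<noteq> 0} = Y" using \<alpha> r0 Y by auto
    then show "2 * j < card {i \<in> Y. \<alpha> i * r i ^ d \<noteq> 0}" using card j by simp
  qed (use card j d in auto)
  text \<open>The tangent line to the conic at the point with parameter x.\<close>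
  define tl where "tl = (\<lambda>x c. l 2 c - 2 * x * l 1 c + x ^ 2 * l 0 c)"
  have dot_tl: "dot3 (tl x) p = dot3 (l 2) p - 2 * x * dot3 (l 1) p + x ^ 2 * dot3 (l 0) p" for x p
    unfolding tl_def dot3_add dot3_diff dot3_smult ..
  have fin_zero: "finite {x. dot3 (tl x) (P i) = 0}" if i: "i \<in> {1..s}" for i
  proof -
    let ?f = "[:dot3 (l 2) (P i), - 2 * dot3 (l 1) (P i), dot3 (l 0) (P i):]"
    have "?f \<noteq> 0" using l_span[OF i] by (auto simp: le_Suc_eq numeral_2_eq_2)
    then have "finite {x. poly ?f x = 0}" by (rule poly_roots_finite)
    also have "{x. poly ?f x = 0} = {x. dot3 (tl x) (P i) = 0}"
      by (simp add: dot_tl power2_eq_square algebra_simps)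
    finally show ?thesis .
  qed
  have "finite ((\<Union>j<t. bad j) \<union> (\<Union>i\<in>{1..s}. {x. dot3 (tl x) (P i) = 0}))"
    using fin_bad fin_zero by blast
  then obtain x where x: "x \<notin> (\<Union>j<t. bad j) \<union> (\<Union>i\<in>{1..s}. {x. dot3 (tl x) (P i) = 0})"
    using infinite_UNIV_char_0[where 'a='a] by (metis UNIV_I finite_subset subsetI)
  have "hessians_nondegenerate \<alpha> d (tl x)" unfolding hessians_nondegenerate_def
  proof (intro conjI ballI allI impI)
    fix i assume "i \<in> {1..s}"
    then show "dot3 (tl x) (P i) \<noteq> 0" using x by blast
  next
    fix j i and g :: "'a pol"
    assume j: "k - 1 \<le> j" "j < t" and g: "g \<in> forms j" and i: "i \<in> {1..s}"
    let ?z = "\<lambda>i. if i \<in> {1..s} then \<alpha> i * dot3 (tl x) (P i) ^ (d - 2 * j) * eval3 (P i) g else 0"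
    assume z: "?z \<in> relations j"
    let ?N = "2 * (d - j)"
    have z0: "?z i = 0" if "i \<notin> Y" for i
      by (rule relations_supported[OF Y(1) cb card_ge j(1) _ z that]) (use j in simp)
    let ?G = "subst_poly q g"
    have degG: "degree ?G \<le> 2 * j" by (rule heval_subst_poly(1)[OF deg_q g])
    have N: "?N = 2 * (d - 2 * j) + 2 * j" "?N - 2 * j = 2 * (d - 2 * j)" using d j by auto
    have key: "?z i * r i ^ j = \<alpha> i * r i ^ d * heval ?N ([:-x, 1:] ^ (?N - 2 * j) * ?G) (u i) (v i)"
      if i: "i \<in> Y" for i
    proof -
      have "dot3 (tl x) (P i) = r i * (u i - x * v i)\<^sup>2"
        using dot_l[OF i, of 0] dot_l[OF i, of 1] dot_l[OF i, of 2]
        by (simp add: dot_tl power2_eq_square algebra_simps)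
      then have "?z i * r i ^ j = \<alpha> i * (r i ^ (d - 2 * j) * r i ^ j * r i ^ j) * ((u i - x * v i) ^ (2 * (d - 2 * j)) * heval (2 * j) ?G (u i) (v i))"
        using i Y evalP[OF i g] by (auto simp: power_mult_distrib power_mult)
      also have "r i ^ (d - 2 * j) * r i ^ j * r i ^ j = r i ^ d"
        using d j by (simp flip: power_add)
      also have "(u i - x * v i) ^ (2 * (d - 2 * j)) * heval (2 * j) ?G (u i) (v i)
        = heval ?N ([:-x, 1:] ^ (?N - 2 * j) * ?G) (u i) (v i)"
      proof -
        have lin: "degree [:-x, 1:] \<le> 1" by simp
        have "degree ([:-x, 1:] ^ (2 * (d - 2 * j))) \<le> 1 * (2 * (d - 2 * j))"
          by (rule degree_power_le_mult) simp
        from heval_mult[OF this degG, of "u i" "v i"] heval_power[OF lin, of "2 * (d - 2 * j)" "u i" "v i"]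
        show ?thesis unfolding N heval_linear by simp
      qed
      finally show ?thesis .
    qed
    have "(\<Sum>i\<in>Y. \<alpha> i * r i ^ d * heval ?N ([:-x, 1:] ^ (?N - 2 * j) * ?G) (u i) (v i)
       * heval (2 * j) h (u i) (v i)) = 0" if h: "degree h \<le> 2 * j" for h
    proof -
      have "(\<Sum>i\<in>Y. ?z i * (r i ^ j * heval (2 * j) h (u i) (v i))) = 0"
        by (rule sumY[OF z z0 h])
      then show ?thesis by (simp only: key flip: mult.assoc cong: sum.cong)
    qed
    then have "x \<in> bad j" if "?G \<noteq> 0" unfolding bad_def using that degG by blast
    then have "?G = 0" using x j by blast
    show "eval3 (P i) g = 0"
    proof (cases "i \<in> Y")
      case True
      then show ?thesis using evalP[OF True g] \<open>?G = 0\<close> by simp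
    next
      case False
      have "dot3 (tl x) (P i) \<noteq> 0" using x i by blast
      then show ?thesis using z0[OF False] \<alpha>[OF i] i by simp
    qed
  qed
  then show ?thesis by blast
qed

end

subsection \<open>Points on two lines\<close>

context conic_points
begin

text \<open>On a line a form of degree \<open>t\<close> is a binary form with \<open>t + 1\<close>
  coefficients, so more than \<open>t + 1\<close> collinear points would carry a nonzero relation of
  degree \<open>t\<close>.\<close>

lemma card_collinear:
  assumes Y: "Y \<subseteq> {1..s}" and b: "b e0 \<noteq> 0" and line: "\<And>i. i \<in> Y \<Longrightarrow> dot3 b (P i) = 0"
  shows "card Y \<le> t + 1"
proof (rule ccontr)
  assume "\<not> ?thesis"
  then have card: "card {..t} < card Y" by simp
  have finY: "finite Y" using Y finite_subset by blast
  define b' where "b' = (\<lambda>c. if c = e0 + 1 then 1 else 0 :: 'a)"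
  have "x = 0 \<and> y = 0" if "\<forall>c. x * b c + y * b' c = 0" for x y
  proof -
    have "x * b e0 + y * b' e0 = 0" "x * b (e0 + 1) + y * b' (e0 + 1) = 0" using that by blast+
    then show ?thesis using b by (simp add: b'_def)
  qed
  then obtain f r0 r1 r2 where r: "\<And>p c. p c = r0 c * dot3 b p + r1 c * dot3 b' p + r2 c * dot3 f p"
    using complete_to_coordinates[of b b'] by metis
  define q where "q = (\<lambda>c. [:r1 c, r2 c:])"
  have deg_q: "degree (q c) \<le> 1" for c by (simp add: q_def)
  define A where "A = (\<lambda>i. dot3 f (P i))"
  define B where "B = (\<lambda>i. dot3 b' (P i))"
  have P: "P i = (\<lambda>c. heval 1 (q c) (A i) (B i))" if "i \<in> Y" for i
    unfolding q_def heval_linear A_def B_def using r[of "P i"] line[OF that] by (auto simp: fun_eq_iff)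
  obtain y where y: "\<exists>i\<in>Y. y i \<noteq> 0" "\<forall>e\<in>{..t}. (\<Sum>i\<in>Y. (A i ^ e * B i ^ (t - e)) * y i) = 0"
    using homogeneous_system[OF _ finY card, of "\<lambda>e i. A i ^ e * B i ^ (t - e)"] by auto
  let ?y = "\<lambda>i. if i \<in> Y then y i else 0"
  have "?y \<in> relations t" unfolding relations_def
  proof (intro CollectI conjI ballI allI impI)
    fix g :: "'a pol" assume g: "g \<in> forms t"
    have ev: "eval3 (P i) g = heval t (subst_poly q g) (A i) (B i)" if "i \<in> Y" for i
      using heval_subst_poly(2)[OF deg_q g, where a = "A i" and b = "B i"] P[OF that] by simp
    have "(\<Sum>i=1..s. ?y i * eval3 (P i) g) = (\<Sum>i\<in>Y. y i * heval t (subst_poly q g) (A i) (B i))"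
      using Y ev by (intro sum.mono_neutral_cong_right) auto
    also have "\<dots> = (\<Sum>e\<le>t. coeff (subst_poly q g) e * (\<Sum>i\<in>Y. (A i ^ e * B i ^ (t - e)) * y i))"
      unfolding heval_def sum_distrib_left by (subst sum.swap) (simp add: ac_simps)
    also have "\<dots> = 0" using y(2) by simp
    finally show "(\<Sum>i=1..s. ?y i * eval3 (P i) g) = 0" .
  qed (use Y in auto)
  from relations_t[OF this] y(1) show False by metis
qed

text \<open>
  The residual relation dot3 b1 (P i) * v i lives off the line b1 = 0; the second syzygy shows
  that it lives on a second line.
\<close>

lemma second_line:
  assumes b1: "b1 c1 \<noteq> 0" and b1u: "\<And>i. dot3 b1 (P i) * u i = 0"
  obtains b2 where "\<And>x y. \<forall>c. x * b1 c + y * b2 c = 0 \<Longrightarrow> x = 0 \<and> y = 0"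
    and "t + 1 \<le> card {i\<in>{1..s}. dot3 b1 (P i) = 0}"
    and "t \<le> card {i\<in>{1..s}. dot3 b1 (P i) \<noteq> 0 \<and> dot3 b2 (P i) = 0}"
proof -
  let ?Y1 = "{i\<in>{1..s}. dot3 b1 (P i) = 0}"
  have t1: "t - 1 + 2 = t + 1" "t - 1 = Suc (t - 2)" "t - 2 + 2 = t" using kt by auto
  obtain i0 where i0: "u i0 \<noteq> 0" using uv[of 1 0] by auto
  have su: "t + 1 \<le> card {i. u i \<noteq> 0}" using support_of_relation[OF u i0] t1 by simp
  have sub: "{i. u i \<noteq> 0} \<subseteq> ?Y1" using b1u relations_outside[OF u] by fastforce
  then have "card {i. u i \<noteq> 0} \<le> card ?Y1" by (intro card_mono) auto
  with su have Y1: "t + 1 \<le> card ?Y1" by simp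
  have Y1': "card ?Y1 \<le> t + 1" by (rule card_collinear[where b = b1 and ?e0.0 = c1]) (use b1 in auto)
  \<comment> \<open>Were \<open>v\<close> supported on the line too, the combination of
    \<open>u\<close> and \<open>v\<close> that vanishes at \<open>i0\<close> would live on at most
    \<open>t\<close> points, while a nonzero relation of degree \<open>t - 1\<close> needs
    \<open>t + 1\<close>.\<close>
  have "\<exists>i. dot3 b1 (P i) * v i \<noteq> 0"
  proof (rule ccontr)
    assume "\<not> ?thesis"
    then have b1v: "dot3 b1 (P i) * v i = 0" for i by blast
    define z where "z = (\<lambda>i. (- v i0 / u i0) * u i + 1 * v i)"
    have z: "z \<in> relations (t - 1)" unfolding z_def by (rule relations_lincomb[OF u v])
    have zi0: "z i0 = 0" using i0 by (simp add: z_def)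
    have "{i. z i \<noteq> 0} \<subseteq> ?Y1 - {i0}"
    proof
      fix i assume "i \<in> {i. z i \<noteq> 0}"
      then have i: "z i \<noteq> 0" by simp
      have "dot3 b1 (P i) * z i = 0" using b1u[of i] b1v[of i] by (auto simp: z_def)
      then show "i \<in> ?Y1 - {i0}" using i zi0 relations_outside[OF z] by fastforce
    qed
    moreover have "i0 \<in> ?Y1" using i0 sub by blast
    ultimately have "card {i. z i \<noteq> 0} < card ?Y1"
      by (intro psubset_card_mono) auto
    then have card_z: "card {i. z i \<noteq> 0} < t + 1" using Y1' by linarith
    have "\<forall>i. z i = 0"
    proof (intro allI, rule ccontr)
      fix i assume "z i \<noteq> 0"
      from support_of_relation[OF z this] card_z t1(1) show False by linarith
    qed
    from uv[OF this[unfolded z_def]] show False by simp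
  qed
  then obtain i1 where i1: "dot3 b1 (P i1) * v i1 \<noteq> 0" by blast
  obtain a b a' b' where syz: "\<And>i. dot3 a (P i) * u i + dot3 b (P i) * v i = 0"
    "\<And>i. dot3 a' (P i) * u i + dot3 b' (P i) * v i = 0"
    and ind: "\<And>x y. \<forall>c. x * a c + y * a' c = 0 \<Longrightarrow> \<forall>c. x * b c + y * b' c = 0 \<Longrightarrow> x = 0 \<and> y = 0"
    using two_syzygies by metis
  \<comment> \<open>Two syzygies without a \<open>v\<close> part would give independent linear forms
    vanishing on the support of \<open>u\<close>. They share only one zero in the plane, but the
    support has at least \<open>t + 1\<close> points.\<close>
  have "\<exists>a b. (\<forall>i. dot3 a (P i) * u i + dot3 b (P i) * v i = 0) \<and> (\<exists>c. b c \<noteq> 0)"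
  proof (rule ccontr)
    assume *: "\<not> ?thesis"
    have b0: "b = (\<lambda>_. 0)" "b' = (\<lambda>_. 0)" using * syz by blast+
    have inda: "x = 0 \<and> y = 0" if "\<forall>c. x * a c + y * a' c = 0" for x y
      using ind[OF that] b0 by simp
    have au: "dot3 a (P i) = 0" "dot3 a' (P i) = 0" if "u i \<noteq> 0" for i
      using syz[of i] that b0 by (simp_all add: dot3_def)
    have "i = i0" if i: "u i \<noteq> 0" for i
    proof -
      obtain r where r: "\<And>c. P i c = r * cross3 a a' c"
        using multiple_of_cross3[OF au[OF i] inda] by metis
      obtain r' where r': "\<And>c. P i0 c = r' * cross3 a a' c"
        using multiple_of_cross3[OF au[OF i0] inda] by metis
      show ?thesis using sub i i0 by (intro not_proportional) (auto simp: r r')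
    qed
    then have "{i. u i \<noteq> 0} \<subseteq> {i0}" by blast
    then have "card {i. u i \<noteq> 0} \<le> card {i0}" by (intro card_mono) auto
    with su kt show False by simp
  qed
  then obtain a2 b2 c2 where b2: "\<And>i. dot3 a2 (P i) * u i + dot3 b2 (P i) * v i = 0" "b2 c2 \<noteq> 0" by blast
  have b12v: "dot3 b2 (P i) * (dot3 b1 (P i) * v i) = 0" for i
  proof -
    have "dot3 b1 (P i) * (dot3 a2 (P i) * u i + dot3 b2 (P i) * v i)
      = dot3 a2 (P i) * (dot3 b1 (P i) * u i) + dot3 b2 (P i) * (dot3 b1 (P i) * v i)"
      by (simp add: algebra_simps)
    then show ?thesis using b2(1) b1u by simp
  qed
  show ?thesis
  proof (rule that[of b2, OF _ Y1])
    fix x y assume xy: "\<forall>c. x * b1 c + y * b2 c = 0"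
    have "x * dot3 b1 (P i1) + y * dot3 b2 (P i1) = dot3 (\<lambda>c. x * b1 c + y * b2 c) (P i1)"
      unfolding dot3_add dot3_smult ..
    also have "\<dots> = 0" using xy by (simp add: dot3_def)
    finally have "x * dot3 b1 (P i1) + y * dot3 b2 (P i1) = 0" .
    moreover have "dot3 b2 (P i1) = 0" using b12v[of i1] i1 by simp
    ultimately have "x = 0" using i1 by simp
    with xy b2(2) show "x = 0 \<and> y = 0" by auto
  next
    have rel: "(\<lambda>i. dot3 b1 (P i) * v i) \<in> relations (t - 2)"
      using v unfolding t1 by (rule relations_dot3)
    have "t \<le> card {i. dot3 b1 (P i) * v i \<noteq> 0}" using support_of_relation[OF rel i1] t1 by simp
    also have "\<dots> \<le> card {i\<in>{1..s}. dot3 b1 (P i) \<noteq> 0 \<and> dot3 b2 (P i) = 0}"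
    proof (intro card_mono subsetI CollectI)
      fix i assume "i \<in> {i. dot3 b1 (P i) * v i \<noteq> 0}"
      then have i: "dot3 b1 (P i) * v i \<noteq> 0" by simp
      then show "i \<in> {1..s} \<and> dot3 b1 (P i) \<noteq> 0 \<and> dot3 b2 (P i) = 0"
        using b12v[of i] relations_outside[OF rel, of i] by auto
    qed auto
    finally show "t \<le> card {i\<in>{1..s}. dot3 b1 (P i) \<noteq> 0 \<and> dot3 b2 (P i) = 0}" .
  qed
qed

text \<open>The lines meet where \<open>b1\<close> and \<open>b2\<close> both vanish, which is the
  point at infinity for the coordinates \<open>A\<close>, \<open>B1\<close> on the first line and
  \<open>A\<close>, \<open>B2\<close> on the second. The parameter \<open>y\<close> on the second
  line is fixed before \<open>x\<close>, since the weight which that line contributes at the meeting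
  point depends on \<open>y\<close>.\<close>

lemma hessians_nondegenerate_reducible:
  fixes \<alpha> :: "nat \<Rightarrow> 'a"
  assumes b1: "b1 c1 \<noteq> 0" and b1u: "\<And>i. dot3 b1 (P i) * u i = 0"
    and \<alpha>: "\<And>i. i \<in> {1..s} \<Longrightarrow> \<alpha> i \<noteq> 0" and d: "2 * t \<le> d"
  shows "\<exists>a. hessians_nondegenerate \<alpha> d a"
proof -
  obtain b2 where ind: "\<And>x y. \<forall>c. x * b1 c + y * b2 c = 0 \<Longrightarrow> x = 0 \<and> y = 0"
    and cards: "t + 1 \<le> card {i\<in>{1..s}. dot3 b1 (P i) = 0}"
      "t \<le> card {i\<in>{1..s}. dot3 b1 (P i) \<noteq> 0 \<and> dot3 b2 (P i) = 0}"
    by (rule second_line[OF b1 b1u]) (rule that)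
  obtain f r0 r1 r2 where coord: "\<And>p c. p c = r0 c * dot3 b1 p + r1 c * dot3 b2 p + r2 c * dot3 f p"
    by (rule complete_to_coordinates[of b1 b2]) (erule ind, rule that)
  define A where "A = (\<lambda>i. dot3 f (P i))"
  \<comment> \<open>\<open>B1\<close> is the second coordinate on the first line and so comes from
    the equation of the second line; likewise \<open>B2\<close> comes from that of the
    first.\<close>
  define B1 where "B1 = (\<lambda>i. dot3 b2 (P i))"
  define B2 where "B2 = (\<lambda>i. dot3 b1 (P i))"
  have P: "P i c = r0 c * B2 i + r1 c * B1 i + r2 c * A i" for i c
    unfolding A_def B1_def B2_def by (rule coord)
  have ABnz: "A i \<noteq> 0 \<or> B1 i \<noteq> 0 \<or> B2 i \<noteq> 0" if "i \<in> {1..s}" for i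
    using nonzero[OF that] P[of i] by auto
  define Y1 where "Y1 = {i\<in>{1..s}. B2 i = 0}"
  define Y2 where "Y2 = {i\<in>{1..s}. B2 i \<noteq> 0 \<and> B1 i = 0}"
  define Y where "Y = Y1 \<union> Y2"
  have Ys: "Y1 \<subseteq> {1..s}" "Y2 \<subseteq> {1..s}" "Y \<subseteq> {1..s}" "finite Y1" "finite Y2" "finite Y" "Y1 \<inter> Y2 = {}"
    by (auto simp: Y1_def Y2_def Y_def)
  have sumYY: "(\<Sum>i\<in>Y. z i) = (\<Sum>i\<in>Y1. z i) + (\<Sum>i\<in>Y2. z i)" for z :: "nat \<Rightarrow> 'a"
    unfolding Y_def using Ys by (intro sum.union_disjoint)
  have nc1: "noncollinear Y1 A B1" unfolding noncollinear_def
  proof (intro conjI ballI impI notI)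
    fix i j assume i: "i \<in> Y1" and j: "j \<in> Y1" and ij: "i \<noteq> j" and eq: "A i * B1 j = A j * B1 i"
    have "P i c * P j c' = P i c' * P j c" for c c'
    proof -
      have "P i c * P j c' - P i c' * P j c = (r1 c * r2 c' - r1 c' * r2 c) * (A j * B1 i - A i * B1 j)"
        using i j by (simp add: P Y1_def algebra_simps)
      then show ?thesis using eq by simp
    qed
    then have "i = j" using i j Ys by (intro not_proportional) auto
    with ij show False by simp
  qed (use ABnz in \<open>auto simp: Y1_def\<close>)
  have nc2: "noncollinear Y2 A B2" unfolding noncollinear_def
  proof (intro conjI ballI impI notI)
    fix i j assume i: "i \<in> Y2" and j: "j \<in> Y2" and ij: "i \<noteq> j" and eq: "A i * B2 j = A j * B2 i"
    have "P i c * P j c' = P i c' * P j c" for c c'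
    proof -
      have "P i c * P j c' - P i c' * P j c = (r0 c * r2 c' - r0 c' * r2 c) * (A j * B2 i - A i * B2 j)"
        using i j by (simp add: P Y2_def algebra_simps)
      then show ?thesis using eq by simp
    qed
    then have "i = j" using i j Ys by (intro not_proportional) auto
    with ij show False by simp
  qed (simp add: Y2_def)

  define q1 where "q1 = (\<lambda>c. [:r1 c, r2 c:])"
  define q2 where "q2 = (\<lambda>c. [:r0 c, r2 c:])"
  have deg_q: "degree (q1 c) \<le> 1" "degree (q2 c) \<le> 1" for c by (simp_all add: q1_def q2_def)
  have ev1: "eval3 (P i) g = heval j (subst_poly q1 g) (A i) (B1 i)" if "i \<in> Y1" "g \<in> forms j" for i g j
  proof -
    have "P i = (\<lambda>c. heval 1 (q1 c) (A i) (B1 i))"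
      unfolding q1_def heval_linear using P[of i] that(1) by (auto simp: fun_eq_iff Y1_def)
    then show ?thesis
      using heval_subst_poly(2)[OF deg_q(1) that(2), where a = "A i" and b = "B1 i"] by simp
  qed
  have ev2: "eval3 (P i) g = heval j (subst_poly q2 g) (A i) (B2 i)" if "i \<in> Y2" "g \<in> forms j" for i g j
  proof -
    have "P i = (\<lambda>c. heval 1 (q2 c) (A i) (B2 i))"
      unfolding q2_def heval_linear using P[of i] that(1) by (auto simp: fun_eq_iff Y2_def)
    then show ?thesis
      using heval_subst_poly(2)[OF deg_q(2) that(2), where a = "A i" and b = "B2 i"] by simp
  qed
  have deg: "degree (subst_poly q1 g) \<le> j" "degree (subst_poly q2 g) \<le> j" if "g \<in> forms j" for g j
    using heval_subst_poly(1)[OF deg_q(1) that] heval_subst_poly(1)[OF deg_q(2) that] by simp_all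
  text \<open>Both coefficients are the value of g at the intersection point of the two lines.\<close>
  have meet: "coeff (subst_poly q1 g) j = coeff (subst_poly q2 g) j" if g: "g \<in> forms j" for g j
  proof -
    have "coeff (subst_poly q g) j = eval3 r2 g"
      if q: "\<And>c. degree (q c) \<le> 1" "\<And>c. coeff (q c) 1 = r2 c" for q
    proof -
      have "(\<lambda>c. heval 1 (q c) 1 0) = r2" using q(2) by (auto simp: heval_at_infinity)
      then show ?thesis
        using heval_subst_poly(2)[OF q(1) g, where a = 1 and b = 0] by (simp add: heval_at_infinity)
    qed
    from this[of q1] this[of q2] deg_q show ?thesis by (simp add: q1_def q2_def)
  qed

  have cb: "conic_bound Y"
    unfolding conic_bound_def
  proof (intro allI exI impI)
    fix j y
    \<comment> \<open>\<open>j\<close> conditions on each line, for the monomials vanishing at the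
      meeting point, and one joint condition for \<open>A ^ j\<close>: in all
      \<open>2 * j + 1\<close>.\<close>
    let ?M = "\<lambda>e i. if e < j then if i \<in> Y1 then A i ^ e * B1 i ^ (j - e) else 0
      else if e < 2 * j then if i \<in> Y2 then A i ^ (e - j) * B2 i ^ (j - (e - j)) else 0
      else A i ^ j"
    assume y0: "\<forall>i. i \<notin> Y \<longrightarrow> y i = 0" and y: "\<forall>e\<le>2 * j. (\<Sum>i\<in>Y. ?M e i * y i) = 0"
    have y1: "(\<Sum>i\<in>Y1. A i ^ e * B1 i ^ (j - e) * y i) = 0" if "e < j" for e
    proof -
      have "(\<Sum>i\<in>Y. ?M e i * y i) = 0" by (rule y[rule_format]) (use that in simp)
      moreover have "(\<Sum>i\<in>Y1. ?M e i * y i) = (\<Sum>i\<in>Y1. A i ^ e * B1 i ^ (j - e) * y i)"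
        using that by (intro sum.cong) auto
      moreover have "(\<Sum>i\<in>Y2. ?M e i * y i) = 0" using that Ys by (intro sum.neutral) auto
      ultimately show ?thesis unfolding sumYY by simp
    qed
    have y2: "(\<Sum>i\<in>Y2. A i ^ e * B2 i ^ (j - e) * y i) = 0" if "e < j" for e
    proof -
      have "(\<Sum>i\<in>Y. ?M (j + e) i * y i) = 0" by (rule y[rule_format]) (use that in simp)
      moreover have "(\<Sum>i\<in>Y2. ?M (j + e) i * y i) = (\<Sum>i\<in>Y2. A i ^ e * B2 i ^ (j - e) * y i)"
        using that by (intro sum.cong) auto
      moreover have "(\<Sum>i\<in>Y1. ?M (j + e) i * y i) = 0" using that Ys by (intro sum.neutral) auto
      ultimately show ?thesis unfolding sumYY by simp
    qed
    have "(\<Sum>i\<in>Y. ?M (2 * j) i * y i) = 0" using y by blast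
    then have y3: "(\<Sum>i\<in>Y1. A i ^ j * y i) + (\<Sum>i\<in>Y2. A i ^ j * y i) = 0" by (simp add: sumYY)
    show "y \<in> relations j" unfolding relations_def
    proof (intro CollectI conjI ballI allI impI)
      fix g :: "'a pol" assume g: "g \<in> forms j"
      let ?G1 = "subst_poly q1 g" and ?G2 = "subst_poly q2 g"
      have split: "(\<Sum>i\<in>Z. y i * heval j G (A i) (B i))
        = (\<Sum>e<j. coeff G e * (\<Sum>i\<in>Z. A i ^ e * B i ^ (j - e) * y i)) + coeff G j * (\<Sum>i\<in>Z. A i ^ j * y i)" for Z G B
        unfolding heval_split distrib_left sum.distrib sum_distrib_left
        by (subst sum.swap) (simp add: ac_simps)
      have "(\<Sum>i=1..s. y i * eval3 (P i) g) = (\<Sum>i\<in>Y. y i * eval3 (P i) g)"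
        using y0 Ys by (intro sum.mono_neutral_right) auto
      also have "\<dots> = (\<Sum>i\<in>Y1. y i * heval j ?G1 (A i) (B1 i)) + (\<Sum>i\<in>Y2. y i * heval j ?G2 (A i) (B2 i))"
        unfolding sumYY using ev1[OF _ g] ev2[OF _ g] by simp
      also have "\<dots> = coeff ?G2 j * ((\<Sum>i\<in>Y1. A i ^ j * y i) + (\<Sum>i\<in>Y2. A i ^ j * y i))"
        unfolding split meet[OF g] using y1 y2 by (simp add: distrib_left)
      finally show "(\<Sum>i=1..s. y i * eval3 (P i) g) = 0" using y3 by simp
    next
      fix i assume "i \<notin> {1..s}"
      then show "y i = 0" using y0 Ys by blast
    qed
  qed

  have cY1: "t + 1 \<le> card Y1" and cY2: "t \<le> card Y2"
    using cards by (simp_all add: Y1_def Y2_def B1_def B2_def)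
  have cY: "card Y = card Y1 + card Y2" unfolding Y_def using Ys by (intro card_Un_disjoint)
  have card_ge: "2 * t + 1 \<le> card Y" using cY cY1 cY2 by simp
  have card1: "card Y1 = t + 1" and card2: "card Y2 = t"
    using card_conic_bound[OF Ys(3) cb] cY cY1 cY2 by simp_all
  \<comment> \<open>At most one of the \<open>t + 1\<close> points is the meeting point, whose
    weight might cancel.\<close>
  have cY1': "t \<le> card {i\<in>Y1. \<alpha> i \<noteq> 0 \<and> B1 i \<noteq> 0}"
  proof -
    have "i = i'" if "i \<in> Y1" "B1 i = 0" "i' \<in> Y1" "B1 i' = 0" for i i'
      using nc1 that unfolding noncollinear_def by fastforce
    then have "card {i\<in>Y1. B1 i = 0} \<le> 1" using Ys by (intro card_le_Suc0_iff_eq[THEN iffD2, simplified One_nat_def[symmetric]]) auto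
    moreover have "card Y1 = card {i\<in>Y1. B1 i = 0} + card {i\<in>Y1. \<alpha> i \<noteq> 0 \<and> B1 i \<noteq> 0}"
      using Ys \<alpha> by (subst card_Un_disjoint[symmetric]) (auto intro!: arg_cong[of _ _ card])
    ultimately show ?thesis using card1 by simp
  qed
  have cY2': "{i\<in>Y2. \<alpha> i \<noteq> 0} = Y2" using \<alpha> Ys by auto

  \<comment> \<open>Multiples of \<open>b2\<close> vanish on \<open>Y2\<close> and multiples of
    \<open>b1\<close> on \<open>Y1\<close>, so for \<open>e < j\<close> each line obeys its own
    equations; only the power of \<open>f\<close> couples the lines.\<close>
  have rel1: "(\<Sum>i\<in>Y1. z i * (A i ^ e * B1 i ^ (j - e))) = 0"
    and rel2: "(\<Sum>i\<in>Y2. z i * (A i ^ e * B2 i ^ (j - e))) = 0"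
    if z: "z \<in> relations j" and z0: "\<And>i. i \<notin> Y \<Longrightarrow> z i = 0" and e: "e < j" for z e j
  proof -
    have *: "(\<Sum>i\<in>Y. z i * (dot3 f (P i) ^ e * dot3 b (P i) ^ (j - e))) = 0" for b
    proof -
      let ?g = "linform f ^ e * linform b ^ (j - e)"
      have "?g \<in> forms (1 * e + 1 * (j - e))" by (intro forms_mult forms_power linform_in_forms)
      then have "(\<Sum>i=1..s. z i * eval3 (P i) ?g) = 0" using e by (intro relations_sum[OF z]) simp
      moreover have "(\<Sum>i=1..s. z i * eval3 (P i) ?g) = (\<Sum>i\<in>Y. z i * eval3 (P i) ?g)"
        using z0 Ys by (intro sum.mono_neutral_right) auto
      ultimately show ?thesis by (simp add: eval3_mult eval3_power eval3_linform_dot3)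
    qed
    have "(\<Sum>i\<in>Y2. z i * (A i ^ e * B1 i ^ (j - e))) = 0" "(\<Sum>i\<in>Y1. z i * (A i ^ e * B2 i ^ (j - e))) = 0"
      using e by (auto intro!: sum.neutral simp: Y1_def Y2_def)
    with *[of b2] *[of b1] show "(\<Sum>i\<in>Y1. z i * (A i ^ e * B1 i ^ (j - e))) = 0"
      "(\<Sum>i\<in>Y2. z i * (A i ^ e * B2 i ^ (j - e))) = 0"
      unfolding A_def[symmetric] B1_def[symmetric] B2_def[symmetric]
      by (simp_all add: sumYY A_def[THEN fun_cong, symmetric] B1_def[THEN fun_cong, symmetric] B2_def[THEN fun_cong, symmetric])
  qed
  have rel3: "(\<Sum>i\<in>Y1. z i * A i ^ j) + (\<Sum>i\<in>Y2. z i * A i ^ j) = 0"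
    if z: "z \<in> relations j" and z0: "\<And>i. i \<notin> Y \<Longrightarrow> z i = 0" for z j
  proof -
    have "linform f ^ j \<in> forms (1 * j)" by (intro forms_power linform_in_forms)
    then have "(\<Sum>i=1..s. z i * eval3 (P i) (linform f ^ j)) = 0" by (intro relations_sum[OF z]) simp
    moreover have "(\<Sum>i=1..s. z i * eval3 (P i) (linform f ^ j)) = (\<Sum>i\<in>Y. z i * eval3 (P i) (linform f ^ j))"
      using z0 Ys by (intro sum.mono_neutral_right) auto
    ultimately show ?thesis by (simp add: eval3_power eval3_linform_dot3 sumYY A_def)
  qed

  define N where "N = (\<lambda>j. d - j)"
  \<comment> \<open>\<open>K\<close> collects the equations on the second line whose test monomials
    vanish at the meeting point. Avoiding \<open>bad2\<close> means that no nonzero solution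
    vanishes there itself.\<close>
  define K where "K = (\<lambda>j y G. \<forall>e<j. (\<Sum>i\<in>Y2. \<alpha> i * heval (N j) ([:-y, 1:] ^ (N j - j) * G) (A i) (B2 i)
      * (A i ^ e * B2 i ^ (j - e))) = 0)"
  define bad2 where "bad2 = (\<lambda>j. {y. \<exists>G. G \<noteq> 0 \<and> degree G \<le> j \<and> coeff G j = 0 \<and> K j y G})"
  have fin_bad2: "finite (bad2 j)" if j: "j < t" for j
    unfolding bad2_def K_def
    by (rule binary_hessian_nondegenerate_vanishing_at_infinity[OF Ys(5) nc2])
       (use j d card2 cY2' in \<open>auto simp: N_def Y2_def\<close>)
  \<comment> \<open>Where \<open>B1 i = 0\<close> the parameter \<open>x\<close> has no influence on
    \<open>l\<close>, so \<open>y\<close> alone must make \<open>l\<close> miss the point.\<close>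
  define badA where "badA = (\<lambda>i. {y. B1 i = 0 \<and> A i = y * B2 i})"
  have fin_badA: "finite (badA i)" if i: "i \<in> {1..s}" for i
  proof (cases "B1 i = 0 \<and> B2 i \<noteq> 0")
    case True
    then have "badA i \<subseteq> {A i / B2 i}" by (auto simp: badA_def)
    then show ?thesis by (rule finite_subset) simp
  next
    case False
    then have "badA i = {}" using ABnz[OF i] by (auto simp: badA_def)
    then show ?thesis by simp
  qed
  have "finite ((\<Union>j<t. bad2 j) \<union> (\<Union>i\<in>{1..s}. badA i))" using fin_bad2 fin_badA by blast
  then obtain y where y: "y \<notin> (\<Union>j<t. bad2 j) \<union> (\<Union>i\<in>{1..s}. badA i)"
    using infinite_UNIV_char_0[where 'a='a] by (metis UNIV_I finite_subset subsetI)

  have y_good: "G = 0" if "j < t" "degree G \<le> j" "coeff G j = 0" "K j y G" for j G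
  proof (rule ccontr)
    assume "G \<noteq> 0"
    with that have "y \<in> bad2 j" unfolding bad2_def by blast
    with y that(1) show False by blast
  qed
  define \<Phi> where "\<Phi> = (\<lambda>j G. \<Sum>i\<in>Y2. \<alpha> i * heval (N j) ([:-y, 1:] ^ (N j - j) * G) (A i) (B2 i) * A i ^ j)"
  \<comment> \<open>By \<open>y_good\<close> a solution of \<open>K\<close> is determined by its
    coefficient of degree \<open>j\<close>, so the linear functional \<open>\<Phi>\<close> is a
    multiple of that coefficient on the solutions. If no solution has it nonzero, the only solution
    is 0 and the factor 0 will do.\<close>
  have "\<exists>r. \<forall>G. degree G \<le> j \<longrightarrow> K j y G \<longrightarrow> \<Phi> j G = r * coeff G j" if j: "j < t" for j
  proof (cases "\<exists>G0. degree G0 \<le> j \<and> K j y G0 \<and> coeff G0 j \<noteq> 0")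
    case False
    have "\<Phi> j G = 0" if "degree G \<le> j" "K j y G" for G
    proof -
      have "coeff G j = 0" using False that by blast
      with that have "G = 0" using y_good[OF j] by blast
      then show ?thesis by (simp add: \<Phi>_def)
    qed
    then show ?thesis by (intro exI[of _ 0]) simp
  next
    case True
    then obtain G0 where G0: "degree G0 \<le> j" "K j y G0" "coeff G0 j \<noteq> 0" by blast
    have lin: "heval (N j) ([:-y, 1:] ^ (N j - j) * (G - Polynomial.smult e G0)) p q
      = heval (N j) ([:-y, 1:] ^ (N j - j) * G) p q - e * heval (N j) ([:-y, 1:] ^ (N j - j) * G0) p q" for G e p q
      by (simp only: right_diff_distrib mult_smult_right heval_diff heval_smult)
    have "\<Phi> j G = \<Phi> j G0 / coeff G0 j * coeff G j" if G: "degree G \<le> j" "K j y G" for G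
    proof -
      define e where "e = coeff G j / coeff G0 j"
      let ?H = "G - Polynomial.smult e G0"
      have "degree ?H \<le> j" using G(1) G0(1) by (intro degree_diff_le order_trans[OF degree_smult_le])
      moreover have "coeff ?H j = 0" using G0(3) by (simp add: e_def)
      moreover have "K j y ?H" unfolding K_def
      proof (intro allI impI)
        fix e' assume "e' < j"
        then have "(\<Sum>i\<in>Y2. \<alpha> i * heval (N j) ([:-y, 1:] ^ (N j - j) * G) (A i) (B2 i) * (A i ^ e' * B2 i ^ (j - e'))) = 0"
          "(\<Sum>i\<in>Y2. \<alpha> i * heval (N j) ([:-y, 1:] ^ (N j - j) * G0) (A i) (B2 i) * (A i ^ e' * B2 i ^ (j - e'))) = 0"
          using G(2) G0(2) unfolding K_def by blast+
        moreover have "(\<Sum>i\<in>Y2. \<alpha> i * heval (N j) ([:-y, 1:] ^ (N j - j) * ?H) (A i) (B2 i) * (A i ^ e' * B2 i ^ (j - e')))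
          = (\<Sum>i\<in>Y2. \<alpha> i * heval (N j) ([:-y, 1:] ^ (N j - j) * G) (A i) (B2 i) * (A i ^ e' * B2 i ^ (j - e')))
          - e * (\<Sum>i\<in>Y2. \<alpha> i * heval (N j) ([:-y, 1:] ^ (N j - j) * G0) (A i) (B2 i) * (A i ^ e' * B2 i ^ (j - e')))"
          unfolding lin sum_distrib_left sum_subtractf[symmetric]
          by (intro sum.cong) (simp_all only: algebra_simps)
        ultimately show "(\<Sum>i\<in>Y2. \<alpha> i * heval (N j) ([:-y, 1:] ^ (N j - j) * ?H) (A i) (B2 i) * (A i ^ e' * B2 i ^ (j - e'))) = 0"
          by simp
      qed
      ultimately have "?H = 0" using y_good[OF j] by blast
      then have "G = Polynomial.smult e G0" by simp
      then have "\<Phi> j G = e * \<Phi> j G0"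
        by (simp only: \<Phi>_def mult_smult_right heval_smult sum_distrib_left) (simp only: ac_simps)
      then show ?thesis by (simp add: e_def)
    qed
    then show ?thesis by blast
  qed
  then obtain r where r: "\<And>j G. j < t \<Longrightarrow> degree G \<le> j \<Longrightarrow> K j y G \<Longrightarrow> \<Phi> j G = r j * coeff G j" by metis

  define bad1 where "bad1 = (\<lambda>j. {x. \<exists>G. G \<noteq> 0 \<and> degree G \<le> j \<and> (\<forall>h. degree h \<le> j \<longrightarrow>
    (\<Sum>i\<in>Y1. \<alpha> i * heval (N j) ([:-x, 1:] ^ (N j - j) * G) (A i) (B1 i) * heval j h (A i) (B1 i))
      + r j * coeff G j * coeff h j = 0)})"
  have fin_bad1: "finite (bad1 j)" if j: "j < t" for j
    unfolding bad1_def
    by (rule binary_hessian_nondegenerate_infinity[OF Ys(4) nc1])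
       (use j d card1 cY1' in \<open>auto simp: N_def\<close>)
  define badB where "badB = (\<lambda>i. {x. A i - y * B2 i = x * B1 i})"
  have fin_badB: "finite (badB i)" if i: "i \<in> {1..s}" for i
  proof (cases "B1 i = 0")
    case True
    then have "badB i = {}" using y i by (auto simp: badA_def badB_def)
    then show ?thesis by simp
  next
    case False
    then have "badB i \<subseteq> {(A i - y * B2 i) / B1 i}" by (auto simp: badB_def)
    then show ?thesis by (rule finite_subset) simp
  qed
  have "finite ((\<Union>j<t. bad1 j) \<union> (\<Union>i\<in>{1..s}. badB i))" using fin_bad1 fin_badB by blast
  then obtain x where x: "x \<notin> (\<Union>j<t. bad1 j) \<union> (\<Union>i\<in>{1..s}. badB i)"
    using infinite_UNIV_char_0[where 'a='a] by (metis UNIV_I finite_subset subsetI)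

  define l where "l = (\<lambda>c. f c - x * b2 c - y * b1 c)"
  have dot_l: "dot3 l (P i) = A i - x * B1 i - y * B2 i" for i
    unfolding l_def A_def B1_def B2_def dot3_diff dot3_smult ..
  have l_nz: "dot3 l (P i) \<noteq> 0" if "i \<in> {1..s}" for i
  proof
    assume "dot3 l (P i) = 0"
    then have "x \<in> badB i" by (simp add: dot_l badB_def algebra_simps)
    with x that show False by blast
  qed
  have "hessians_nondegenerate \<alpha> d l" unfolding hessians_nondegenerate_def
  proof (intro conjI ballI allI impI)
    fix i assume "i \<in> {1..s}"
    then show "dot3 l (P i) \<noteq> 0" by (rule l_nz)
  next
    fix j i and g :: "'a pol"
    assume j: "k - 1 \<le> j" "j < t" and g: "g \<in> forms j" and i: "i \<in> {1..s}"
    define z where "z = (\<lambda>i. if i \<in> {1..s} then \<alpha> i * dot3 l (P i) ^ (d - 2 * j) * eval3 (P i) g else 0)"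
    assume "(\<lambda>i. if i \<in> {1..s} then \<alpha> i * dot3 l (P i) ^ (d - 2 * j) * eval3 (P i) g else 0) \<in> relations j"
    then have z: "z \<in> relations j" by (simp only: z_def)
    have z0: "z i = 0" if "i \<notin> Y" for i
      by (rule relations_supported[OF Ys(3) cb card_ge j(1) _ z that]) (use j in simp)
    let ?G1 = "subst_poly q1 g" and ?G2 = "subst_poly q2 g"
    have jN: "j \<le> N j" "d - 2 * j = N j - j" using d j unfolding N_def by linarith+
    have z1: "z i = \<alpha> i * heval (N j) ([:-x, 1:] ^ (N j - j) * ?G1) (A i) (B1 i)" if "i \<in> Y1" for i
      unfolding heval_linear_power_mult[OF deg(1)[OF g] jN(1)] ev1[OF that g, symmetric]
      using that by (simp add: z_def dot_l jN(2) Y1_def)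
    have z2: "z i = \<alpha> i * heval (N j) ([:-y, 1:] ^ (N j - j) * ?G2) (A i) (B2 i)" if "i \<in> Y2" for i
      unfolding heval_linear_power_mult[OF deg(2)[OF g] jN(1)] ev2[OF that g, symmetric]
      using that by (simp add: z_def dot_l jN(2) Y2_def)
    have K: "K j y ?G2" unfolding K_def using rel2[OF z z0] by (simp add: z2 cong: sum.cong)
    have "\<Phi> j ?G2 = (\<Sum>i\<in>Y2. z i * A i ^ j)" unfolding \<Phi>_def by (intro sum.cong) (simp_all add: z2)
    then have tail: "(\<Sum>i\<in>Y2. z i * A i ^ j) = r j * coeff ?G1 j"
      using r[OF j(2) deg(2)[OF g] K] meet[OF g] by simp
    have "(\<Sum>i\<in>Y1. \<alpha> i * heval (N j) ([:-x, 1:] ^ (N j - j) * ?G1) (A i) (B1 i) * heval j h (A i) (B1 i))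
      + r j * coeff ?G1 j * coeff h j = 0" for h
    proof -
      have "(\<Sum>i\<in>Y1. \<alpha> i * heval (N j) ([:-x, 1:] ^ (N j - j) * ?G1) (A i) (B1 i) * heval j h (A i) (B1 i))
        = (\<Sum>i\<in>Y1. z i * heval j h (A i) (B1 i))" by (intro sum.cong) (simp_all add: z1)
      also have "\<dots> = (\<Sum>e<j. coeff h e * (\<Sum>i\<in>Y1. z i * (A i ^ e * B1 i ^ (j - e)))) + coeff h j * (\<Sum>i\<in>Y1. z i * A i ^ j)"
        unfolding heval_split distrib_left sum.distrib sum_distrib_left
        by (subst sum.swap) (simp add: ac_simps)
      also have "\<dots> = coeff h j * (\<Sum>i\<in>Y1. z i * A i ^ j)" using rel1[OF z z0] by simp
      finally have eq: "(\<Sum>i\<in>Y1. \<alpha> i * heval (N j) ([:-x, 1:] ^ (N j - j) * ?G1) (A i) (B1 i) * heval j h (A i) (B1 i))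
        = coeff h j * (\<Sum>i\<in>Y1. z i * A i ^ j)" .
      have "(\<Sum>i\<in>Y1. z i * A i ^ j) = - (r j * coeff ?G1 j)"
        using rel3[OF z z0] tail by (simp add: eq_neg_iff_add_eq_0)
      then show ?thesis unfolding eq by (simp add: algebra_simps)
    qed
    then have "x \<in> bad1 j" if "?G1 \<noteq> 0" unfolding bad1_def using that deg(1)[OF g] by blast
    then have G1: "?G1 = 0" using x j by blast
    \<comment> \<open>Vanishing on the first line forces vanishing at the meeting point, which makes
      \<open>y_good\<close> applicable on the second.\<close>
    then have "coeff ?G2 j = 0" using meet[OF g] by simp
    then have G2: "?G2 = 0" using y_good[OF j(2) deg(2)[OF g] _ K] by blast
    show "eval3 (P i) g = 0"
    proof (cases "i \<in> Y")
      case True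
      then show ?thesis using ev1[OF _ g, of i] ev2[OF _ g, of i] G1 G2 by (auto simp: Y_def)
    next
      case False
      then show ?thesis using z0[OF False] \<alpha>[OF i] i l_nz[OF i] by (simp add: z_def)
    qed
  qed
  then show ?thesis by blast
qed

end

subsection \<open>Hilbert functions and Hessians\<close>

context conic_points
begin

text \<open>If a nonzero linear form kills a nonzero relation \<open>w\<close>, then
  \<open>w\<close> takes the place of \<open>u\<close>: one of \<open>u\<close> and \<open>v\<close>
  is not a multiple of \<open>w\<close>, and the pair interprets the locale anew.\<close>

lemma exists_hessians_nondegenerate:
  fixes \<alpha> :: "nat \<Rightarrow> 'a"
  assumes \<alpha>: "\<And>i. i \<in> {1..s} \<Longrightarrow> \<alpha> i \<noteq> 0" and d: "2 * t \<le> d"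
  shows "\<exists>a. hessians_nondegenerate \<alpha> d a"
proof (cases "\<exists>b w. w \<in> relations (t - 1) \<and> (\<forall>i. dot3 b (P i) * w i = 0) \<and> (\<exists>c. b c \<noteq> 0) \<and> (\<exists>i. w i \<noteq> 0)")
  case False
  then show ?thesis using \<alpha> d by (intro hessians_nondegenerate_irreducible) blast+
next
  case True
  then obtain b w c i where w: "w \<in> relations (t - 1)" "\<And>i. dot3 b (P i) * w i = 0" "b c \<noteq> 0" "w i \<noteq> 0"
    by blast
  have "\<exists>v'\<in>{u, v}. \<forall>x y. (\<forall>i. x * w i + y * v' i = 0) \<longrightarrow> x = 0 \<and> y = 0"
  proof (rule ccontr)
    assume *: "\<not> ?thesis"
    have mult: "\<exists>r. \<forall>i. v' i = r * w i" if v': "v' \<in> {u, v}" for v'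
    proof -
      obtain x y where xy: "\<And>i. x * w i + y * v' i = 0" "x \<noteq> 0 \<or> y \<noteq> 0" using * v' by blast
      have "y \<noteq> 0" using xy(1)[of i] xy(2) w(4) by auto
      then have "v' i = (- x / y) * w i" for i using xy(1)[of i] by (simp add: field_simps add_eq_0_iff2)
      then show ?thesis by blast
    qed
    obtain r r' where r: "\<And>i. u i = r * w i" "\<And>i. v i = r' * w i" using mult[of u] mult[of v] by auto
    have "r' = 0 \<and> - r = 0" by (rule uv) (simp add: r)
    then have "1 = (0::'a) \<and> (0::'a) = 0" by (intro uv) (simp add: r)
    then show False by simp
  qed
  then obtain v' where v': "v' \<in> {u, v}" "\<And>x y. \<forall>i. x * w i + y * v' i = 0 \<Longrightarrow> x = 0 \<and> y = 0" by blast
  interpret W: conic_points P s t k w v'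
  proof unfold_locales
    show "v' \<in> relations (t - 1)" using v'(1) u v by auto
    show "x = 0 \<and> y = 0" if "\<forall>i. x * w i + y * v' i = 0" for x y by (rule v'(2)[OF that])
  qed (fact kt determining w(1))+
  show ?thesis by (rule W.hessians_nondegenerate_reducible[OF w(3,2) \<alpha> d])
qed

end

section \<open>Graded components modulo the ideal of the points\<close>

lemma basis_of_component_cong:
  assumes "\<And>g. g \<in> forms j \<Longrightarrow> g \<in> I \<longleftrightarrow> g \<in> J"
  shows "basis_of_component I j bs \<longleftrightarrow> basis_of_component J j bs"
proof (cases "set bs \<subseteq> forms j")
  case True
  then have comb: "(\<Sum>u<length bs. smult3 (c u) (bs ! u)) \<in> forms j" for c
    by (intro forms_sum forms_smult3) auto
  show ?thesis unfolding basis_of_component_def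
    using assms[OF comb] assms[OF forms_diff[OF _ comb]] by (simp cong: ball_cong)
qed (simp add: basis_of_component_def)

lemma hilb_cong:
  assumes "\<And>g. g \<in> forms j \<Longrightarrow> g \<in> I \<longleftrightarrow> g \<in> J"
  shows "hilb I j = hilb J j"
proof -
  have "basis_of_component I j = basis_of_component J j"
    using basis_of_component_cong[OF assms] by blast
  then show ?thesis by (simp add: hilb_def)
qed

context plane_points
begin

definition vanishes :: "'k pol \<Rightarrow> bool" where
  "vanishes g \<longleftrightarrow> (\<forall>i\<in>{1..s}. eval3 (P i) g = 0)"

lemma vanishing_ideal_iff:
  assumes g: "g \<in> forms j"
  shows "g \<in> vanishing_ideal (P ` {1..s}) \<longleftrightarrow> vanishes g"
proof -
  interpret pol: Modules.module "(*) :: 'k pol \<Rightarrow> 'k pol \<Rightarrow> 'k pol"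
    by unfold_locales (simp_all add: algebra_simps)
  let ?S = "{f :: 'k pol. (\<exists>n. f \<in> forms n) \<and> (\<forall>p\<in>P ` {1..s}. eval3 p f = 0)}"
  have sub: "pol.span ?S \<subseteq> {f. vanishes f}"
  proof (rule pol.span_minimal)
    show "pol.subspace {f. vanishes f}"
      by (rule pol.subspaceI) (auto simp: vanishes_def eval3_add eval3_mult)
  qed (auto simp: vanishes_def)
  show ?thesis
  proof
    assume "g \<in> vanishing_ideal (P ` {1..s})"
    then show "vanishes g" using sub unfolding vanishing_ideal_def by blast
  next
    assume "vanishes g"
    then have "g \<in> ?S" using g by (auto simp: vanishes_def)
    then show "g \<in> vanishing_ideal (P ` {1..s})" unfolding vanishing_ideal_def by (rule pol.span_base)
  qed
qed

lemma vanishes_lincomb: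
  "vanishes (\<Sum>u\<in>A. smult3 (c u) (f u)) \<longleftrightarrow> (\<forall>i\<in>{1..s}. (\<Sum>u\<in>A. c u * eval3 (P i) (f u)) = 0)"
  by (simp add: vanishes_def eval3_sum eval3_smult3)

lemma independent_mod_vanishing_bound:
  fixes n :: nat
  assumes "\<And>c. vanishes (\<Sum>u<n. smult3 (c u) (f u)) \<Longrightarrow> \<forall>u<n. c u = 0"
  shows "n \<le> s"
proof (rule ccontr)
  assume "\<not> n \<le> s"
  then obtain c where c: "\<exists>u\<in>{..<n}. c u \<noteq> 0" "\<forall>i\<in>{1..s}. (\<Sum>u\<in>{..<n}. eval3 (P i) (f u) * c u) = 0"
    using homogeneous_system[of "{1..s}" "{..<n}" "\<lambda>i u. eval3 (P i) (f u)"] by auto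
  have "vanishes (\<Sum>u<n. smult3 (c u) (f u))"
    unfolding vanishes_lincomb using c(2) by (simp add: mult.commute)
  from assms[OF this] c(1) show False by auto
qed

text \<open>\<open>hilb\<close> picks a basis by \<open>SOME\<close>, so its value means something
  only once a basis exists. A longest independent list, bounded in length by the number of points,
  spans.\<close>

lemma basis_exists:
  assumes I: "\<And>g. g \<in> forms j \<Longrightarrow> g \<in> I \<longleftrightarrow> vanishes g"
  shows "\<exists>bs. basis_of_component I j bs"
proof -
  define Q where "Q = (\<lambda>bs. set bs \<subseteq> forms j \<and>
    (\<forall>c. vanishes (\<Sum>u<length bs. smult3 (c u) (bs ! u)) \<longrightarrow> (\<forall>u<length bs. c u = 0)))"
  have "Q []" by (simp add: Q_def)
  moreover have "\<forall>bs. Q bs \<longrightarrow> length bs < Suc s"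
  proof (intro allI impI)
    fix bs assume "Q bs"
    then have "length bs \<le> s"
      by (intro independent_mod_vanishing_bound[where n = "length bs" and f = "\<lambda>u. bs ! u"]) (simp add: Q_def)
    then show "length bs < Suc s" by simp
  qed
  ultimately obtain bs where bs: "Q bs" "\<And>bs'. Q bs' \<Longrightarrow> length bs' \<le> length bs"
    using ex_has_greatest_nat[of Q "[]" length "Suc s"] by blast
  have sub: "set bs \<subseteq> forms j" using bs(1) by (simp add: Q_def)
  have comb: "(\<Sum>u<length bs. smult3 (c u) (bs ! u)) \<in> forms j" for c
    using sub by (intro forms_sum forms_smult3) auto
  have span: "\<exists>c. g - (\<Sum>u<length bs. smult3 (c u) (bs ! u)) \<in> I" if g: "g \<in> forms j" for g
  proof -
    have "\<not> Q (bs @ [g])" using bs(2)[of "bs @ [g]"] by auto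
    moreover have "set (bs @ [g]) \<subseteq> forms j" using sub g by simp
    ultimately obtain c u0 where c: "vanishes (\<Sum>u<length (bs @ [g]). smult3 (c u) ((bs @ [g]) ! u))"
      "u0 < length (bs @ [g])" "c u0 \<noteq> 0" unfolding Q_def by blast
    have s: "(\<Sum>u<length (bs @ [g]). smult3 (c u) ((bs @ [g]) ! u))
      = (\<Sum>u<length bs. smult3 (c u) (bs ! u)) + smult3 (c (length bs)) g"
      by (simp add: nth_append)
    let ?n = "length bs"
    have "c ?n \<noteq> 0"
    proof
      assume 0: "c ?n = 0"
      with c(1) s have "vanishes (\<Sum>u<?n. smult3 (c u) (bs ! u))" by simp
      with bs(1) have "\<forall>u<?n. c u = 0" by (simp add: Q_def)
      with 0 c(2,3) show False by (auto simp: less_Suc_eq)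
    qed
    define e where "e = (\<lambda>u. - c u / c ?n)"
    have "g - (\<Sum>u<?n. smult3 (e u) (bs ! u)) = smult3 (1 / c ?n) ((\<Sum>u<?n. smult3 (c u) (bs ! u)) + smult3 (c ?n) g)"
    proof -
      have "smult3 (e u) (bs ! u) = - smult3 (1 / c ?n) (smult3 (c u) (bs ! u))" for u
        by (simp add: e_def smult3_smult3) (simp add: smult3_def single_uminus)
      then show ?thesis using \<open>c ?n \<noteq> 0\<close>
        by (simp add: smult3_add smult3_sum smult3_smult3 sum_negf)
    qed
    then have "vanishes (g - (\<Sum>u<?n. smult3 (e u) (bs ! u)))"
      using c(1) unfolding s by (simp add: vanishes_def eval3_smult3)
    then have "g - (\<Sum>u<?n. smult3 (e u) (bs ! u)) \<in> I"
      using I[OF forms_diff[OF g comb]] by blast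
    then show ?thesis by blast
  qed
  have "basis_of_component I j bs" unfolding basis_of_component_def
    using sub span bs(1) I[OF comb] by (simp add: Q_def)
  then show ?thesis by blast
qed

lemma hilb_basis:
  assumes "\<And>g. g \<in> forms j \<Longrightarrow> g \<in> I \<longleftrightarrow> vanishes g"
  obtains bs where "basis_of_component I j bs" "length bs = hilb I j"
  using someI_ex[OF basis_exists[OF assms]] unfolding hilb_def by blast

context
  fixes I j bs
  assumes I: "\<And>g. g \<in> forms j \<Longrightarrow> g \<in> I \<longleftrightarrow> vanishes g"
    and basis: "basis_of_component I j bs"
begin

lemma basis_forms: "u < length bs \<Longrightarrow> bs ! u \<in> forms j"
  using basis by (auto simp: basis_of_component_def)

lemma basis_comb_forms: "(\<Sum>u<length bs. smult3 (c u) (bs ! u)) \<in> forms j"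
  using basis_forms by (intro forms_sum forms_smult3) auto

lemma basis_independent:
  assumes "vanishes (\<Sum>u<length bs. smult3 (c u) (bs ! u))" "u < length bs"
  shows "c u = 0"
proof -
  have "(\<Sum>u<length bs. smult3 (c u) (bs ! u)) \<in> I" using I[OF basis_comb_forms] assms(1) by blast
  then show ?thesis using basis assms(2) unfolding basis_of_component_def by blast
qed

lemma length_basis_le: "length bs \<le> s"
  by (rule independent_mod_vanishing_bound[where n = "length bs" and f = "\<lambda>u. bs ! u"]) (use basis_independent in blast)

lemma relations_basisI:
  assumes y0: "\<And>i. i \<notin> {1..s} \<Longrightarrow> y i = 0"
    and y: "\<And>u. u < length bs \<Longrightarrow> (\<Sum>i=1..s. y i * eval3 (P i) (bs ! u)) = 0"
  shows "y \<in> relations j"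
  unfolding relations_def
proof (intro CollectI conjI allI impI ballI)
  fix g :: "'k pol" assume g: "g \<in> forms j"
  obtain c where c: "g - (\<Sum>u<length bs. smult3 (c u) (bs ! u)) \<in> I"
    using basis g unfolding basis_of_component_def by blast
  then have "vanishes (g - (\<Sum>u<length bs. smult3 (c u) (bs ! u)))"
    using I[OF forms_diff[OF g basis_comb_forms]] by blast
  then have ev: "eval3 (P i) g = (\<Sum>u<length bs. c u * eval3 (P i) (bs ! u))" if "i \<in> {1..s}" for i
    using that by (simp add: vanishes_def eval3_diff eval3_sum eval3_smult3)
  have "(\<Sum>i=1..s. y i * eval3 (P i) g) = (\<Sum>i=1..s. \<Sum>u<length bs. c u * (y i * eval3 (P i) (bs ! u)))"
    using ev by (intro sum.cong) (auto simp: sum_distrib_left ac_simps)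
  also have "\<dots> = (\<Sum>u<length bs. c u * (\<Sum>i=1..s. y i * eval3 (P i) (bs ! u)))"
    unfolding sum_distrib_left by (rule sum.swap)
  also have "\<dots> = 0" using y by simp
  finally show "(\<Sum>i=1..s. y i * eval3 (P i) g) = 0" .
qed (rule y0)

text \<open>
  The complement of a maximal set of points at which the values of a form of degree j can be
  prescribed arbitrarily.
\<close>

lemma determining_set:
  "\<exists>T\<subseteq>{1..s}. card T \<le> s - length bs \<and> (\<forall>z\<in>relations j. (\<forall>i\<in>T. z i = 0) \<longrightarrow> (\<forall>i. z i = 0))"
proof -
  define Q where "Q = (\<lambda>J. J \<subseteq> {1..s} \<and>
    (\<forall>i\<in>J. \<exists>w\<in>forms j. \<forall>i'\<in>J. eval3 (P i') w = (if i' = i then 1 else 0)))"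
  have "Q {}" by (simp add: Q_def)
  moreover have "card J < Suc s" if "Q J" for J
  proof -
    have "card J \<le> card {1..s}" using that by (intro card_mono) (auto simp: Q_def)
    then show ?thesis by simp
  qed
  ultimately obtain J where J: "Q J" "\<And>J'. Q J' \<Longrightarrow> card J' \<le> card J"
    using ex_has_greatest_nat[of Q "{}" card "Suc s"] by blast
  have sub: "J \<subseteq> {1..s}" using J(1) by (simp add: Q_def)
  then have finJ: "finite J" by (rule finite_subset) simp
  \<comment> \<open>With fewer points than basis elements some nontrivial combination vanishes on
    \<open>J\<close> and, by independence, not at some further point \<open>i1\<close>; correcting
    by it extends the interpolation to \<open>i1\<close>.\<close>
  have "length bs \<le> card J"
  proof (rule ccontr)
    assume "\<not> ?thesis"
    then obtain c where c: "\<exists>u\<in>{..<length bs}. c u \<noteq> 0"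
      "\<forall>i\<in>J. (\<Sum>u<length bs. eval3 (P i) (bs ! u) * c u) = 0"
      using homogeneous_system[OF finJ, of "{..<length bs}" "\<lambda>i u. eval3 (P i) (bs ! u)"] by auto
    define g where "g = (\<Sum>u<length bs. smult3 (c u) (bs ! u))"
    have g: "g \<in> forms j" unfolding g_def by (rule basis_comb_forms)
    have gJ: "eval3 (P i) g = 0" if "i \<in> J" for i
      using c(2) that by (simp add: g_def eval3_sum eval3_smult3 mult.commute)
    have "\<not> vanishes g" using basis_independent[of c] c(1) unfolding g_def by blast
    then obtain i1 where i1: "i1 \<in> {1..s}" "eval3 (P i1) g \<noteq> 0" by (auto simp: vanishes_def)
    then have "i1 \<notin> J" using gJ by blast
    have "Q (insert i1 J)" unfolding Q_def
    proof (intro conjI ballI)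
      show "insert i1 J \<subseteq> {1..s}" using sub i1 by simp
      fix i assume "i \<in> insert i1 J"
      show "\<exists>w\<in>forms j. \<forall>i'\<in>insert i1 J. eval3 (P i') w = (if i' = i then 1 else 0)"
      proof (cases "i = i1")
        case True
        then show ?thesis using i1 gJ \<open>i1 \<notin> J\<close> g
          by (intro bexI[of _ "smult3 (1 / eval3 (P i1) g) g"]) (auto simp: eval3_smult3 intro: forms_smult3)
      next
        case False
        then have "i \<in> J" using \<open>i \<in> insert i1 J\<close> by simp
        then obtain w where w: "w \<in> forms j" "\<forall>i'\<in>J. eval3 (P i') w = (if i' = i then 1 else 0)"
          using J(1) unfolding Q_def by blast
        let ?w = "w - smult3 (eval3 (P i1) w / eval3 (P i1) g) g"
        have "?w \<in> forms j" using w(1) g by (intro forms_diff forms_smult3)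
        then show ?thesis using w(2) gJ i1 False
          by (intro bexI[of _ ?w]) (auto simp: eval3_diff eval3_smult3)
      qed
    qed
    from J(2)[OF this] \<open>i1 \<notin> J\<close> finJ show False by simp
  qed
  moreover have "card ({1..s} - J) = s - card J" using sub finJ by (simp add: card_Diff_subset)
  moreover have "z i = 0" if z: "z \<in> relations j" and z0: "\<forall>i\<in>{1..s} - J. z i = 0" for z i
  proof (cases "i \<in> J")
    case True
    then obtain w where w: "w \<in> forms j" "\<forall>i'\<in>J. eval3 (P i') w = (if i' = i then 1 else 0)"
      using J(1) unfolding Q_def by blast
    have "(\<Sum>i'=1..s. z i' * eval3 (P i') w) = (\<Sum>i'=1..s. if i' = i then z i else 0)"
      using w(2) z0 True by (intro sum.cong) auto
    then show ?thesis using relations_sum[OF z w(1)] True sub by auto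
  next
    case False
    then show ?thesis using z0 relations_outside[OF z] by blast
  qed
  ultimately show ?thesis by (intro exI[of _ "{1..s} - J"]) auto
qed

end

lemma card_points: "card (P ` {1..s}) = s"
proof -
  have "inj_on P {1..s}"
  proof (rule inj_onI, rule ccontr)
    fix i j assume ij: "i \<in> {1..s}" "j \<in> {1..s}" "P i = P j" "i \<noteq> j"
    then have "same_point (P i) (P j)" unfolding same_point_def by (intro exI[of _ 1]) simp
    with distinct ij show False by blast
  qed
  then show ?thesis by (simp add: card_image)
qed

text \<open>The \<open>LEAST\<close> in \<open>tau\<close> is attained because degree
  \<open>s\<close> qualifies: a nonzero relation of degree \<open>s\<close> would need
  \<open>s + 2\<close> points in its support.\<close>

lemma hilb_tau: "hilb (vanishing_ideal (P ` {1..s})) (tau (P ` {1..s})) = s"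
proof -
  let ?I = "vanishing_ideal (P ` {1..s})"
  note V = vanishing_ideal_iff[where j = s]
  obtain bs where bs: "basis_of_component ?I s bs" "length bs = hilb ?I s"
    by (rule hilb_basis[of s ?I]) (rule V, assumption, rule that)
  have "\<not> length bs < s"
  proof
    assume "length bs < s"
    then obtain y where y: "\<exists>i\<in>{1..s}. y i \<noteq> 0"
      "\<forall>u\<in>{..<length bs}. (\<Sum>i=1..s. eval3 (P i) (bs ! u) * y i) = 0"
      using homogeneous_system[of "{..<length bs}" "{1..s}" "\<lambda>u i. eval3 (P i) (bs ! u)"] by auto
    let ?y = "\<lambda>i. if i \<in> {1..s} then y i else 0"
    have rel: "?y \<in> relations s"
      using y(2) by (intro relations_basisI[OF V bs(1)]) (auto simp: ac_simps)
    from y(1) obtain i where "i \<in> {1..s}" "y i \<noteq> 0" by blast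
    then have "?y i \<noteq> 0" by simp
    from support_of_relation[OF rel this] have "s + 2 \<le> card {i. ?y i \<noteq> 0}" .
    also have "\<dots> \<le> card {1..s}" by (intro card_mono) (auto split: if_splits)
    finally show False by simp
  qed
  then have "hilb ?I s = card (P ` {1..s})"
    using length_basis_le[OF V bs(1)] bs(2) card_points by simp
  then show ?thesis unfolding tau_def using card_points LeastI[of "\<lambda>i. hilb ?I i = card (P ` {1..s})"] by simp
qed

text \<open>Multiplying by a power of a coordinate that is nonzero at \<open>P i\<close> lowers the
  degree to \<open>t\<close> without killing the value at \<open>i\<close>.\<close>

lemma relations_eq_0_mono:
  assumes t: "\<And>z i. z \<in> relations t \<Longrightarrow> z i = 0" and n: "t \<le> n" and u: "u \<in> relations n"
  shows "u i = 0"
proof (cases "i \<in> {1..s}")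
  case True
  then obtain c where c: "P i c \<noteq> 0" using nonzero by (auto simp: fun_eq_iff)
  let ?g = "linform (\<lambda>e. if e = c then 1 else 0) ^ (n - t) :: 'k pol"
  have "?g \<in> forms (1 * (n - t))" by (intro forms_power linform_in_forms)
  then have "(\<lambda>i. eval3 (P i) ?g * u i) \<in> relations t"
    using u n by (intro relations_mult[of u "n - t" t]) auto
  from t[OF this, of i] c show ?thesis by (simp add: eval3_power eval3_linform_dot3 dot3_unit)
next
  case False
  then show ?thesis using relations_outside[OF u] by blast
qed

section \<open>Annihilators and Hessians of sums of powers\<close>

text \<open>If \<open>g\<close> annihilates F, applying all forms of the complementary degree
  \<open>d - j\<close> shows that the values \<open>\<alpha> i * eval3 (P i) g\<close> form a
  relation of that degree, which is zero as \<open>t \<le> d - j\<close>. So up to degree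
  \<open>d - t\<close> the annihilator agrees with the ideal of the points.\<close>

lemma Ann_iff:
  assumes \<alpha>: "\<And>i. i \<in> {1..s} \<Longrightarrow> \<alpha> i \<noteq> 0"
    and F: "F = (\<Sum>i=1..s. smult3 (\<alpha> i) (linform (P i) ^ d))"
    and t: "\<And>z i. z \<in> relations t \<Longrightarrow> z i = 0" and j: "j \<le> d" "t \<le> d - j" and g: "g \<in> forms j"
  shows "g \<in> Ann F \<longleftrightarrow> vanishes g"
proof
  have act: "g \<bullet>\<^sub>S F = (\<Sum>i=1..s. smult3 (fact d / fact (d - j) * \<alpha> i * eval3 (P i) g) (linform (P i) ^ (d - j)))"
    unfolding F by (rule act_sum_powers[OF g j(1)])
  show "g \<in> Ann F" if "vanishes g"
    using that act by (simp add: Ann_def vanishes_def)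
  assume "g \<in> Ann F"
  then have 0: "g \<bullet>\<^sub>S F = 0" by (simp add: Ann_def)
  define y where "y = (\<lambda>i. if i \<in> {1..s} then \<alpha> i * eval3 (P i) g else 0)"
  have "y \<in> relations (d - j)" unfolding relations_def
  proof (intro CollectI conjI ballI allI impI)
    fix h :: "'k pol" assume h: "h \<in> forms (d - j)"
    let ?c = "\<lambda>i. fact (d - j) / fact 0 * (fact d / fact (d - j) * \<alpha> i * eval3 (P i) g) * eval3 (P i) h"
    have "h \<bullet>\<^sub>S (g \<bullet>\<^sub>S F) = (\<Sum>i=1..s. smult3 (?c i) 1)"
      unfolding act using act_sum_powers[OF h order_refl, of _ P "{1..s}"] by simp
    moreover have "h \<bullet>\<^sub>S 0 = 0"
      using act_sum_powers[OF h order_refl, of _ P "{}"] by simp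
    ultimately have "smult3 (\<Sum>i=1..s. ?c i) 1 = 0" using 0 by (simp add: smult3_sum_left)
    then have "(\<Sum>i=1..s. ?c i) = 0"
      using lookup_smult3[of "\<Sum>i=1..s. ?c i" 1 0] by simp
    moreover have "(\<Sum>i=1..s. ?c i) = fact d * (\<Sum>i=1..s. y i * eval3 (P i) h)"
      unfolding sum_distrib_left by (intro sum.cong) (auto simp: y_def)
    ultimately show "(\<Sum>i=1..s. y i * eval3 (P i) h) = 0" by simp
  next
    fix i assume "i \<notin> {1..s}"
    then show "y i = 0" unfolding y_def by (rule if_not_P)
  qed
  then have "y i = 0" for i by (rule relations_eq_0_mono[rotated 2]) (fact t j(2))+
  then have "\<alpha> i * eval3 (P i) g = 0" if "i \<in> {1..s}" for i using that by (metis y_def)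
  then show "vanishes g" using \<alpha> by (simp add: vanishes_def)
qed

lemma hess_at_entry:
  assumes F: "F = (\<Sum>i=1..s. smult3 (\<alpha> i) (linform (P i) ^ d))"
    and bs: "set bs \<subseteq> forms j" and j: "2 * j \<le> d" and uv: "u < length bs" "v < length bs"
  shows "hess_at (linform a) F bs $$ (u, v) = fact d / fact (d - 2 * j) *
    (\<Sum>i=1..s. \<alpha> i * dot3 a (P i) ^ (d - 2 * j) * eval3 (P i) (bs ! u) * eval3 (P i) (bs ! v))"
proof -
  have "bs ! u * bs ! v \<in> forms (j + j)" using bs uv by (intro forms_mult) auto
  then have "bs ! u * bs ! v \<in> forms (2 * j)" by (simp add: mult_2)
  from act_sum_powers[OF this j, of \<alpha> P "{1..s}"]
  have "eval3 a ((bs ! u * bs ! v) \<bullet>\<^sub>S F) = (\<Sum>i=1..s. fact d / fact (d - 2 * j) * \<alpha> i * eval3 (P i) (bs ! u * bs ! v)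
      * eval3 a (linform (P i)) ^ (d - 2 * j))"
    unfolding F by (simp add: eval3_sum eval3_smult3 eval3_power)
  also have "\<dots> = fact d / fact (d - 2 * j) *
    (\<Sum>i=1..s. \<alpha> i * dot3 a (P i) ^ (d - 2 * j) * eval3 (P i) (bs ! u) * eval3 (P i) (bs ! v))"
    unfolding sum_distrib_left
    by (intro sum.cong) (auto simp: eval3_mult eval3_linform dot3_def ac_simps)
  finally show ?thesis using uv by (simp add: hess_at_def hess_def lookup_linform[unfolded One_nat_def])
qed

text \<open>At a point the Hessian is a weighted Gram matrix of the evaluation vectors of the basis.
  A kernel vector, read as the coefficients of a form \<open>g\<close>, thus makes the weighted
  values of \<open>g\<close> a relation; so \<open>g\<close> vanishes at the points, and
  independence of the basis makes the vector zero.\<close>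

lemma det_hess_at_nonzero:
  assumes F: "F = (\<Sum>i=1..s. smult3 (\<alpha> i) (linform (P i) ^ d))" and j: "2 * j \<le> d"
    and I: "\<And>g. g \<in> forms j \<Longrightarrow> g \<in> I \<longleftrightarrow> vanishes g"
    and basis: "basis_of_component I j bs"
    and nondeg: "\<And>g. g \<in> forms j \<Longrightarrow>
      (\<lambda>i. if i \<in> {1..s} then \<alpha> i * dot3 a (P i) ^ (d - 2 * j) * eval3 (P i) g else 0) \<in> relations j \<Longrightarrow>
      vanishes g"
  shows "det (hess_at (linform a) F bs) \<noteq> 0"
proof
  let ?n = "length bs" and ?H = "hess_at (linform a) F bs"
  have H: "?H \<in> carrier_mat ?n ?n" by (simp add: hess_at_def hess_def)
  assume "det ?H = 0"
  then obtain x where x: "x \<in> carrier_vec ?n" "x \<noteq> 0\<^sub>v ?n" "?H *\<^sub>v x = 0\<^sub>v ?n"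
    using det_0_iff_vec_prod_zero_field[OF H] by blast
  define g where "g = (\<Sum>u<?n. smult3 (x $ u) (bs ! u))"
  have g: "g \<in> forms j" unfolding g_def by (rule basis_comb_forms[OF I basis])
  let ?z = "\<lambda>i. if i \<in> {1..s} then \<alpha> i * dot3 a (P i) ^ (d - 2 * j) * eval3 (P i) g else 0"
  have "?z \<in> relations j"
  proof (rule relations_basisI[OF I basis])
    fix u assume u: "u < ?n"
    have bsf: "set bs \<subseteq> forms j" using basis by (simp add: basis_of_component_def)
    have "0 = (?H *\<^sub>v x) $ u" using x(3) u by simp
    also have "\<dots> = (\<Sum>v<?n. ?H $$ (u, v) * x $ v)"
      using H x(1) u by (simp add: scalar_prod_def atLeast0LessThan)
    also have "\<dots> = (\<Sum>v<?n. \<Sum>i=1..s. fact d / fact (d - 2 * j) *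
        (\<alpha> i * dot3 a (P i) ^ (d - 2 * j) * (x $ v * eval3 (P i) (bs ! v)) * eval3 (P i) (bs ! u)))"
      using u by (intro sum.cong) (auto simp: hess_at_entry[OF F bsf j] sum_distrib_left sum_distrib_right ac_simps)
    also have "\<dots> = (\<Sum>i=1..s. \<Sum>v<?n. fact d / fact (d - 2 * j) *
        (\<alpha> i * dot3 a (P i) ^ (d - 2 * j) * (x $ v * eval3 (P i) (bs ! v)) * eval3 (P i) (bs ! u)))"
      by (rule sum.swap)
    also have "\<dots> = fact d / fact (d - 2 * j) * (\<Sum>i=1..s. ?z i * eval3 (P i) (bs ! u))"
      unfolding g_def by (simp add: eval3_sum eval3_smult3 sum_distrib_left sum_distrib_right ac_simps)
    finally show "(\<Sum>i=1..s. ?z i * eval3 (P i) (bs ! u)) = 0" by simp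
  qed auto
  then have "vanishes g" using nondeg[OF g] by blast
  then have "x $ u = 0" if "u < ?n" for u
    using basis_independent[OF I basis, of "\<lambda>u. x $ u" u] that unfolding g_def by blast
  then have "x = 0\<^sub>v ?n" using x(1) by (intro eq_vecI) auto
  with x(2) show False by simp
qed

end

theorem theorem4p6:
  fixes P :: "nat \<Rightarrow> 3 \<Rightarrow> 'k::field_char_0"
    and \<alpha> :: "nat \<Rightarrow> 'k"
    and s d k :: nat
    and X :: "(3 \<Rightarrow> 'k) set"
    and F :: "'k pol"
  assumes nonzero: "\<And>i. i \<in> {1..s} \<Longrightarrow> P i \<noteq> (\<lambda>_. 0)"
    and distinct: "\<And>i j. i \<in> {1..s} \<Longrightarrow> j \<in> {1..s} \<Longrightarrow> i \<noteq> j \<Longrightarrow> \<not> same_point (P i) (P j)"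
    and X_def: "X = P ` {1..s}"
    and alpha: "\<And>i. i \<in> {1..s} \<Longrightarrow> \<alpha> i \<noteq> 0"
    and F_def: "F = (\<Sum>i=1..s. smult3 (\<alpha> i) (linform (P i) ^ d))"
    and F_nonzero: "F \<noteq> 0"
    and d: "d \<ge> 2 * tau X"
    and k: "1 \<le> k" "k < tau X"
    and diff_0: "first_diff (hilb (Ann F)) 0 = 1"
    and diff_1: "first_diff (hilb (Ann F)) 1 = 2"
    and diff_2: "\<And>i. k \<le> i \<Longrightarrow> i \<le> tau X \<Longrightarrow> first_diff (hilb (Ann F)) i = 2"
  shows "\<exists>l\<in>forms 1. \<forall>j. k - 1 \<le> j \<and> j \<le> d div 2 \<longrightarrow>
           (\<forall>bs. basis_of_component (Ann F) j bs \<longrightarrow> det (hess_at l F bs) \<noteq> 0)"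
proof -
  interpret plane_points P s by unfold_locales (fact nonzero distinct)+
  define t where "t = tau X"
  have d: "2 * t \<le> d" and kt: "1 \<le> k" "k < t" using d k by (simp_all add: t_def)
  have rel_t: "z i = 0" if z: "z \<in> relations t" for z i
  proof -
    note V = vanishing_ideal_iff[where j = t]
    obtain bs where bs: "basis_of_component (vanishing_ideal (P ` {1..s})) t bs"
      "length bs = hilb (vanishing_ideal (P ` {1..s})) t"
      by (rule hilb_basis[of t "vanishing_ideal (P ` {1..s})"]) (rule V, assumption, rule that)
    have "length bs = s" using bs(2) hilb_tau by (simp add: t_def X_def)
    then obtain T where T: "T \<subseteq> {1..s}" "card T \<le> 0" "\<forall>z\<in>relations t. (\<forall>i\<in>T. z i = 0) \<longrightarrow> (\<forall>i. z i = 0)"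
      using determining_set[OF V bs(1)] by auto
    then have "finite T" using finite_subset by blast
    with T(2) have "T = {}" by simp
    with T(3) z show ?thesis by blast
  qed
  have Ann: "g \<in> Ann F \<longleftrightarrow> vanishes g" if "g \<in> forms j" "j \<le> d - t" for g j
    by (rule Ann_iff[where \<alpha> = \<alpha> and d = d and t = t and j = j], erule alpha, rule F_def, erule rel_t)
       (use that d kt in auto)
  define h where "h = hilb (Ann F)"
  have h_t: "h t = s"
  proof -
    have "h t = hilb (vanishing_ideal (P ` {1..s})) t"
      unfolding h_def
    proof (rule hilb_cong)
      fix g :: "'k pol"
      assume g: "g \<in> forms t"
      have "t \<le> d - t" using d by simp
      from Ann[OF g this] vanishing_ideal_iff[OF g]
      show "g \<in> Ann F \<longleftrightarrow> g \<in> vanishing_ideal (P ` {1..s})" by blast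
    qed
    then show ?thesis using hilb_tau by (simp add: t_def X_def)
  qed
  \<comment> \<open>Downward from \<open>h t = s\<close> in steps of 2. The differences are given
    from degree \<open>k\<close> on, so the values are known from \<open>k - 1\<close> on; this is
    where the lower bound on \<open>j\<close> in the conclusion comes from.\<close>
  have h: "h j + 2 * (t - j) = s" if j: "k - 1 \<le> j" "j \<le> t" for j
    using j(2)
  proof (induction rule: inc_induct)
    case base
    then show ?case using h_t by simp
  next
    case (step n)
    have "first_diff h (Suc n) = 2"
      unfolding h_def using step(1,2) j(1) by (intro diff_2) (auto simp: t_def)
    then have "h (Suc n) = h n + 2" by (simp add: first_diff_def)
    then show ?case using step by simp
  qed
  have basis: "\<exists>bs. basis_of_component (Ann F) j bs \<and> length bs = h j" if "j \<le> t" for j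
  proof -
    have "j \<le> d - t" using that d by simp
    then have A: "g \<in> Ann F \<longleftrightarrow> vanishes g" if "g \<in> forms j" for g using Ann that by blast
    show ?thesis by (rule hilb_basis[of j "Ann F"], erule A) (auto simp: h_def)
  qed
  have determining: "\<exists>T\<subseteq>{1..s}. card T \<le> 2 * (t - j) \<and>
       (\<forall>z\<in>relations j. (\<forall>i\<in>T. z i = 0) \<longrightarrow> (\<forall>i. z i = 0))" if j: "k - 1 \<le> j" "j \<le> t" for j
  proof -
    obtain bs where bs: "basis_of_component (Ann F) j bs" "length bs = h j" using basis[OF j(2)] by blast
    have "j \<le> d - t" using j d by simp
    with Ann have A: "g \<in> Ann F \<longleftrightarrow> vanishes g" if "g \<in> forms j" for g using that by blast
    have "s - length bs = 2 * (t - j)" using h[OF j] bs(2) by simp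
    with determining_set[OF A bs(1)] show ?thesis by simp
  qed
  obtain u v where u: "u \<in> relations (t - 1)" and v: "v \<in> relations (t - 1)"
    and uv: "\<And>x y. \<forall>i. x * u i + y * v i = 0 \<Longrightarrow> x = 0 \<and> y = 0"
  proof -
    obtain bs where bs: "basis_of_component (Ann F) (t - 1) bs" "length bs = h (t - 1)"
      using basis[of "t - 1"] by auto
    have A: "g \<in> Ann F \<longleftrightarrow> vanishes g" if "g \<in> forms (t - 1)" for g
      using Ann[OF that] d by simp
    have len: "Suc (Suc (length bs)) = s" using h[of "t - 1"] kt bs(2) by simp
    define M where "M = (\<lambda>e i. eval3 (P i) (bs ! e))"
    have rel: "(\<lambda>i. if i \<in> {1..s} then y i else 0) \<in> relations (t - 1)"
      if "\<And>e. e < length bs \<Longrightarrow> (\<Sum>i=1..s. M e i * y i) = 0" for y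
      using that by (intro relations_basisI[OF A bs(1)]) (auto simp: M_def ac_simps)
    obtain y where y: "\<exists>i\<in>{1..s}. y i \<noteq> 0" "\<forall>e\<in>{..<length bs}. (\<Sum>i=1..s. M e i * y i) = 0"
      using homogeneous_system[of "{..<length bs}" "{1..s}" M] len by auto
    then obtain i0 where i0: "i0 \<in> {1..s}" "y i0 \<noteq> 0" by blast
    \<comment> \<open>\<open>s - 2\<close> equations in \<open>s\<close> unknowns leave room for one
      more: it makes the second solution vanish at \<open>i0\<close>, where the first does not, and
      so gives independence.\<close>
    let ?M = "\<lambda>e i. if e < length bs then M e i else if i = i0 then 1 else 0"
    obtain y' where y': "\<exists>i\<in>{1..s}. y' i \<noteq> 0" "\<forall>e\<in>{..length bs}. (\<Sum>i=1..s. ?M e i * y' i) = 0"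
      using homogeneous_system[of "{..length bs}" "{1..s}" ?M] len by auto
    then obtain i1 where i1: "i1 \<in> {1..s}" "y' i1 \<noteq> 0" by blast
    have M': "(\<Sum>i=1..s. M e i * y' i) = 0" if "e < length bs" for e
      using y'(2)[rule_format, of e] that by simp
    have "(\<Sum>i=1..s. ?M (length bs) i * y' i) = (\<Sum>i=1..s. if i = i0 then y' i0 else 0)"
      by (intro sum.cong) auto
    also have "\<dots> = y' i0" using i0(1) by simp
    finally have y'0: "y' i0 = 0" using y'(2)[rule_format, of "length bs"] by simp
    let ?u = "\<lambda>i. if i \<in> {1..s} then y i else 0" and ?v = "\<lambda>i. if i \<in> {1..s} then y' i else 0"
    show ?thesis
    proof (rule that[of ?u ?v])
      show "?u \<in> relations (t - 1)" by (rule rel) (use y(2) in blast)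
      show "?v \<in> relations (t - 1)" by (rule rel) (rule M')
      fix x z assume xz: "\<forall>i. x * ?u i + z * ?v i = 0"
      from xz[rule_format, of i0] i0 y'0 have "x = 0" by simp
      with xz[rule_format, of i1] i1 show "x = 0 \<and> z = 0" by simp
    qed
  qed
  interpret conic_points P s t k u v
    by unfold_locales (fact kt determining u v uv)+
  obtain a where a: "hessians_nondegenerate \<alpha> d a"
    using exists_hessians_nondegenerate[of \<alpha> d] alpha d by blast
  have a_nz: "dot3 a (P i) \<noteq> 0" if "i \<in> {1..s}" for i
    using a that unfolding hessians_nondegenerate_def by blast
  show ?thesis
  proof (intro bexI[of _ "linform a"] allI impI, elim conjE)
    fix j bs
    assume j: "k - 1 \<le> j" "j \<le> d div 2" and bs: "basis_of_component (Ann F) j bs"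
    have jd: "2 * j \<le> d" "j \<le> d - t" using j d by auto
    have A: "g \<in> Ann F \<longleftrightarrow> vanishes g" if "g \<in> forms j" for g using Ann[OF that jd(2)] .
    show "det (hess_at (linform a) F bs) \<noteq> 0"
    proof (rule det_hess_at_nonzero[OF F_def jd(1) A bs])
      fix g :: "'k pol"
      let ?z = "\<lambda>i. if i \<in> {1..s} then \<alpha> i * dot3 a (P i) ^ (d - 2 * j) * eval3 (P i) g else 0"
      assume g: "g \<in> forms j" and z: "?z \<in> relations j"
      show "vanishes g"
      proof (cases "j < t")
        case True
        then show ?thesis using a j(1) g z unfolding hessians_nondegenerate_def vanishes_def by blast
      next
        \<comment> \<open>From degree \<open>t\<close> on there are no nonzero relations, so it
          suffices that \<open>linform a\<close> misses the points.\<close>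
        case False
        have "?z i = 0" for i
          by (rule relations_eq_0_mono[where t = t and n = j and u = ?z], erule rel_t) (use z False in auto)
        then have "\<alpha> i * dot3 a (P i) ^ (d - 2 * j) * eval3 (P i) g = 0" if "i \<in> {1..s}" for i
          using that by meson
        then show ?thesis using alpha a_nz by (simp add: vanishes_def)
      qed
    qed
  qed (rule linform_in_forms)
qed

end
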